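(* Let $U\subset\mathbb{R}^m$ be open, let $X,Y$ be real separable Hilbert spaces, and let $F:U\to\mathcal{L}(X,Y)$ be real analytic in the operator norm. Let $R:U\to\mathbb{R}^r$ be $C^1$. Assume that for all $p,q\in U$, $$F(p)=F(q)\quad\Longrightarrow\quad R(p)=R(q).$$ Then for every compact set $K\subset U$ there exist constants $C>0$ and $\theta\in(0,1]$ such that $$|R(p)-R(q)|\le C\,\|F(p)-F(q)\|_{\mathcal{L}(X,Y)}^{\theta}\qquad\text{for all }p,q\in K.$$
   Context: $\mathcal{L}(X,Y)$ denotes the Banach space of bounded linear operators $X\to Y$ with the operator norm. For a real Banach space $B$ and an open set $U\subset\mathbb{R}^m$, a map $F:U\to B$ is real analytic if for every $p_0\in U$ there are continuous symmetric multilinear maps $A_k:(\mathbb{R}^m)^k\to B$, $k\ge 0$, such that $F(p_0+h)=\sum_{k=0}^\infty A_k(h,\ldots,h)$ for all sufficiently small $h$, with convergence in the norm of $B$. "Real analytic in the operator norm" means this with $B=\mathcal{L}(X,Y)$. *)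

theory Defs
  imports "HOL-Analysis.Analysis"
begin

(* An element of the k-fold power of 'a is an extensional function on {..<k};
   continuity refers to the product topology on that power. *)
definition continuous_symmetric_multilinear ::
  "nat \<Rightarrow> ((nat \<Rightarrow> 'a::real_normed_vector) \<Rightarrow> 'b::real_normed_vector) \<Rightarrow> bool"
  where "continuous_symmetric_multilinear k A \<longleftrightarrow>
    (\<forall>v \<in> {..<k} \<rightarrow>\<^sub>E UNIV. \<forall>i<k. linear (\<lambda>x. A (v(i := x)))) \<and>
    (\<forall>v \<in> {..<k} \<rightarrow>\<^sub>E UNIV. \<forall>\<pi>. \<pi> permutes {..<k} \<longrightarrow> A (v \<circ> \<pi>) = A v) \<and>
    continuous_map (product_topology (\<lambda>_. euclidean) {..<k}) euclidean A"

(* Intended for open U: only then do the values of F near p0 lie in its domain.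
   For 'b a type of bounded operators, the convergence in sums is in operator norm. *)
definition real_analytic_on ::
  "('a::real_normed_vector \<Rightarrow> 'b::real_normed_vector) \<Rightarrow> 'a set \<Rightarrow> bool"
  (infix \<open>real'_analytic'_on\<close> 50)
  where "F real_analytic_on U \<longleftrightarrow>
    (\<forall>p0\<in>U. \<exists>A :: nat \<Rightarrow> (nat \<Rightarrow> 'a) \<Rightarrow> 'b.
      (\<forall>k. continuous_symmetric_multilinear k (A k)) \<and>
      (\<exists>\<epsilon>>0. \<forall>h. norm h < \<epsilon> \<longrightarrow> (\<lambda>k. A k (\<lambda>i\<in>{..<k}. h)) sums F (p0 + h)))"

(* The library's C1_differentiable_on covers only functions of one real variable. *)
definition continuously_differentiable_on ::
  "('a::real_normed_vector \<Rightarrow> 'b::real_normed_vector) \<Rightarrow> 'a set \<Rightarrow> bool"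
  (infix \<open>continuously'_differentiable'_on\<close> 50)
  where "f continuously_differentiable_on U \<longleftrightarrow>
    (\<exists>f' :: 'a \<Rightarrow> 'a \<Rightarrow>\<^sub>L 'b.
      (\<forall>x\<in>U. (f has_derivative blinfun_apply (f' x)) (at x)) \<and> continuous_on U f')"

end

theory Submission
  imports Defs "HOL-Complex_Analysis.Conformal_Mappings"
begin

text \<open>
  The assertion is a Lojasiewicz inequality for \<open>norm (R p - R q)\<close> against \<open>norm (F p - F q)\<close> on \<open>U \<times> U\<close>.
  Separability yields countably many functionals \<open>l k\<close> of norm at most one that separate operators,
  and \<open>f (p, q) = (\<Sum>k. (1 / 2) ^ k * (l k (F p) - l k (F q))\<^sup>2)\<close> is a scalar real analytic function with the same
  zeros as \<open>norm (F p - F q)\<close> and \<open>f (p, q) \<le> 2 * (norm (F p - F q))\<^sup>2\<close>. Its analyticity requires a common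
  complex neighborhood for all \<open>l k \<circ> F\<close>; Baire's theorem and polarization bound the coefficients of the
  power series of \<open>F\<close> geometrically.

  So it is enough that a Lipschitz function \<open>g\<close> vanishing on the zeros of an analytic \<open>f\<close> satisfies
  \<open>\<bar>g\<bar> ^ n \<le> C * \<bar>f\<bar>\<close> locally. If \<open>f\<close> is a monomial times a unit, then \<open>g\<close> is bounded by a multiple of the distance to each
  of the coordinate hyperplanes on which \<open>f\<close> vanishes, and the inequality follows. The general
  case is reduced to this one by finitely many analytic substitutions whose compact pieces cover a
  neighborhood. By induction on the number of variables and on the order \<open>d\<close> of \<open>f\<close> in one variable
  \<open>t\<close>: a Tschirnhausen transformation gives \<open>f = (\<Sum>i<d - 1. c i * t ^ i) + t ^ d * u\<close>, the coefficients \<open>c i\<close>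
  are brought to monomial form by the induction hypothesis, power substitutions make their slopes
  integral, and blow-ups lower the slopes or the order.
\<close>

section \<open>Functions holomorphic along curves\<close>

text \<open>The inequality compares values at a single point, so it may be checked at any preimage
  of that point. The charts are therefore analytic maps whose compact pieces jointly cover a
  neighborhood, which puts shears, blow-ups and power substitutions on the same footing. The
  function \<open>g\<close>, being merely Lipschitz, is only pulled back and never resolved. The
  price is that every later step takes place at all points of the compact pieces and not only at the
  center. Hence germ properties are always shown at all nearby points, monomials may be centered
  away from the base point, and the radii of the charts are chosen uniformly. In the induction on
  the order the function is a product: a factor free of \<open>t\<close>, and the factor whose order
  is lowered. A blow-up splits off powers of another coordinate, which are collected in the first
  factor. Exponents found on different pieces can be combined because \<open>g\<close> is scaled to
  absolute value at most 1. The squares in the scalar function lead to the final exponent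
  \<open>2 / (n + 2)\<close>, with \<open>n\<close> the exponent in the scalar inequality.\<close>

definition cvec :: "real ^ 'k \<Rightarrow> complex ^ 'k" where
  "cvec x = (\<chi> i. of_real (x $ i))"

text \<open>Holomorphy is tested on curves only, so that the chain rule is immediate and no theory of several
  complex variables is needed.\<close>
definition hol :: "(complex ^ 'k \<Rightarrow> complex) \<Rightarrow> (complex ^ 'k) set \<Rightarrow> bool" where
  "hol F S \<longleftrightarrow> continuous_on S F \<and>
    (\<forall>\<gamma> D. open D \<longrightarrow> (\<forall>i. (\<lambda>t. \<gamma> t $ i) holomorphic_on D) \<longrightarrow> \<gamma> ` D \<subseteq> S \<longrightarrow>
      (\<lambda>t. F (\<gamma> t)) holomorphic_on D)"

lemma holD_cont: "hol F S \<Longrightarrow> continuous_on S F"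
  by (simp add: hol_def)

lemma holD_curve:
  assumes "hol F S" "open D" "\<And>i. (\<lambda>t. \<gamma> t $ i) holomorphic_on D" "\<And>t. t \<in> D \<Longrightarrow> \<gamma> t \<in> S"
  shows "(\<lambda>t. F (\<gamma> t)) holomorphic_on D"
proof -
  have "\<gamma> ` D \<subseteq> S"
    using assms(4) by blast
  then show ?thesis
    using assms(1-3) unfolding hol_def by blast
qed

lemma hol_subset: "hol F S \<Longrightarrow> T \<subseteq> S \<Longrightarrow> hol F T"
  unfolding hol_def by (meson continuous_on_subset order_trans)

lemma hol_cong: "hol F S \<Longrightarrow> (\<And>z. z \<in> S \<Longrightarrow> G z = F z) \<Longrightarrow> hol G S"
  unfolding hol_def
  by (auto simp: image_subset_iff cong: continuous_on_cong holomorphic_cong)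

lemma hol_const [intro]: "hol (\<lambda>z. c) S"
  by (auto simp: hol_def)

lemma hol_coord [intro]: "hol (\<lambda>z. z $ i) S"
  by (auto simp: hol_def intro!: continuous_intros)

lemma hol_add [intro]: "hol F S \<Longrightarrow> hol G S \<Longrightarrow> hol (\<lambda>z. F z + G z) S"
  by (auto simp: hol_def intro!: continuous_intros holomorphic_intros)

lemma hol_mult [intro]: "hol F S \<Longrightarrow> hol G S \<Longrightarrow> hol (\<lambda>z. F z * G z) S"
  by (auto simp: hol_def intro!: continuous_intros holomorphic_intros)

lemma hol_diff [intro]: "hol F S \<Longrightarrow> hol G S \<Longrightarrow> hol (\<lambda>z. F z - G z) S"
  by (auto simp: hol_def intro!: continuous_intros holomorphic_intros)

lemma hol_power [intro]: "hol F S \<Longrightarrow> hol (\<lambda>z. F z ^ n) S"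
  by (auto simp: hol_def intro!: continuous_intros holomorphic_intros)

lemma hol_sum [intro]: "(\<And>i. i \<in> I \<Longrightarrow> hol (F i) S) \<Longrightarrow> hol (\<lambda>z. \<Sum>i\<in>I. F i z) S"
  by (induction I rule: infinite_finite_induct) auto

lemma hol_prod [intro]: "(\<And>i. i \<in> I \<Longrightarrow> hol (F i) S) \<Longrightarrow> hol (\<lambda>z. \<Prod>i\<in>I. F i z) S"
  by (induction I rule: infinite_finite_induct) auto

lemma hol_divide:
  assumes "hol F S" "hol G S" "\<And>z. z \<in> S \<Longrightarrow> G z \<noteq> 0"
  shows "hol (\<lambda>z. F z / G z) S"
  using assms by (auto simp: hol_def image_subset_iff intro!: continuous_intros holomorphic_intros)

lemma hol_compose:
  assumes F: "hol F T" and P: "\<And>i. hol (\<lambda>z. P z $ i) S" and PS: "\<And>z. z \<in> S \<Longrightarrow> P z \<in> T"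
  shows "hol (\<lambda>z. F (P z)) S"
  unfolding hol_def
proof (intro conjI allI impI)
  have "continuous_on S (\<lambda>z. \<chi> i. P z $ i)"
    using P by (intro continuous_on_vec_lambda) (auto simp: hol_def)
  then have cP: "continuous_on S P"
    by simp
  then show "continuous_on S (\<lambda>z. F (P z))"
    using continuous_on_compose2[OF holD_cont[OF F] cP] PS by auto
next
  fix \<gamma> :: "complex \<Rightarrow> complex ^ 'b" and D
  assume D: "open D" "\<forall>i. (\<lambda>t. \<gamma> t $ i) holomorphic_on D" "\<gamma> ` D \<subseteq> S"
  then have "(\<lambda>t. P (\<gamma> t) $ i) holomorphic_on D" for i
    by (intro holD_curve[OF P]) auto
  then show "(\<lambda>t. F (P (\<gamma> t))) holomorphic_on D"
    using D PS by (intro holD_curve[OF F]) auto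
qed

lemma hol_uniform_limit:
  assumes F: "\<And>n. hol (F n) S" and lim: "uniform_limit S F G sequentially"
  shows "hol G S"
  unfolding hol_def
proof (intro conjI allI impI)
  show "continuous_on S G"
    by (rule uniform_limit_theorem[OF _ lim]) (auto intro!: always_eventually holD_cont F)
next
  fix \<gamma> :: "complex \<Rightarrow> complex ^ 'a" and D
  assume D: "open D" "\<forall>i. (\<lambda>t. \<gamma> t $ i) holomorphic_on D" "\<gamma> ` D \<subseteq> S"
  show "(\<lambda>t. G (\<gamma> t)) holomorphic_on D"
  proof (rule holomorphic_uniform_sequence[OF D(1)])
    show "(\<lambda>t. F n (\<gamma> t)) holomorphic_on D" for n
      using D by (intro holD_curve[OF F]) auto
    show "\<exists>d>0. cball x d \<subseteq> D \<and>
        uniform_limit (cball x d) (\<lambda>n t. F n (\<gamma> t)) (\<lambda>t. G (\<gamma> t)) sequentially"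
      if x: "x \<in> D" for x
    proof -
      obtain d where d: "d > 0" "cball x d \<subseteq> D"
        using D(1) x open_contains_cball by blast
      then have "\<gamma> t \<in> S" if "t \<in> cball x d" for t
        using D(3) that by blast
      then have "uniform_limit (cball x d) (\<lambda>n t. F n (\<gamma> t)) (\<lambda>t. G (\<gamma> t)) sequentially"
        using lim unfolding uniform_limit_iff by (auto elim!: eventually_mono)
      then show ?thesis
        using d by blast
    qed
  qed
qed

text \<open>Morera's theorem along each curve: the integrals over the sides of a triangle are
  exchanged with the circle integral, and the inner ones add up to zero by Cauchy's theorem.
  Quotients, Taylor coefficients and implicit functions are all written as such integrals, which
  makes them holomorphic in the parameter.\<close>

lemma hol_circle_integral:
  assumes r: "r > 0"
    and H: "continuous_on (S \<times> sphere c r) (\<lambda>(z, w). H z w)"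
    and hH: "\<And>w. w \<in> sphere c r \<Longrightarrow> hol (\<lambda>z. H z w) S"
  shows "hol (\<lambda>z. contour_integral (circlepath c r) (H z)) S"
proof -
  define \<rho> where "\<rho> = circlepath c r"
  have \<rho>im: "path_image \<rho> = sphere c r"
    using r by (simp add: \<rho>_def path_image_circlepath)
  have \<rho>in: "\<rho> x \<in> sphere c r" if "x \<in> {0..1}" for x
    using that \<rho>im by (auto simp: path_image_def)
  have c\<rho>: "continuous_on {0..1} \<rho>"
    using valid_path_imp_path[of \<rho>] by (auto simp: path_def \<rho>_def)
  have vd\<rho>: "vector_derivative \<rho> (at x) = 2 * pi * \<i> * r * exp (2 * complex_of_real pi * \<i> * x)" for x
    by (simp add: \<rho>_def vector_derivative_circlepath)
  have cts: "continuous_on S (\<lambda>z. contour_integral \<rho> (H z))"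
  proof -
    have c: "continuous_on (S \<times> cbox 0 1)
       (\<lambda>(z, x). H z (\<rho> x) * (2 * pi * \<i> * r * exp (2 * complex_of_real pi * \<i> * of_real x)))"
      unfolding case_prod_beta
    proof (intro continuous_on_mult)
      have "continuous_on (S \<times> cbox 0 1) (\<lambda>p. (\<lambda>(z, w). H z w) (fst p, \<rho> (snd p)))"
      proof (rule continuous_on_compose2[OF H])
        show "continuous_on (S \<times> cbox 0 1) (\<lambda>x. (fst x, \<rho> (snd x)))"
          by (intro continuous_intros continuous_on_compose2[OF c\<rho>]) auto
      qed (use \<rho>in in auto)
      then show "continuous_on (S \<times> cbox 0 1) (\<lambda>p. H (fst p) (\<rho> (snd p)))"
        by simp
    qed (intro continuous_intros)+
    have "continuous_on S (\<lambda>z. integral (cbox 0 1)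
       (\<lambda>x. H z (\<rho> x) * (2 * pi * \<i> * r * exp (2 * complex_of_real pi * \<i> * of_real x))))"
      by (rule integral_continuous_on_param[OF c])
    moreover have "contour_integral \<rho> (H z) = integral (cbox 0 1)
       (\<lambda>x. H z (\<rho> x) * (2 * pi * \<i> * r * exp (2 * complex_of_real pi * \<i> * of_real x)))" for z
      unfolding contour_integral_integral cbox_interval
      by (intro integral_cong) (simp only: vd\<rho>)
    ultimately show ?thesis
      by simp
  qed
  have "(\<lambda>t. contour_integral \<rho> (H (\<gamma> t))) holomorphic_on D"
    if D: "open D" "\<forall>i. (\<lambda>t. \<gamma> t $ i) holomorphic_on D" "\<gamma> ` D \<subseteq> S" for \<gamma> D
  proof -
    have "continuous_on D (\<lambda>t. \<chi> i. \<gamma> t $ i)"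
      using D by (intro continuous_on_vec_lambda holomorphic_on_imp_continuous_on) auto
    then have c\<gamma>: "continuous_on D \<gamma>"
      by simp
    have H\<gamma>: "continuous_on (D \<times> sphere c r) (\<lambda>(t, w). H (\<gamma> t) w)"
    proof -
      have "continuous_on (D \<times> sphere c r) (\<lambda>p. (\<lambda>(z, w). H z w) (\<gamma> (fst p), snd p))"
        using D(3)
        by (intro continuous_on_compose2[OF H] continuous_intros continuous_on_compose2[OF c\<gamma>]) auto
      then show ?thesis
        by (simp add: case_prod_beta)
    qed
    have hol1: "(\<lambda>t. H (\<gamma> t) w) holomorphic_on D" if "w \<in> sphere c r" for w
      using D by (intro holD_curve[OF hH[OF that]]) auto
    have "(\<lambda>t. contour_integral \<rho> (H (\<gamma> t))) analytic_on D"
    proof (rule Morera_triangle)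
      show "continuous_on D (\<lambda>t. contour_integral \<rho> (H (\<gamma> t)))"
        using continuous_on_compose2[OF cts c\<gamma>] D(3) by auto
      show "open D" by fact
      fix p q s :: complex
      have swap: "contour_integral (linepath a b) (\<lambda>t. contour_integral \<rho> (H (\<gamma> t))) =
            contour_integral \<rho> (\<lambda>w. contour_integral (linepath a b) (\<lambda>t. H (\<gamma> t) w))"
        if "closed_segment a b \<subseteq> D" for a b
      proof (rule contour_integral_swap)
        show "continuous_on (path_image (linepath a b) \<times> path_image \<rho>) (\<lambda>(y1, y2). H (\<gamma> y1) y2)"
          by (rule continuous_on_subset[OF H\<gamma>]) (use that \<rho>im in auto)
        have "continuous_on {0..1} (\<lambda>x::real. 2 * pi * \<i> * r * exp (2 * complex_of_real pi * \<i> * x))"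
          by (intro continuous_intros)
        then show "continuous_on {0..1} (\<lambda>t. vector_derivative \<rho> (at t))"
          by (simp add: vd\<rho>)
      qed (auto simp: \<rho>_def)
      have integ: "(\<lambda>w. contour_integral (linepath a b) (\<lambda>t. H (\<gamma> t) w)) contour_integrable_on \<rho>"
        if ab: "closed_segment a b \<subseteq> D" for a b
        unfolding \<rho>_def
      proof (rule contour_integrable_continuous_circlepath)
        have "continuous_on (sphere c r \<times> cbox 0 1) (\<lambda>(w, x). H (\<gamma> (linepath a b x)) w * (b - a))"
        proof -
          have "linepath a b x \<in> D" if "x \<in> {0..1}" for x
            using that ab by (auto simp: linepath_in_path)
          then have "continuous_on (sphere c r \<times> cbox 0 1)
              (\<lambda>p. (\<lambda>(t, w). H (\<gamma> t) w) (linepath a b (snd p), fst p))"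
            by (intro continuous_on_compose2[OF H\<gamma>] continuous_intros
                continuous_on_compose2[OF continuous_on_linepath[of UNIV a b]]) auto
          then show ?thesis
            by (auto simp: case_prod_beta intro!: continuous_intros)
        qed
        from integral_continuous_on_param[OF this]
        show "continuous_on (path_image (circlepath c r))
           (\<lambda>w. contour_integral (linepath a b) (\<lambda>t. H (\<gamma> t) w))"
          using r unfolding contour_integral_integral
          by (simp add: path_image_circlepath)
      qed
      show "convex hull {p, q, s} \<subseteq> D \<longrightarrow>
         contour_integral (linepath p q) (\<lambda>t. contour_integral \<rho> (H (\<gamma> t))) +
         contour_integral (linepath q s) (\<lambda>t. contour_integral \<rho> (H (\<gamma> t))) +
         contour_integral (linepath s p) (\<lambda>t. contour_integral \<rho> (H (\<gamma> t))) = 0"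
      proof
        assume hull: "convex hull {p, q, s} \<subseteq> D"
        have seg: "closed_segment p q \<subseteq> D" "closed_segment q s \<subseteq> D" "closed_segment s p \<subseteq> D"
          using order_trans[OF segments_subset_convex_hull(1)[of p q s] hull]
            order_trans[OF segments_subset_convex_hull(3)[of q s p] hull]
            order_trans[OF segments_subset_convex_hull(5)[of s p q] hull] by simp_all
        have zero: "contour_integral (linepath p q) (\<lambda>t. H (\<gamma> t) w) +
           contour_integral (linepath q s) (\<lambda>t. H (\<gamma> t) w) +
           contour_integral (linepath s p) (\<lambda>t. H (\<gamma> t) w) = 0" if "w \<in> sphere c r" for w
        proof -
          have "(\<lambda>t. H (\<gamma> t) w) holomorphic_on convex hull {p, q, s}"
            using hol1[OF that] hull holomorphic_on_subset by blast
          from Cauchy_theorem_triangle[OF this]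
          have "contour_integral (linepath p q +++ linepath q s +++ linepath s p) (\<lambda>t. H (\<gamma> t) w) = 0"
            by (rule contour_integral_unique)
          moreover have "(\<lambda>t. H (\<gamma> t) w) contour_integrable_on linepath a b" if "closed_segment a b \<subseteq> D" for a b
            by (rule contour_integrable_continuous_linepath)
               (rule continuous_on_subset[OF holomorphic_on_imp_continuous_on[OF hol1[OF \<open>w \<in> sphere c r\<close>]] that])
          ultimately show ?thesis
            using seg by (simp add: add.assoc)
        qed
        have "contour_integral (linepath p q) (\<lambda>t. contour_integral \<rho> (H (\<gamma> t))) +
         contour_integral (linepath q s) (\<lambda>t. contour_integral \<rho> (H (\<gamma> t))) +
         contour_integral (linepath s p) (\<lambda>t. contour_integral \<rho> (H (\<gamma> t))) =
         contour_integral \<rho> (\<lambda>w. contour_integral (linepath p q) (\<lambda>t. H (\<gamma> t) w) +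
           contour_integral (linepath q s) (\<lambda>t. H (\<gamma> t) w) +
           contour_integral (linepath s p) (\<lambda>t. H (\<gamma> t) w))"
          by (simp only: swap[OF seg(1)] swap[OF seg(2)] swap[OF seg(3)]
              contour_integral_add[OF integ[OF seg(1)] integ[OF seg(2)]]
              contour_integral_add[OF contour_integrable_add[OF integ[OF seg(1)] integ[OF seg(2)]] integ[OF seg(3)]])
        also have "\<dots> = contour_integral \<rho> (\<lambda>w. 0)"
          by (rule contour_integral_cong) (use zero \<rho>im in auto)
        finally show "contour_integral (linepath p q) (\<lambda>t. contour_integral \<rho> (H (\<gamma> t))) +
         contour_integral (linepath q s) (\<lambda>t. contour_integral \<rho> (H (\<gamma> t))) +
         contour_integral (linepath s p) (\<lambda>t. contour_integral \<rho> (H (\<gamma> t))) = 0"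
          by simp
      qed
    qed
    then show ?thesis
      by (rule analytic_imp_holomorphic)
  qed
  with cts show ?thesis
    by (auto simp: hol_def \<rho>_def)
qed

section \<open>Vectors with one coordinate replaced\<close>

definition upd :: "'a ^ 'k \<Rightarrow> 'k \<Rightarrow> 'a \<Rightarrow> 'a ^ 'k" where
  "upd x k t = (\<chi> i. if i = k then t else x $ i)"

lemma upd_nth [simp]: "upd x k t $ i = (if i = k then t else x $ i)"
  by (simp add: upd_def)

lemma upd_same [simp]: "upd x k (x $ k) = x"
  by (simp add: vec_eq_iff)

lemma upd_upd [simp]: "upd (upd x k s) k t = upd x k t"
  by (simp add: vec_eq_iff)

lemma cvec_nth [simp]: "cvec x $ i = of_real (x $ i)"
  by (simp add: cvec_def)

lemma cvec_upd: "cvec (upd x k t) = upd (cvec x) k (of_real t)"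
  by (simp add: vec_eq_iff)

lemma upd_axis: "upd x k t = x + axis k (t - x $ k)" for x :: "'a::comm_ring_1 ^ 'k"
  by (simp add: vec_eq_iff axis_def)

lemma norm_axis_eq: "norm (axis k x :: 'a::real_normed_field ^ 'k) = norm x"
  unfolding norm_vec_def L2_set_def axis_def
  by (simp add: if_distrib[of norm] if_distrib[of "\<lambda>x. x\<^sup>2"] cong: if_cong)

lemma dist_upd_le:
  fixes x :: "'a::real_normed_field ^ 'k"
  shows "dist (upd x k t) a \<le> 2 * dist x a + dist t (a $ k)"
proof -
  have "dist (upd x k t) a \<le> dist x a + norm (t - x $ k)"
    unfolding upd_axis dist_norm
    using norm_triangle_ineq[of "x - a" "axis k (t - x $ k)"] by (simp add: algebra_simps norm_axis_eq)
  also have "norm (t - x $ k) \<le> dist t (a $ k) + dist (x $ k) (a $ k)"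
    by (metis dist_norm dist_triangle2)
  also have "dist (x $ k) (a $ k) \<le> dist x a"
    by (rule dist_vec_nth_le)
  finally show ?thesis
    by simp
qed

lemma dist_upd_self:
  fixes x :: "'a::real_normed_field ^ 'k"
  shows "dist (upd x k t) x = dist t (x $ k)"
  by (simp add: upd_axis dist_norm norm_axis_eq)

lemma continuous_on_upd [continuous_intros]:
  assumes "continuous_on S f" "continuous_on S g"
  shows "continuous_on S (\<lambda>x. upd (f x) k (g x))"
  unfolding upd_def
proof (rule continuous_on_vec_lambda)
  show "continuous_on S (\<lambda>x. if i = k then g x else f x $ i)" for i
    using assms by (cases "i = k") (auto intro!: continuous_intros)
qed

lemma tendsto_upd [tendsto_intros]:
  assumes "(f \<longlongrightarrow> x) F" "(g \<longlongrightarrow> t) F"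
  shows "((\<lambda>y. upd (f y) k (g y)) \<longlongrightarrow> upd x k t) F"
proof (rule vec_tendstoI)
  show "((\<lambda>y. upd (f y) k (g y) $ i) \<longlongrightarrow> upd x k t $ i) F" for i
    using assms by (cases "i = k") (auto intro!: tendsto_intros)
qed

lemma norm_cvec [simp]: "norm (cvec x) = norm x"
  by (simp add: norm_vec_def L2_set_def)

lemma cvec_diff: "cvec (x - y) = cvec x - cvec y"
  by (simp add: vec_eq_iff)

lemma dist_cvec [simp]: "dist (cvec x) (cvec y) = dist x y"
  by (metis cvec_diff dist_norm norm_cvec)

lemma cvec_in_ball [simp]: "cvec x \<in> ball (cvec a) e \<longleftrightarrow> x \<in> ball a e"
  by simp

lemma hol_ball_mono: "hol F (ball c e) \<Longrightarrow> d \<le> e \<Longrightarrow> hol F (ball c d)"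
  using hol_subset subset_ball by blast

text \<open>Schwarz reflection: conjugation is applied both to the curve, with its parameter domain,
  and to the value, so that holomorphy is preserved.\<close>

lemma hol_cnj:
  assumes F: "hol F (ball (cvec a) e)"
  shows "hol (\<lambda>z. cnj (F (\<chi> i. cnj (z $ i)))) (ball (cvec a) e)"
proof -
  define c :: "complex ^ 'a \<Rightarrow> complex ^ 'a" where "c z = (\<chi> i. cnj (z $ i))" for z
  have [simp]: "c z $ i = cnj (z $ i)" for z i
    by (simp add: c_def)
  have "dist (cvec a) (c z) = dist (cvec a) z" for z
  proof -
    have "dist (cvec a $ i) (c z $ i) = dist (cvec a $ i) (z $ i)" for i
      by (metis \<open>\<And>z i. c z $ i = cnj (z $ i)\<close> complex_cnj_complex_of_real complex_cnj_diff
          complex_mod_cnj cvec_nth dist_norm)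
    then show ?thesis
      by (simp add: dist_vec_def)
  qed
  then have cb: "c z \<in> ball (cvec a) e \<longleftrightarrow> z \<in> ball (cvec a) e" for z
    by simp
  have "continuous_on UNIV c"
    unfolding c_def by (intro continuous_on_vec_lambda continuous_intros)
  then have cont: "continuous_on (ball (cvec a) e) (\<lambda>z. cnj (F (c z)))"
    by (intro continuous_intros continuous_on_compose2[OF holD_cont[OF F]])
       (use cb in \<open>auto intro: continuous_on_subset\<close>)
  have "(\<lambda>t. cnj (F (c (\<gamma> t)))) holomorphic_on D"
    if D: "open D" "\<forall>i. (\<lambda>t. \<gamma> t $ i) holomorphic_on D" "\<gamma> ` D \<subseteq> ball (cvec a) e" for \<gamma> D
  proof -
    have D': "cnj ` cnj ` D = D"
      by (auto simp: image_image)
    have oD: "open (cnj ` D)"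
      using D(1) unfolding image_cnj_conv_vimage_cnj by (intro open_vimage) auto
    have "(\<lambda>t. F (c (\<gamma> (cnj t)))) holomorphic_on cnj ` D"
    proof (rule holD_curve[OF F oD])
      show "(\<lambda>t. c (\<gamma> (cnj t)) $ i) holomorphic_on cnj ` D" for i
        using holomorphic_on_compose_cnj_cnj[of "\<lambda>t. \<gamma> t $ i" "cnj ` D"] D oD
        by (simp add: D' o_def)
      show "c (\<gamma> (cnj t)) \<in> ball (cvec a) e" if "t \<in> cnj ` D" for t
        using that D(3) unfolding cb by force
    qed
    then show ?thesis
      using holomorphic_on_compose_cnj_cnj[of "\<lambda>t. F (c (\<gamma> (cnj t)))" D] D(1)
      by (simp add: o_def)
  qed
  then show ?thesis
    using cont unfolding hol_def c_def by blast
qed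

text \<open>Encoded by a complex extension instead of a power series, so that algebra, composition,
  limits and parameter integrals come from \<open>hol\<close>.\<close>

definition ranalytic :: "(real ^ 'k \<Rightarrow> real) \<Rightarrow> real ^ 'k \<Rightarrow> bool" where
  "ranalytic f a \<longleftrightarrow> (\<exists>F e. e > 0 \<and> hol F (ball (cvec a) e) \<and>
     (\<forall>x\<in>ball a e. F (cvec x) = of_real (f x)))"

lemma ranalyticI:
  assumes "e > 0" "hol F (ball (cvec a) e)" "\<And>x. x \<in> ball a e \<Longrightarrow> F (cvec x) = of_real (f x)"
  shows "ranalytic f a"
  using assms unfolding ranalytic_def by blast

lemma ranalyticE:
  assumes "ranalytic f a" "\<delta> > 0"
  obtains F e where "e > 0" "e \<le> \<delta>" "hol F (ball (cvec a) e)"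
    "\<And>x. x \<in> ball a e \<Longrightarrow> F (cvec x) = of_real (f x)"
proof -
  obtain F e where F: "e > 0" "hol F (ball (cvec a) e)" "\<And>x. x \<in> ball a e \<Longrightarrow> F (cvec x) = of_real (f x)"
    using assms(1) unfolding ranalytic_def by blast
  show ?thesis
    by (rule that[of "min e \<delta>" F])
       (use F assms(2) hol_ball_mono[OF F(2), of "min e \<delta>"] in auto)
qed

text \<open>The average of \<open>F\<close> and its reflection equals the real part of
  \<open>F\<close> at real points. Thus a function defined by a contour integral need not be shown
  to be real valued there.\<close>

lemma ranalytic_Re:
  assumes "e > 0" "hol F (ball (cvec a) e)" "\<And>x. x \<in> ball a e \<Longrightarrow> f x = Re (F (cvec x))"
  shows "ranalytic f a"
proof (rule ranalyticI[OF assms(1)])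
  show "hol (\<lambda>z. (1/2) * (F z + cnj (F (\<chi> i. cnj (z $ i))))) (ball (cvec a) e)"
    by (intro hol_mult hol_add hol_const hol_cnj assms(2))
  fix x assume x: "x \<in> ball a e"
  have "(\<chi> i. cnj (cvec x $ i)) = cvec x"
    by (simp add: vec_eq_iff)
  then show "(1/2) * (F (cvec x) + cnj (F (\<chi> i. cnj (cvec x $ i)))) = of_real (f x)"
    using assms(3)[OF x] by (simp add: complex_eq_iff)
qed

lemma ranalytic_const [intro, simp]: "ranalytic (\<lambda>x. c) a"
  by (rule ranalyticI[of 1 "\<lambda>_. of_real c"]) auto

lemma ranalytic_coord [intro, simp]: "ranalytic (\<lambda>x. x $ i) a"
  by (rule ranalyticI[of 1 "\<lambda>z. z $ i"]) auto

lemma ranalytic_add [intro]: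
  assumes "ranalytic f a" "ranalytic g a" shows "ranalytic (\<lambda>x. f x + g x) a"
proof -
  obtain F e where F: "e > 0" "hol F (ball (cvec a) e)" "\<And>x. x \<in> ball a e \<Longrightarrow> F (cvec x) = of_real (f x)"
    using assms(1) unfolding ranalytic_def by blast
  obtain G d where G: "d > 0" "d \<le> e" "hol G (ball (cvec a) d)" "\<And>x. x \<in> ball a d \<Longrightarrow> G (cvec x) = of_real (g x)"
    using ranalyticE[OF assms(2) F(1)] by blast
  show ?thesis
    by (rule ranalyticI[OF G(1), of "\<lambda>z. F z + G z"])
       (use F G hol_ball_mono[OF F(2) G(2)] in auto)
qed

lemma ranalytic_mult [intro]:
  assumes "ranalytic f a" "ranalytic g a" shows "ranalytic (\<lambda>x. f x * g x) a"
proof -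
  obtain F e where F: "e > 0" "hol F (ball (cvec a) e)" "\<And>x. x \<in> ball a e \<Longrightarrow> F (cvec x) = of_real (f x)"
    using assms(1) unfolding ranalytic_def by blast
  obtain G d where G: "d > 0" "d \<le> e" "hol G (ball (cvec a) d)" "\<And>x. x \<in> ball a d \<Longrightarrow> G (cvec x) = of_real (g x)"
    using ranalyticE[OF assms(2) F(1)] by blast
  show ?thesis
    by (rule ranalyticI[OF G(1), of "\<lambda>z. F z * G z"])
       (use F G hol_ball_mono[OF F(2) G(2)] in auto)
qed

lemma ranalytic_diff [intro]: "ranalytic f a \<Longrightarrow> ranalytic g a \<Longrightarrow> ranalytic (\<lambda>x. f x - g x) a"
  using ranalytic_add[of f a "\<lambda>x. -1 * g x"] ranalytic_mult[OF ranalytic_const, of g a "-1"] by simp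

lemma ranalytic_power [intro]: "ranalytic f a \<Longrightarrow> ranalytic (\<lambda>x. f x ^ n) a"
  by (induction n) auto

lemma ranalytic_sum [intro]: "(\<And>i. i \<in> I \<Longrightarrow> ranalytic (f i) a) \<Longrightarrow> ranalytic (\<lambda>x. \<Sum>i\<in>I. f i x) a"
  by (induction I rule: infinite_finite_induct) auto

lemma ranalytic_prod [intro]: "(\<And>i. i \<in> I \<Longrightarrow> ranalytic (f i) a) \<Longrightarrow> ranalytic (\<lambda>x. \<Prod>i\<in>I. f i x) a"
  by (induction I rule: infinite_finite_induct) auto

lemma ranalytic_eventually:
  assumes "ranalytic f a" shows "\<forall>\<^sub>F x in nhds a. ranalytic f x"
proof -
  obtain F e where F: "e > 0" "hol F (ball (cvec a) e)" "\<And>x. x \<in> ball a e \<Longrightarrow> F (cvec x) = of_real (f x)"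
    using assms(1) unfolding ranalytic_def by blast
  have "ranalytic f x" if x: "dist x a < e" for x
  proof (rule ranalyticI)
    show "e - dist x a > 0"
      using x by simp
    have "ball (cvec x) (e - dist x a) \<subseteq> ball (cvec a) e"
      by (simp add: subset_iff) (metis add.commute dist_commute dist_cvec dist_triangle_lt less_diff_eq)
    then show "hol F (ball (cvec x) (e - dist x a))"
      using F(2) hol_subset by blast
    show "F (cvec y) = of_real (f y)" if "y \<in> ball x (e - dist x a)" for y
      using that by (intro F(3)) (simp, metis add.commute dist_commute dist_triangle_lt less_diff_eq)
  qed
  then show ?thesis
    using F(1) unfolding eventually_nhds_metric by blast
qed

lemma cont_cvec: "continuous_on S cvec"
  unfolding cvec_def by (intro continuous_on_vec_lambda continuous_intros)

lemma ranalytic_isCont: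
  assumes "ranalytic f a" shows "isCont f a"
proof -
  obtain F e where F: "e > 0" "hol F (ball (cvec a) e)" "\<And>x. x \<in> ball a e \<Longrightarrow> F (cvec x) = of_real (f x)"
    using assms(1) unfolding ranalytic_def by blast
  have "continuous_on (ball a e) (\<lambda>x. Re (F (cvec x)))"
    using holD_cont[OF F(2)]
    by (intro continuous_intros continuous_on_compose2[OF holD_cont[OF F(2)]] cont_cvec) auto
  then have "continuous_on (ball a e) f"
    by (rule continuous_on_eq) (use F in auto)
  then show ?thesis
    using F(1) by (simp add: continuous_on_eq_continuous_at)
qed

lemma ranalytic_tendsto: "ranalytic f a \<Longrightarrow> (f \<longlongrightarrow> f a) (nhds a)"
  using ranalytic_isCont[of f a] by (simp add: continuous_at tendsto_nhds_iff)

lemma ranalytic_compose: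
  assumes f: "ranalytic f (\<pi> b)" and \<pi>: "\<And>i. ranalytic (\<lambda>x. \<pi> x $ i) b"
  shows "ranalytic (\<lambda>x. f (\<pi> x)) b"
proof -
  obtain F e where F: "e > 0" "hol F (ball (cvec (\<pi> b)) e)"
      "\<And>x. x \<in> ball (\<pi> b) e \<Longrightarrow> F (cvec x) = of_real (f x)"
    using f unfolding ranalytic_def by blast
  have "\<forall>i. \<exists>P d. d > 0 \<and> hol P (ball (cvec b) d) \<and> (\<forall>x\<in>ball b d. P (cvec x) = of_real (\<pi> x $ i))"
    using \<pi> unfolding ranalytic_def by blast
  then obtain P d where P: "\<And>i. d i > 0" "\<And>i. hol (P i) (ball (cvec b) (d i))"
      "\<And>i x. x \<in> ball b (d i) \<Longrightarrow> P i (cvec x) = of_real (\<pi> x $ i)"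
    by metis
  define d0 where "d0 = Min (range d)"
  have d0: "d0 > 0" "\<And>i. d0 \<le> d i"
    using P(1) by (auto simp: d0_def)
  define Q where "Q z = (\<chi> i. P i z)" for z
  have hQ: "hol (\<lambda>z. Q z $ i) (ball (cvec b) d0)" for i
    using hol_ball_mono[OF P(2) d0(2), of i] by (auto simp: Q_def)
  have Qc: "Q (cvec x) = cvec (\<pi> x)" if "x \<in> ball b d0" for x
  proof -
    have "P i (cvec x) = of_real (\<pi> x $ i)" for i
      using that d0(2)[of i] by (intro P(3)) auto
    then show ?thesis
      by (simp add: Q_def vec_eq_iff)
  qed
  have "continuous_on (ball (cvec b) d0) (\<lambda>z. \<chi> i. Q z $ i)"
    using hQ by (intro continuous_on_vec_lambda holD_cont)
  then have "isCont Q (cvec b)"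
    using d0(1) by (simp add: continuous_on_eq_continuous_at)
  then have "\<forall>\<^sub>F z in nhds (cvec b). Q z \<in> ball (Q (cvec b)) e"
    using F(1) topological_tendstoD[of Q "Q (cvec b)" "nhds (cvec b)" "ball (Q (cvec b)) e"]
    by (simp add: continuous_at tendsto_nhds_iff)
  moreover have "Q (cvec b) = cvec (\<pi> b)"
    using d0 by (intro Qc) auto
  ultimately obtain r where r: "r > 0" "\<And>z. dist z (cvec b) < r \<Longrightarrow> Q z \<in> ball (cvec (\<pi> b)) e"
    unfolding eventually_nhds_metric by auto
  show ?thesis
  proof (rule ranalyticI)
    show "min r d0 > 0"
      using r d0 by auto
    show "hol (\<lambda>z. F (Q z)) (ball (cvec b) (min r d0))"
      by (rule hol_compose[OF F(2)]) (use r hol_ball_mono[OF hQ, of "min r d0"] in \<open>auto simp: dist_commute\<close>)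
    fix x assume x: "x \<in> ball b (min r d0)"
    have "cvec (\<pi> x) \<in> ball (cvec (\<pi> b)) e"
      using r(2)[of "cvec x"] x Qc[of x] by (auto simp: dist_commute)
    then show "F (Q (cvec x)) = of_real (f (\<pi> x))"
      using x Qc[of x] F(3)[of "\<pi> x"] by auto
  qed
qed

section \<open>Division and Taylor coefficients\<close>

text \<open>The factor \<open>s\<close> occurs with the values 0 and 1: then \<open>w\<close> is the
  new coordinate itself or an increment added to \<open>z $ k\<close>.\<close>

lemma hol_upd:
  assumes F: "hol F (ball c e)" and S: "\<And>z. z \<in> S \<Longrightarrow> upd z k (w + s * z $ k) \<in> ball c e"
  shows "hol (\<lambda>z. F (upd z k (w + s * z $ k))) S"
proof (rule hol_compose[OF F])
  show "hol (\<lambda>z. upd z k (w + s * z $ k) $ i) S" for i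
    by (cases "i = k") (auto intro!: hol_add hol_mult hol_const hol_coord)
qed (rule S)

lemma cont_upd_pair:
  assumes F: "hol F (ball c e)"
    and S: "\<And>z w. z \<in> S \<Longrightarrow> w \<in> T \<Longrightarrow> upd z k (w + s * z $ k) \<in> ball c e"
  shows "continuous_on (S \<times> T) (\<lambda>p. F (upd (fst p) k (snd p + s * fst p $ k)))"
  by (rule continuous_on_compose2[OF holD_cont[OF F]]) (use S in \<open>auto intro!: continuous_intros\<close>)

lemma hol_slice:
  assumes F: "hol F (ball c e)" and D: "open D" "\<And>w. w \<in> D \<Longrightarrow> upd z k (w + s) \<in> ball c e"
  shows "(\<lambda>w. F (upd z k (w + s))) holomorphic_on D"
proof (rule holD_curve[OF F D(1)])
  show "(\<lambda>w. upd z k (w + s) $ i) holomorphic_on D" for i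
    by (cases "i = k") (auto intro!: holomorphic_intros)
qed (rule D(2))

text \<open>By Cauchy's formula the divided difference of a function \<open>\<phi>\<close> between
  \<open>u\<close> and \<open>b\<close> is the circle integral of
  \<open>\<phi> w / ((w - b) * (w - u))\<close>, up to \<open>2 * pi * \<i>\<close>. This integral
  is regular at \<open>u = b\<close> too, so the quotient needs no extension across the
  hyperplane.\<close>

lemma ranalytic_division:
  assumes f: "ranalytic f a" and zero: "\<forall>\<^sub>F x in nhds a. f (upd x k (a $ k)) = 0"
  obtains g where "ranalytic g a" "\<forall>\<^sub>F x in nhds a. f x = (x $ k - a $ k) * g x"
proof -
  obtain \<delta> where \<delta>: "\<delta> > 0" "\<And>x. dist x a < \<delta> \<Longrightarrow> f (upd x k (a $ k)) = 0"
    using zero unfolding eventually_nhds_metric by blast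
  obtain F e where F: "e > 0" "e \<le> \<delta>" "hol F (ball (cvec a) e)"
      "\<And>x. x \<in> ball a e \<Longrightarrow> F (cvec x) = of_real (f x)"
    using ranalyticE[OF f \<delta>(1)] by blast
  \<comment> \<open>By \<open>dist_upd_le\<close> a replaced coordinate costs twice the distance of
    \<open>z\<close> plus the distance of \<open>w\<close>; with \<open>w\<close> in the disc of
    radius \<open>2 * r\<close> this is less than \<open>4 * r = e\<close>.\<close>
  define r where "r = e / 4"
  have r: "r > 0"
    using F(1) by (simp add: r_def)
  define b where "b = cvec a $ k"
  define B where "B = ball (cvec a) r"
  have upd_in: "upd z k w \<in> ball (cvec a) e" if "z \<in> B" "dist b w \<le> r" for z w
    using dist_upd_le[of z k w "cvec a"] that F(1) by (simp add: B_def r_def b_def dist_commute)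
  have kr: "dist b (z $ k) < r" if "z \<in> B" for z
    using dist_vec_nth_le[of "cvec a" k z] that by (simp add: B_def b_def)
  define H where "H z w = F (upd z k w) / (w - b) / (w - z $ k)" for z w
  have Hnz: "w - b \<noteq> 0" "w - z $ k \<noteq> 0" if "w \<in> sphere b r" "z \<in> B" for z w
    using that r kr[OF that(2)] by auto
  have "hol (\<lambda>z. contour_integral (circlepath b r) (H z)) B"
  proof (rule hol_circle_integral[OF r])
    have "continuous_on (B \<times> sphere b r) (\<lambda>p. F (upd (fst p) k (snd p + 0 * fst p $ k)))"
      by (rule cont_upd_pair[OF F(3)]) (use upd_in in auto)
    then show "continuous_on (B \<times> sphere b r) (\<lambda>(z, w). H z w)"
      unfolding H_def case_prod_beta using Hnz by (auto intro!: continuous_intros)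
    fix w assume w: "w \<in> sphere b r"
    have "hol (\<lambda>z. F (upd z k (w + 0 * z $ k))) B"
      by (rule hol_upd[OF F(3)]) (use upd_in w in auto)
    then show "hol (\<lambda>z. H z w) B"
      unfolding H_def using Hnz[OF w]
      by (intro hol_divide hol_diff hol_const hol_coord) auto
  qed
  then have hG: "hol (\<lambda>z. 1 / (2 * pi * \<i>) * contour_integral (circlepath b r) (H z)) B"
    by (rule hol_mult[OF hol_const])
  define g where "g x = Re (1 / (2 * pi * \<i>) * contour_integral (circlepath b r) (H (cvec x)))" for x
  have "ranalytic g a"
    by (rule ranalytic_Re[OF r, of "\<lambda>z. 1 / (2 * pi * \<i>) * contour_integral (circlepath b r) (H z)"])
       (use hG in \<open>auto simp: g_def B_def\<close>)
  moreover have "f x = (x $ k - a $ k) * g x" if x: "dist x a < r" for x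
  proof (cases "x $ k = a $ k")
    case True
    have "f (upd x k (a $ k)) = 0"
      by (rule \<delta>(2)) (use x F(2) F(1) in \<open>simp add: r_def\<close>)
    then show ?thesis
      using True by (metis diff_self mult_zero_left upd_same)
  next
    case False
    define z where "z = cvec x"
    have z: "z \<in> B"
      using x by (simp add: B_def z_def dist_commute)
    define \<phi> where "\<phi> w = F (upd z k w)" for w
    have "\<phi> holomorphic_on ball b (r * 2)"
    proof -
      have "dist (upd z k w) (cvec a) < e" if "dist b w < r * 2" for w
        using dist_upd_le[of z k w "cvec a"] that x
        by (simp add: b_def dist_commute z_def r_def)
      then show ?thesis
        using hol_slice[OF F(3) open_ball, of b "r * 2" z k 0]
        unfolding \<phi>_def by (auto simp: dist_commute)
    qed
    moreover have "cball b r \<subseteq> ball b (r * 2)" "ball b r \<subseteq> ball b (r * 2)"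
      using r by auto
    ultimately have \<phi>: "continuous_on (cball b r) \<phi>" "\<phi> holomorphic_on ball b r"
      using holomorphic_on_subset holomorphic_on_imp_continuous_on by blast+
    have \<phi>b: "\<phi> b = 0"
    proof -
      have "upd z k b = cvec (upd x k (a $ k))"
        by (simp add: z_def b_def cvec_upd)
      moreover have "upd x k (a $ k) \<in> ball a e"
        using dist_upd_le[of x k "a $ k" a] x F(1) by (simp add: r_def dist_commute)
      moreover have "dist x a < \<delta>"
        using x F(1,2) by (simp add: r_def)
      ultimately show ?thesis
        using F(4) \<delta>(2) by (simp add: \<phi>_def)
    qed
    have \<phi>x: "\<phi> (z $ k) = of_real (f x)"
      unfolding \<phi>_def upd_same using F(4)[of x] x F(1) by (simp add: z_def r_def dist_commute)
    have ne: "z $ k \<noteq> b"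
      using False by (simp add: z_def b_def)
    have cauchy: "((\<lambda>w. \<phi> w / (w - u)) has_contour_integral 2 * pi * \<i> * \<phi> u) (circlepath b r)"
      if "norm (u - b) < r" for u
      using Cauchy_integral_circlepath[OF \<phi> that] by simp
    have "((\<lambda>w. \<phi> w / (w - z $ k) - \<phi> w / (w - b)) has_contour_integral
       (2 * pi * \<i> * \<phi> (z $ k) - 2 * pi * \<i> * \<phi> b)) (circlepath b r)"
      using kr[OF z] r
      by (intro has_contour_integral_diff cauchy) (auto simp: dist_norm norm_minus_commute)
    then have "((\<lambda>w. 1 / (z $ k - b) * (\<phi> w / (w - z $ k) - \<phi> w / (w - b))) has_contour_integral
       1 / (z $ k - b) * (2 * pi * \<i> * \<phi> (z $ k) - 2 * pi * \<i> * \<phi> b)) (circlepath b r)"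
      by (rule has_contour_integral_lmul)
    then have "(H z has_contour_integral
       1 / (z $ k - b) * (2 * pi * \<i> * \<phi> (z $ k) - 2 * pi * \<i> * \<phi> b)) (circlepath b r)"
    proof (rule has_contour_integral_eq)
      fix w assume "w \<in> path_image (circlepath b r)"
      then have "w \<in> sphere b r"
        using r by (simp add: path_image_circlepath)
      then show "1 / (z $ k - b) * (\<phi> w / (w - z $ k) - \<phi> w / (w - b)) = H z w"
        using Hnz[of w z] z ne by (simp add: H_def \<phi>_def divide_simps) (simp add: algebra_simps)
    qed
    then have "contour_integral (circlepath b r) (H z) =
        1 / (z $ k - b) * (2 * pi * \<i> * \<phi> (z $ k) - 2 * pi * \<i> * \<phi> b)"
      by (rule contour_integral_unique)
    then have "1 / (2 * pi * \<i>) * contour_integral (circlepath b r) (H z) = of_real (f x / (x $ k - a $ k))"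
      by (simp add: \<phi>b \<phi>x) (simp add: z_def b_def)
    then have "g x = f x / (x $ k - a $ k)"
      by (simp add: g_def z_def)
    then show ?thesis
      using False by simp
  qed
  ultimately show thesis
    using that[of g] r unfolding eventually_nhds_metric by blast
qed

text \<open>The polynomial \<open>p\<close> agrees with the germ \<open>\<phi>\<close> at \<open>0\<close> up to order \<open>m\<close>; it need not have degree at most \<open>m\<close>.\<close>
definition has_tp :: "(real \<Rightarrow> real) \<Rightarrow> nat \<Rightarrow> real poly \<Rightarrow> bool" where
  "has_tp \<phi> m p \<longleftrightarrow> (\<exists>B. \<forall>\<^sub>F s in nhds 0. \<bar>\<phi> s - poly p s\<bar> \<le> B * \<bar>s\<bar> ^ Suc m)"

text \<open>Cauchy's formula for derivatives writes the coefficient as a circle integral around 0 in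
  which the base point \<open>z\<close> is a parameter.\<close>

lemma hol_taylor_coeff:
  assumes F: "hol F (ball (cvec a) e)" and e: "e > 0"
  shows "hol (\<lambda>z. (deriv ^^ j) (\<lambda>w. F (upd z k (w + z $ k))) 0 / fact j) (ball (cvec a) (e / 4))"
proof -
  define r where "r = e / 4"
  have r: "r > 0"
    using e by (simp add: r_def)
  define B where "B = ball (cvec a) r"
  have upd_in: "upd z k (w + 1 * z $ k) \<in> ball (cvec a) e" if "z \<in> B" "dist 0 w < r * 2" for z w
  proof -
    have "dist (upd z k (w + z $ k)) (cvec a) \<le> dist (upd z k (w + z $ k)) z + dist z (cvec a)"
      by (rule dist_triangle)
    also have "dist (upd z k (w + z $ k)) z = norm w"
      unfolding dist_upd_self by (simp add: dist_norm)
    also have "norm w + dist z (cvec a) < r * 2 + r"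
      using that by (simp add: B_def dist_commute)
    finally show ?thesis
      using e by (simp add: r_def dist_commute)
  qed
  define H where "H z w = F (upd z k (w + 1 * z $ k)) / w ^ Suc j" for z w
  have Hnz: "w \<noteq> 0" if "w \<in> sphere 0 r" for w :: complex
    using that r by auto
  have "hol (\<lambda>z. contour_integral (circlepath 0 r) (H z)) B"
  proof (rule hol_circle_integral[OF r])
    have "continuous_on (B \<times> sphere 0 r) (\<lambda>p. F (upd (fst p) k (snd p + 1 * fst p $ k)))"
      by (rule cont_upd_pair[OF F]) (use upd_in r in auto)
    then show "continuous_on (B \<times> sphere 0 r) (\<lambda>(z, w). H z w)"
      unfolding H_def case_prod_beta using Hnz by (auto intro!: continuous_intros)
    fix w :: complex assume w: "w \<in> sphere 0 r"
    have "hol (\<lambda>z. F (upd z k (w + 1 * z $ k))) B"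
      by (rule hol_upd[OF F]) (use upd_in w r in auto)
    then show "hol (\<lambda>z. H z w) B"
      unfolding H_def using Hnz[OF w] by (intro hol_divide hol_const) auto
  qed
  then have "hol (\<lambda>z. 1 / (2 * pi * \<i>) * contour_integral (circlepath 0 r) (H z)) B"
    by (rule hol_mult[OF hol_const])
  then show ?thesis
    unfolding B_def[symmetric] r_def[symmetric]
  proof (rule hol_cong)
    fix z assume z: "z \<in> B"
    define \<phi> where "\<phi> w = F (upd z k (w + z $ k))" for w
    have "\<phi> holomorphic_on ball 0 (r * 2)"
      using hol_slice[OF F open_ball, of 0 "r * 2" z k "z $ k"] upd_in[OF z]
      unfolding \<phi>_def by auto
    moreover have "cball 0 r \<subseteq> ball 0 (r * 2)" "ball 0 r \<subseteq> ball (0::complex) (r * 2)"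
      using r by auto
    ultimately have \<phi>: "continuous_on (cball 0 r) \<phi>" "\<phi> holomorphic_on ball 0 r"
      using holomorphic_on_subset holomorphic_on_imp_continuous_on by blast+
    have "contour_integral (circlepath 0 r) (H z) = (2 * pi * \<i>) * (deriv ^^ j) \<phi> 0 / fact j"
      using Cauchy_contour_integral_circlepath[OF \<phi>, of 0 j] r
      by (simp add: H_def[abs_def] \<phi>_def[abs_def])
    then show "(deriv ^^ j) (\<lambda>w. F (upd z k (w + z $ k))) 0 / fact j =
        1 / (2 * pi * \<i>) * contour_integral (circlepath 0 r) (H z)"
      by (simp add: \<phi>_def[abs_def])
  qed
qed

lemma holomorphic_real_tp:
  assumes g: "g holomorphic_on ball 0 r" and r: "r > 0"
    and \<phi>: "\<forall>\<^sub>F s in nhds 0. \<phi> s = Re (g (of_real s))"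
  shows "has_tp \<phi> m (\<Sum>j\<le>m. monom (Re ((deriv ^^ j) g 0 / fact j)) j)"
proof -
  define c where "c j = (deriv ^^ j) g 0 / fact j" for j
  have sums: "(\<lambda>j. c j * w ^ j) sums g w" if "w \<in> ball 0 r" for w
    using holomorphic_power_series[OF g that] by (simp add: c_def)
  define \<rho> where "\<rho> = r / 2"
  have \<rho>: "\<rho> > 0" "\<rho> < r"
    using r by (auto simp: \<rho>_def)
  have "summable (\<lambda>j. c j * of_real \<rho> ^ j)"
    using sums[of "of_real \<rho>"] \<rho> by (auto simp: summable_def)
  then have sm: "summable (\<lambda>j. norm (c j * w ^ j))" if "norm w < \<rho>" for w
    using that \<rho> by (intro powser_insidea[of _ "of_real \<rho>"]) auto
  \<comment> \<open>The tail after degree \<open>m\<close>, with \<open>Suc m\<close> powers of the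
    variable taken out, majorized at the radius \<open>\<rho> / 2\<close>.\<close>
  define M where "M = (\<Sum>i. norm (c (i + Suc m)) * (\<rho> / 2) ^ i)"
  have sM: "summable (\<lambda>i. norm (c (i + Suc m)) * (\<rho> / 2) ^ i)"
  proof -
    have "summable (\<lambda>j. norm (c j) * (\<rho> / 2) ^ j)"
      using sm[of "of_real (\<rho> / 2)"] \<rho> by (simp add: norm_mult norm_power)
    then have "summable (\<lambda>i. norm (c (i + Suc m)) * (\<rho> / 2) ^ (i + Suc m))"
      by (rule summable_ignore_initial_segment)
    then have "summable (\<lambda>i. norm (c (i + Suc m)) * (\<rho> / 2) ^ (i + Suc m) * (1 / (\<rho> / 2) ^ Suc m))"
      by (rule summable_mult2)
    then show ?thesis
      using \<rho> by (simp add: power_add)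
  qed
  have bound: "norm (g w - (\<Sum>j\<le>m. c j * w ^ j)) \<le> M * norm w ^ Suc m" if w: "norm w \<le> \<rho> / 2" for w
  proof -
    have "(\<lambda>i. c (i + Suc m) * w ^ (i + Suc m)) sums (g w - (\<Sum>j<Suc m. c j * w ^ j))"
      using w \<rho> by (intro sums_split_initial_segment sums) auto
    then have eq: "g w - (\<Sum>j\<le>m. c j * w ^ j) = (\<Sum>i. c (i + Suc m) * w ^ (i + Suc m))"
      by (simp add: sums_iff lessThan_Suc_atMost)
    have nb: "norm (c (i + Suc m) * w ^ (i + Suc m)) \<le> norm (c (i + Suc m)) * (\<rho> / 2) ^ i * norm w ^ Suc m" for i
    proof -
      have "norm (c (i + Suc m)) * norm w ^ i \<le> norm (c (i + Suc m)) * (\<rho> / 2) ^ i"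
        by (intro mult_left_mono power_mono) (use w in auto)
      then have "norm (c (i + Suc m)) * norm w ^ i * norm w ^ Suc m \<le> norm (c (i + Suc m)) * (\<rho> / 2) ^ i * norm w ^ Suc m"
        by (rule mult_right_mono) simp
      then show ?thesis
        by (simp add: norm_mult norm_power power_add mult_ac)
    qed
    have "norm (\<Sum>i. c (i + Suc m) * w ^ (i + Suc m)) \<le> (\<Sum>i. norm (c (i + Suc m)) * (\<rho> / 2) ^ i * norm w ^ Suc m)"
      by (intro norm_suminf_le nb summable_mult2 sM)
    also have "\<dots> = M * norm w ^ Suc m"
      unfolding M_def by (rule suminf_mult2[OF sM, symmetric])
    finally show ?thesis
      using eq by simp
  qed
  have "\<forall>\<^sub>F s in nhds 0. \<bar>s\<bar> < \<rho> / 2"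
    unfolding eventually_nhds_metric using \<rho> by (intro exI[of _ "\<rho> / 2"]) auto
  with \<phi> have "\<forall>\<^sub>F s in nhds 0. \<bar>\<phi> s - poly (\<Sum>j\<le>m. monom (Re (c j)) j) s\<bar> \<le> M * \<bar>s\<bar> ^ Suc m"
  proof eventually_elim
    case (elim s)
    have "\<phi> s - poly (\<Sum>j\<le>m. monom (Re (c j)) j) s = Re (g (of_real s) - (\<Sum>j\<le>m. c j * of_real s ^ j))"
      by (simp add: elim poly_sum poly_monom flip: of_real_power)
    also have "\<bar>\<dots>\<bar> \<le> norm (g (of_real s) - (\<Sum>j\<le>m. c j * of_real s ^ j))"
      by (rule abs_Re_le_cmod)
    also have "\<dots> \<le> M * \<bar>s\<bar> ^ Suc m"
      using bound[of "of_real s"] elim by simp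
    finally show ?case .
  qed
  then show ?thesis
    unfolding has_tp_def c_def by blast
qed

text \<open>Letting \<open>s\<close> tend to 0 kills the constant coefficient, and division by
  \<open>s\<close> lowers \<open>m\<close>; the punctured neighborhood makes this division
  legitimate.\<close>

lemma poly_small_coeff:
  fixes r :: "real poly"
  assumes "\<forall>\<^sub>F s in at 0. \<bar>poly r s\<bar> \<le> B * \<bar>s\<bar> ^ Suc m" "i \<le> m"
  shows "coeff r i = 0"
  using assms
proof (induction m arbitrary: r i)
  case (0 r i)
  have "((\<lambda>s. \<bar>poly r s\<bar>) \<longlongrightarrow> \<bar>poly r 0\<bar>) (at 0)"
    by (intro tendsto_intros)
  moreover have "((\<lambda>s. B * \<bar>s\<bar> ^ Suc 0) \<longlongrightarrow> B * \<bar>0\<bar> ^ Suc 0) (at (0::real))"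
    by (intro tendsto_intros)
  ultimately have "\<bar>poly r 0\<bar> \<le> B * \<bar>0\<bar> ^ Suc 0"
    by (intro tendsto_le[OF trivial_limit_at _ _ 0(1)])
  then show ?case
    using 0 by (simp add: poly_0_coeff_0)
next
  case (Suc m r i)
  have "((\<lambda>s. \<bar>poly r s\<bar>) \<longlongrightarrow> \<bar>poly r 0\<bar>) (at 0)"
    by (intro tendsto_intros)
  moreover have "((\<lambda>s. B * \<bar>s\<bar> ^ Suc (Suc m)) \<longlongrightarrow> B * \<bar>0\<bar> ^ Suc (Suc m)) (at (0::real))"
    by (intro tendsto_intros)
  ultimately have "\<bar>poly r 0\<bar> \<le> B * \<bar>0\<bar> ^ Suc (Suc m)"
    by (intro tendsto_le[OF trivial_limit_at _ _ Suc(2)])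
  then have r0: "coeff r 0 = 0"
    by (simp add: poly_0_coeff_0)
  obtain c q where q: "r = pCons c q"
    by (cases r) auto
  have r: "r = pCons 0 q"
    using r0 q by simp
  have "\<forall>\<^sub>F s::real in at 0. s \<noteq> 0"
    by (simp add: eventually_at_filter)
  with Suc(2) have "\<forall>\<^sub>F s in at 0. \<bar>poly q s\<bar> \<le> B * \<bar>s\<bar> ^ Suc m"
  proof eventually_elim
    case (elim s)
    then have "\<bar>s\<bar> * \<bar>poly q s\<bar> \<le> \<bar>s\<bar> * (B * \<bar>s\<bar> ^ Suc m)"
      by (simp add: r abs_mult mult_ac)
    then show ?case
      using elim(2) by (simp add: mult_le_cancel_left)
  qed
  then show ?case
    using Suc.IH[of q "i - 1"] Suc.prems(2) by (cases i) (auto simp: r)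
qed

lemma has_tp_unique:
  assumes "has_tp \<phi> m p" "has_tp \<phi> m q" "i \<le> m"
  shows "coeff p i = coeff q i"
proof -
  obtain B C where B: "\<forall>\<^sub>F s in nhds 0. \<bar>\<phi> s - poly p s\<bar> \<le> B * \<bar>s\<bar> ^ Suc m"
      and C: "\<forall>\<^sub>F s in nhds 0. \<bar>\<phi> s - poly q s\<bar> \<le> C * \<bar>s\<bar> ^ Suc m"
    using assms unfolding has_tp_def by blast
  from B C have "\<forall>\<^sub>F s in nhds 0. \<bar>poly (p - q) s\<bar> \<le> (B + C) * \<bar>s\<bar> ^ Suc m"
    unfolding distrib_right poly_diff by eventually_elim linarith
  then have "\<forall>\<^sub>F s in at 0. \<bar>poly (p - q) s\<bar> \<le> (B + C) * \<bar>s\<bar> ^ Suc m"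
    by (simp add: eventually_at_filter eventually_mono)
  from poly_small_coeff[OF this assms(3)] show ?thesis
    by simp
qed

text \<open>The third clause is the rule that differentiating coefficient \<open>j\<close> gives
  \<open>Suc j\<close> times the next one. For the coefficient one below the order it provides the
  simple zero to which \<open>ranalytic_implicit\<close> is applied.\<close>

lemma ranalytic_taylor:
  assumes "ranalytic f a"
  obtains T where "\<And>j. ranalytic (T j) a"
    "\<And>m. \<forall>\<^sub>F x in nhds a. has_tp (\<lambda>s. f (upd x k (x $ k + s))) m (\<Sum>j\<le>m. monom (T j x) j)"
    "\<And>j. \<forall>\<^sub>F x in nhds a. has_tp (\<lambda>s. T j (upd x k (x $ k + s))) 1 [:T j x, of_nat (Suc j) * T (Suc j) x:]"
proof -
  obtain F e where F: "e > 0" "hol F (ball (cvec a) e)"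
      "\<And>x. x \<in> ball a e \<Longrightarrow> F (cvec x) = of_real (f x)"
    using assms unfolding ranalytic_def by blast
  define g where "g x w = F (upd (cvec x) k (w + cvec x $ k))" for x w
  define T where "T j x = Re ((deriv ^^ j) (g x) 0 / fact j)" for j x
  have T: "ranalytic (T j) a" for j
    by (rule ranalytic_Re[of "e / 4", OF _ hol_taylor_coeff[OF F(2,1), of j k]])
       (use F(1) in \<open>auto simp: T_def g_def[abs_def]\<close>)
  have near: "\<forall>\<^sub>F x in nhds a. dist x a < e / 2"
    unfolding eventually_nhds_metric using F(1) by (intro exI[of _ "e / 2"]) auto
  have g: "g x holomorphic_on ball 0 (e / 2)" if x: "dist x a < e / 2" for x
    unfolding g_def[abs_def]
  proof (rule hol_slice[OF F(2) open_ball])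
    fix w :: complex assume w: "w \<in> ball 0 (e / 2)"
    have "dist (upd (cvec x) k (w + cvec x $ k)) (cvec a) \<le>
        dist (upd (cvec x) k (w + cvec x $ k)) (cvec x) + dist (cvec x) (cvec a)"
      by (rule dist_triangle)
    also have "dist (upd (cvec x) k (w + cvec x $ k)) (cvec x) = norm w"
      unfolding dist_upd_self by (simp add: dist_norm)
    finally show "upd (cvec x) k (w + cvec x $ k) \<in> ball (cvec a) e"
      using w x by (simp add: dist_commute)
  qed
  have small: "\<forall>\<^sub>F s::real in nhds 0. \<bar>s\<bar> < e / 2"
    unfolding eventually_nhds_metric using F(1) by (intro exI[of _ "e / 2"]) auto
  have tp: "has_tp (\<lambda>s. f (upd x k (x $ k + s))) m (\<Sum>j\<le>m. monom (T j x) j)"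
    if x: "dist x a < e / 2" for x m
    unfolding T_def
  proof (rule holomorphic_real_tp[OF g[OF x]])
    show "\<forall>\<^sub>F s in nhds 0. f (upd x k (x $ k + s)) = Re (g x (of_real s))"
      using small
    proof eventually_elim
      case (elim s)
      have "dist (upd x k (x $ k + s)) a \<le> dist (upd x k (x $ k + s)) x + dist x a"
        by (rule dist_triangle)
      also have "dist (upd x k (x $ k + s)) x = \<bar>s\<bar>"
        unfolding dist_upd_self by (simp add: dist_norm)
      finally have "upd x k (x $ k + s) \<in> ball a e"
        using x elim by (simp add: dist_commute)
      from F(3)[OF this] show ?case
        by (simp add: g_def cvec_upd add.commute)
    qed
  qed (use F(1) in auto)
  have tp1: "has_tp (\<lambda>s. T j (upd x k (x $ k + s))) 1 [:T j x, of_nat (Suc j) * T (Suc j) x:]"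
    if x: "dist x a < e / 2" for x j
  proof -
    define h where "h w = (deriv ^^ j) (g x) w / fact j" for w
    have hd: "(deriv ^^ j) (g x) holomorphic_on ball 0 (e / 2)"
      by (rule holomorphic_higher_deriv[OF g[OF x] open_ball])
    then have h: "h holomorphic_on ball 0 (e / 2)"
      unfolding h_def by (rule holomorphic_on_divide[OF _ holomorphic_on_const]) simp
    have "has_tp (\<lambda>s. T j (upd x k (x $ k + s))) 1 (\<Sum>i\<le>1. monom (Re ((deriv ^^ i) h 0 / fact i)) i)"
    proof (rule holomorphic_real_tp[OF h])
      show "\<forall>\<^sub>F s in nhds 0. T j (upd x k (x $ k + s)) = Re (h (of_real s))"
      proof (rule always_eventually, rule allI)
        fix s :: real
        have "g (upd x k (x $ k + s)) = (\<lambda>w. g x (of_real s + w))"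
          by (simp add: g_def fun_eq_iff cvec_upd algebra_simps)
        moreover have "(deriv ^^ j) (\<lambda>w. g x (of_real s + w)) 0 = (deriv ^^ j) (g x) (of_real s)"
          using higher_deriv_shift_0[of j "g x" "of_real s"] by (simp add: o_def)
        ultimately show "T j (upd x k (x $ k + s)) = Re (h (of_real s))"
          by (simp add: T_def h_def)
      qed
    qed (use F(1) in auto)
    moreover have "deriv h 0 = deriv ((deriv ^^ j) (g x)) 0 / fact j"
      unfolding h_def using F(1)
      by (intro deriv_cdivide_right[OF holomorphic_on_imp_differentiable_at[OF hd open_ball]]) auto
    then have dh: "deriv h 0 = of_nat (Suc j) * ((deriv ^^ Suc j) (g x) 0 / fact (Suc j))"
      by (simp del: of_nat_Suc)
    have "Re (deriv h 0) = of_nat (Suc j) * T (Suc j) x"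
    proof -
      define w where "w = (deriv ^^ Suc j) (g x) 0 / fact (Suc j)"
      have "Re (of_nat (Suc j) * w) = of_nat (Suc j) * Re w"
        by simp
      then show ?thesis
        unfolding T_def dh w_def .
    qed
    moreover have "(\<Sum>i\<le>1. monom (Re ((deriv ^^ i) h 0 / fact i)) i) = [:Re (h 0), Re (deriv h 0):]"
      by (simp add: monom_altdef)
    moreover have "Re (h 0) = T j x"
      by (simp add: h_def T_def)
    ultimately show ?thesis
      by (simp only:)
  qed
  show thesis
    by (rule that[of T]) (use T tp tp1 near in \<open>auto elim!: eventually_mono\<close>)
qed

text \<open>A line through \<open>a\<close> and a nearby point where \<open>f\<close> is nonzero
  carries a nonzero function of one variable, whose power series has a first nonzero real
  coefficient to offer as \<open>d\<close>. The normalization \<open>v $ k = 1\<close> lets a shear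
  turn this line into the axis \<open>k\<close>.\<close>

lemma ranalytic_direction:
  assumes f: "ranalytic f a" and nz: "\<not> (\<forall>\<^sub>F x in nhds a. f x = 0)"
  obtains v d p where "v $ k = 1" "has_tp (\<lambda>s. f (a + s *s v)) d p" "coeff p d \<noteq> 0"
proof -
  obtain F e where F: "e > 0" "hol F (ball (cvec a) e)"
      "\<And>x. x \<in> ball a e \<Longrightarrow> F (cvec x) = of_real (f x)"
    using f unfolding ranalytic_def by blast
  have "\<forall>\<^sub>F x in nhds a. x \<in> ball a e \<and> ranalytic f x"
    using ranalytic_eventually[OF f] eventually_nhds_in_open[OF open_ball, of a a e] F(1)
    by (auto intro: eventually_conj)
  then obtain x0 where x0: "x0 \<in> ball a e" "ranalytic f x0" "f x0 \<noteq> 0"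
    using nz eventually_mono[of "\<lambda>x. x \<in> ball a e \<and> ranalytic f x" "nhds a" "\<lambda>x. f x = 0"] by blast
  \<comment> \<open>The point with nonzero value is moved along \<open>k\<close> until it leaves the
    hyperplane through \<open>a\<close>; only then can the direction be scaled to have
    \<open>k\<close>-th coordinate 1.\<close>
  have "\<forall>\<^sub>F t in at (x0 $ k). f (upd x0 k t) \<noteq> 0 \<and> upd x0 k t \<in> ball a e \<and> t \<noteq> a $ k"
  proof (intro eventually_conj)
    have lim: "((\<lambda>t. upd x0 k t) \<longlongrightarrow> x0) (at (x0 $ k))"
      using tendsto_upd[of "\<lambda>_. x0" x0 "at (x0 $ k)" "\<lambda>t. t" "x0 $ k" k] by simp
    have "((\<lambda>t. f (upd x0 k t)) \<longlongrightarrow> f x0) (at (x0 $ k))"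
      by (rule isCont_tendsto_compose[OF ranalytic_isCont[OF x0(2)] lim])
    then show "\<forall>\<^sub>F t in at (x0 $ k). f (upd x0 k t) \<noteq> 0"
      using x0(3) tendsto_imp_eventually_ne by blast
    show "\<forall>\<^sub>F t in at (x0 $ k). upd x0 k t \<in> ball a e"
      by (rule topological_tendstoD[OF lim open_ball x0(1)])
    show "\<forall>\<^sub>F t in at (x0 $ k). t \<noteq> a $ k"
    proof (cases "x0 $ k = a $ k")
      case True
      then show ?thesis
        by (simp add: eventually_at_filter)
    next
      case False
      then show ?thesis
        by (rule tendsto_imp_eventually_ne[OF tendsto_ident_at])
    qed
  qed
  then obtain t where t: "f (upd x0 k t) \<noteq> 0" "upd x0 k t \<in> ball a e" "t \<noteq> a $ k"
    using eventually_happens[of _ "at (x0 $ k)"] by (auto simp: trivial_limit_at)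
  define x where "x = upd x0 k t"
  define l where "l = t - a $ k"
  define v where "v = (1 / l) *s (x - a)"
  have l: "l \<noteq> 0"
    using t by (simp add: l_def)
  have vk: "v $ k = 1"
    using l by (simp add: v_def x_def l_def divide_simps)
  have xv: "x = a + l *s v"
    using l by (simp add: v_def vec_eq_iff)
  have nv: "norm v > 0"
    using vk by auto
  define D where "D = ball (0::complex) (e / norm v)"
  define g where "g w = F (cvec a + w *s cvec v)" for w
  have norm_s: "norm (w *s u) = norm w * norm u" for w :: complex and u :: "complex ^ 'a"
    by (simp add: norm_vec_def L2_set_def norm_mult power_mult_distrib real_sqrt_mult flip: sum_distrib_left)
  have inb: "cvec a + w *s cvec v \<in> ball (cvec a) e" if "w \<in> D" for w
    using that nv by (simp add: D_def dist_norm norm_s pos_less_divide_eq)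
  have cv: "cvec (a + s *s v) = cvec a + of_real s *s cvec v" for s
    by (simp add: vec_eq_iff)
  have g: "g holomorphic_on D"
    unfolding g_def
  proof (rule holD_curve[OF F(2)])
    show "open D"
      by (simp add: D_def)
    show "(\<lambda>w. (cvec a + w *s cvec v) $ i) holomorphic_on D" for i
      by (auto intro!: holomorphic_intros)
  qed (rule inb)
  have fg: "f (a + s *s v) = Re (g (of_real s))" if "of_real s \<in> D" for s
    using F(3)[of "a + s *s v"] inb[OF that] by (simp add: g_def flip: cv)
  have "of_real l \<in> D"
  proof -
    have "norm (x - a) = \<bar>l\<bar> * norm v"
    proof -
      have "cvec (x - a) = of_real l *s cvec v"
        by (simp add: xv vec_eq_iff)
      then show ?thesis
        by (metis norm_cvec norm_of_real norm_s)
    qed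
    then show ?thesis
      using t(2) nv by (simp add: D_def x_def dist_norm norm_minus_commute pos_less_divide_eq)
  qed
  then have sums: "(\<lambda>j. (deriv ^^ j) g 0 / fact j * of_real l ^ j) sums g (of_real l)"
    using holomorphic_power_series[OF g[unfolded D_def], of "of_real l"] by (simp add: D_def)
  have "\<exists>j. Re ((deriv ^^ j) g 0 / fact j) \<noteq> 0"
  proof (rule ccontr)
    assume c: "\<not> ?thesis"
    have "Re ((deriv ^^ j) g 0 / fact j * of_real l ^ j) = 0" for j
    proof -
      have "Re (w * complex_of_real u) = Re w * u" for w u
        by simp
      then show ?thesis
        using c by (metis mult_zero_left of_real_power)
    qed
    then have "(\<lambda>j. 0) sums Re (g (of_real l))"
      using sums_Re[OF sums] by simp
    then have "Re (g (of_real l)) = 0"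
      by (simp add: sums_iff)
    then show False
      using fg[OF \<open>of_real l \<in> D\<close>] t(1) xv x_def by simp
  qed
  then obtain d where d: "Re ((deriv ^^ d) g 0 / fact d) \<noteq> 0"
    by blast
  have "has_tp (\<lambda>s. f (a + s *s v)) d (\<Sum>j\<le>d. monom (Re ((deriv ^^ j) g 0 / fact j)) j)"
  proof (rule holomorphic_real_tp[OF g[unfolded D_def]])
    have "\<forall>\<^sub>F s::real in nhds 0. \<bar>s\<bar> < e / norm v"
      unfolding eventually_nhds_metric using F(1) nv by (intro exI[of _ "e / norm v"]) auto
    then show "\<forall>\<^sub>F s in nhds 0. f (a + s *s v) = Re (g (of_real s))"
      by eventually_elim (rule fg, simp add: D_def)
  qed (use F(1) nv in auto)
  moreover have "coeff (\<Sum>j\<le>d. monom (Re ((deriv ^^ j) g 0 / fact j)) j) d \<noteq> 0"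
    using d by (simp add: coeff_sum)
  ultimately show thesis
    using that vk by blast
qed

text \<open>Identity theorem. If \<open>f\<close> vanishes near a point \<open>x0\<close> of the
  ball, consider \<open>F\<close> on the complex line through \<open>x0\<close> and any other real
  point of the ball. The parameters for which the line stays in the complex ball form a convex set,
  so continuation in one variable reaches the other point.\<close>

lemma ranalytic_nonzero_nearby:
  assumes f: "ranalytic f a" and nz: "\<not> (\<forall>\<^sub>F x in nhds a. f x = 0)"
  shows "\<forall>\<^sub>F b in nhds a. \<not> (\<forall>\<^sub>F x in nhds b. f x = 0)"
proof -
  obtain F e where F: "e > 0" "hol F (ball (cvec a) e)"
      "\<And>x. x \<in> ball a e \<Longrightarrow> F (cvec x) = of_real (f x)"
    using f unfolding ranalytic_def by blast
  have ball: "\<forall>\<^sub>F x in nhds a. x \<in> ball a e"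
    using F(1) by (intro eventually_nhds_in_open) auto
  have "\<forall>\<^sub>F x in nhds a. f x = 0" if x0: "x0 \<in> ball a e" and z: "\<forall>\<^sub>F x in nhds x0. f x = 0" for x0
  proof -
    obtain \<delta> where \<delta>: "\<delta> > 0" "\<And>x. dist x x0 < \<delta> \<Longrightarrow> f x = 0"
      using z unfolding eventually_nhds_metric by blast
    have "f x = 0" if x: "x \<in> ball a e" for x
    proof -
      define v where "v = x - x0"
      define D where "D = {w. cvec x0 + w *s cvec v \<in> ball (cvec a) e}"
      have cts: "continuous_on UNIV (\<lambda>w. cvec x0 + w *s cvec v)"
        unfolding vector_scalar_mult_def
        by (intro continuous_intros continuous_on_vec_lambda)
      have oD: "open D"
        unfolding D_def using open_vimage[OF open_ball cts] by (simp add: vimage_def)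
      have "convex D"
      proof (rule convexI)
        fix p q :: complex and u w :: real
        assume pq: "p \<in> D" "q \<in> D" and uw: "0 \<le> u" "0 \<le> w" "u + w = 1"
        have "u *\<^sub>R (cvec x0 + p *s cvec v) + w *\<^sub>R (cvec x0 + q *s cvec v) \<in> ball (cvec a) e"
          using pq uw unfolding D_def by (intro convexD[OF convex_ball]) auto
        moreover have "u *\<^sub>R (cvec x0 + p *s cvec v) + w *\<^sub>R (cvec x0 + q *s cvec v) =
            (u + w) *\<^sub>R cvec x0 + (u *\<^sub>R p + w *\<^sub>R q) *s cvec v"
          unfolding vec_eq_iff vector_add_component vector_scaleR_component vector_smult_component
          by (simp add: scaleR_conv_of_real algebra_simps)
        ultimately show "u *\<^sub>R p + w *\<^sub>R q \<in> D"
          using uw by (simp add: D_def)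
      qed
      then have cD: "connected D"
        by (rule convex_connected)
      have cv: "cvec (x0 + s *s v) = cvec x0 + of_real s *s cvec v" for s
        by (simp add: vec_eq_iff)
      have hol: "(\<lambda>w. F (cvec x0 + w *s cvec v)) holomorphic_on D"
        by (rule holD_curve[OF F(2) oD]) (auto simp: D_def intro!: holomorphic_intros)
      have "((\<lambda>s. x0 + s *s v) \<longlongrightarrow> x0 + 0 *s v) (nhds 0)"
        unfolding vector_scalar_mult_def
        by (intro tendsto_add tendsto_const vec_tendstoI) (auto intro!: tendsto_eq_intros simp: tendsto_nhds_iff)
      then have "\<forall>\<^sub>F s in nhds 0. x0 + s *s v \<in> ball x0 (min \<delta> (e - dist a x0))"
        by (rule topological_tendstoD[OF _ open_ball]) (use \<delta>(1) x0 in auto)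
      then obtain r where r: "r > 0" "\<And>s. \<bar>s\<bar> < r \<Longrightarrow> x0 + s *s v \<in> ball x0 (min \<delta> (e - dist a x0))"
        unfolding eventually_nhds_metric by auto
      have rr: "of_real s \<in> D \<and> F (cvec x0 + of_real s *s cvec v) = 0" if "\<bar>s\<bar> < r" for s :: real
      proof -
        have "dist x0 (x0 + s *s v) < \<delta>" "dist a x0 + dist x0 (x0 + s *s v) < e"
          using r(2)[OF that] by auto
        then have "f (x0 + s *s v) = 0" "x0 + s *s v \<in> ball a e"
          using \<delta>(2)[of "x0 + s *s v"] dist_triangle[of a "x0 + s *s v" x0] by (auto simp: dist_commute)
        then show ?thesis
          using F(3)[of "x0 + s *s v"] unfolding D_def by (simp flip: cv)
      qed
      define U where "U = complex_of_real ` {s. \<bar>s\<bar> < r}"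
      have "F (cvec x0 + 1 *s cvec v) = 0"
      proof (rule analytic_continuation[OF hol oD cD, of U 0])
        show "U \<subseteq> D"
          using rr by (auto simp: U_def)
        show "0 \<in> D"
          using rr[of 0] r by simp
        show "0 islimpt U"
          unfolding islimpt_approachable
        proof (intro allI impI)
          fix \<epsilon> :: real assume "\<epsilon> > 0"
          then have "complex_of_real (min \<epsilon> r / 2) \<in> U"
            unfolding U_def using r by (intro imageI) auto
          moreover have "complex_of_real (min \<epsilon> r / 2) \<noteq> 0" "norm (complex_of_real (min \<epsilon> r / 2)) < \<epsilon>"
            unfolding norm_of_real of_real_eq_0_iff using r(1) \<open>\<epsilon> > 0\<close> by (auto simp: min_def)
          ultimately show "\<exists>x'\<in>U. x' \<noteq> 0 \<and> dist x' 0 < \<epsilon>"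
            by (metis dist_0_norm dist_commute)
        qed
        show "F (cvec x0 + z *s cvec v) = 0" if "z \<in> U" for z
          using that rr by (auto simp: U_def)
        have "cvec x0 + 1 *s cvec v = cvec x"
          by (simp add: v_def cvec_diff)
        then show "1 \<in> D"
          using x by (simp add: D_def)
      qed
      moreover have "cvec x0 + 1 *s cvec v = cvec x"
        by (simp add: v_def cvec_diff)
      ultimately show ?thesis
        using F(3)[OF x] by simp
    qed
    then show ?thesis
      using ball by (auto elim: eventually_mono)
  qed
  then have "\<not> (\<forall>\<^sub>F x in nhds b. f x = 0)" if "b \<in> ball a e" for b
    using nz that by blast
  then show ?thesis
    by (rule eventually_mono[OF ball])
qed

text \<open>Germs form an integral domain: at a nearby point where \<open>g\<close> is nonzero,
  \<open>f\<close> would vanish identically, contrary to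
  \<open>ranalytic_nonzero_nearby\<close>.\<close>

lemma ranalytic_zero_prod:
  assumes f: "ranalytic f a" and g: "ranalytic g a" and fg: "\<forall>\<^sub>F x in nhds a. f x * g x = 0"
  shows "(\<forall>\<^sub>F x in nhds a. f x = 0) \<or> (\<forall>\<^sub>F x in nhds a. g x = 0)"
proof (rule ccontr)
  assume *: "\<not> ?thesis"
  have "\<forall>\<^sub>F x in nhds a. (\<forall>\<^sub>F y in nhds x. f y * g y = 0) \<and> ranalytic g x \<and> \<not> (\<forall>\<^sub>F y in nhds x. f y = 0)"
    using fg ranalytic_eventually[OF g] ranalytic_nonzero_nearby[OF f] * by (simp add: eventually_eventually eventually_conj_iff)
  then obtain x where x: "\<forall>\<^sub>F y in nhds x. f y * g y = 0" "ranalytic g x" "\<not> (\<forall>\<^sub>F y in nhds x. f y = 0)" "g x \<noteq> 0"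
    using * eventually_mono[of "\<lambda>x. (\<forall>\<^sub>F y in nhds x. f y * g y = 0) \<and> ranalytic g x \<and> \<not> (\<forall>\<^sub>F y in nhds x. f y = 0)" "nhds a" "\<lambda>x. g x = 0"]
    by blast
  have "\<forall>\<^sub>F y in nhds x. g y \<noteq> 0"
    using ranalytic_tendsto[OF x(2)] x(4) by (rule tendsto_imp_eventually_ne)
  with x(1) have "\<forall>\<^sub>F y in nhds x. f y = 0"
    by eventually_elim simp
  then show False
    using x(3) by blast
qed

section \<open>The implicit function theorem in one coordinate\<close>

text \<open>The root is the integral of \<open>w * g' w / g w\<close> over a circle that encloses
  exactly one zero, hence analytic in the parameters. That a real zero exists is shown separately by
  the intermediate value theorem; that it is the only one follows from a lower Lipschitz bound on
  the disc.\<close>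

lemma ranalytic_implicit:
  assumes G: "ranalytic G a" and G0: "G a = 0"
    and tp: "has_tp (\<lambda>s. G (upd a k (a $ k + s))) 1 p" and p1: "coeff p 1 \<noteq> 0"
  obtains \<phi> where "ranalytic \<phi> a" "\<phi> a = a $ k" "\<forall>\<^sub>F x in nhds a. G (upd x k (\<phi> x)) = 0"
proof -
  obtain F e where F: "e > 0" "hol F (ball (cvec a) e)"
      "\<And>x. x \<in> ball a e \<Longrightarrow> F (cvec x) = of_real (G x)"
    using G unfolding ranalytic_def by blast
  define T where "T z = deriv (\<lambda>w. F (upd z k (w + z $ k))) 0" for z
  have hT: "hol T (ball (cvec a) (e / 4))"
    using hol_taylor_coeff[OF F(2,1), of 1 k] by (simp add: T_def[abs_def])
  define \<mu> where "\<mu> = T (cvec a)"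
  \<comment> \<open>Half of the slope: where the derivative differs from \<open>\<mu>\<close> by
    less than \<open>L\<close>, differences of \<open>g\<close> are at least
    \<open>2 * L - L = L\<close> times the differences of the argument.\<close>
  define L where "L = \<bar>Re \<mu>\<bar> / 2"
  have "Re \<mu> = coeff p 1"
  proof -
    define g where "g w = F (upd (cvec a) k (w + cvec a $ k))" for w
    have g: "g holomorphic_on ball 0 e"
      unfolding g_def
    proof (rule hol_slice[OF F(2) open_ball])
      fix w :: complex assume w: "w \<in> ball 0 e"
      have "dist (upd (cvec a) k (w + cvec a $ k)) (cvec a) = norm w"
        unfolding dist_upd_self by (simp add: dist_norm)
      then show "upd (cvec a) k (w + cvec a $ k) \<in> ball (cvec a) e"
        using w by (simp add: dist_commute)
    qed
    have "has_tp (\<lambda>s. G (upd a k (a $ k + s))) 1 (\<Sum>j\<le>1. monom (Re ((deriv ^^ j) g 0 / fact j)) j)"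
    proof (rule holomorphic_real_tp[OF g F(1)])
      have "\<forall>\<^sub>F s::real in nhds 0. \<bar>s\<bar> < e"
        unfolding eventually_nhds_metric using F(1) by (intro exI[of _ e]) auto
      then show "\<forall>\<^sub>F s in nhds 0. G (upd a k (a $ k + s)) = Re (g (of_real s))"
      proof eventually_elim
        case (elim s)
        have "dist (upd a k (a $ k + s)) a = \<bar>s\<bar>"
          unfolding dist_upd_self by (simp add: dist_norm)
        then have "upd a k (a $ k + s) \<in> ball a e"
          using elim by (simp add: dist_commute)
        from F(3)[OF this] show ?case
          by (simp add: g_def cvec_upd add.commute)
      qed
    qed
    from has_tp_unique[OF this tp, of 1] show ?thesis
      by (simp add: \<mu>_def T_def g_def[abs_def] coeff_sum)
  qed
  then have L: "L > 0"
    using p1 by (simp add: L_def)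
  have \<mu>L: "norm \<mu> \<ge> 2 * L"
    using abs_Re_le_cmod[of \<mu>] by (simp add: L_def)
  have "\<forall>\<^sub>F z in nhds (cvec a). T z \<in> ball \<mu> L"
  proof -
    have "isCont T (cvec a)"
      using holD_cont[OF hT] F(1) by (simp add: continuous_on_eq_continuous_at)
    then show ?thesis
      using L topological_tendstoD[of T "T (cvec a)" "nhds (cvec a)" "ball \<mu> L"]
      by (simp add: continuous_at tendsto_nhds_iff \<mu>_def)
  qed
  then obtain \<rho>0 where \<rho>0: "\<rho>0 > 0" "\<And>z. dist z (cvec a) < \<rho>0 \<Longrightarrow> T z \<in> ball \<mu> L"
    unfolding eventually_nhds_metric by blast
  define \<rho> where "\<rho> = min \<rho>0 (e / 4)"
  have \<rho>: "\<rho> > 0" "\<rho> \<le> e / 4" "\<And>z. dist z (cvec a) < \<rho> \<Longrightarrow> norm (T z - \<mu>) < L"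
    using \<rho>0 F(1) by (auto simp: \<rho>_def dist_norm norm_minus_commute)
  define r where "r = \<rho> / 4"
  have r: "r > 0"
    using \<rho> by (simp add: r_def)
  define b where "b = cvec a $ k"
  define B where "B = ball (cvec a) r"
  define D where "D = ball b (2 * r)"
  have upd_in: "dist (upd z k w) (cvec a) < \<rho>" if "z \<in> B" "w \<in> D" for z w
    using dist_upd_le[of z k w "cvec a"] that by (simp add: B_def D_def r_def b_def dist_commute)
  have upd_in': "upd z k w \<in> ball (cvec a) e" "upd z k w \<in> ball (cvec a) (e / 4)" if "z \<in> B" "w \<in> D" for z w
    using upd_in[OF that] \<rho>(2) F(1) by (auto simp: dist_commute)
  define g where "g z w = F (upd z k w)" for z w
  have ghol: "g z holomorphic_on D" if z: "z \<in> B" for z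
    using hol_slice[OF F(2), of D z k 0] upd_in'(1)[OF z] unfolding g_def[abs_def] D_def by auto
  have gder: "(g z has_field_derivative T (upd z k w)) (at w)" if z: "z \<in> B" and w: "w \<in> D" for z w
  proof -
    have "T (upd z k w) = deriv (\<lambda>u. g z (w + u)) 0"
      by (simp add: T_def g_def[abs_def] add.commute)
    also have "\<dots> = deriv (g z) w"
      using deriv_shift_0[of "g z" w] by (simp add: o_def)
    finally show ?thesis
      using holomorphic_derivI[OF ghol[OF z] _ w] by (simp add: D_def)
  qed
  have lip: "norm (g z w - g z w' - \<mu> * (w - w')) \<le> L * norm (w - w')"
    if z: "z \<in> B" and w: "w \<in> D" "w' \<in> D" for z w w'
  proof -
    have "norm ((g z w - \<mu> * w) - (g z w' - \<mu> * w')) \<le> L * norm (w - w')"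
    proof (rule field_differentiable_bound[of D _ "\<lambda>w. T (upd z k w) - \<mu>"])
      show "convex D"
        by (simp add: D_def)
      show "((\<lambda>w. g z w - \<mu> * w) has_field_derivative T (upd z k u) - \<mu>) (at u within D)" if "u \<in> D" for u
        by (rule has_field_derivative_at_within[OF DERIV_diff[OF gder[OF z that] DERIV_cmult_Id]])
      show "norm (T (upd z k u) - \<mu>) \<le> L" if "u \<in> D" for u
        using \<rho>(3)[OF upd_in[OF z that]] by simp
    qed (use w in auto)
    then show ?thesis
      by (simp add: algebra_simps)
  qed
  have lower: "norm (g z w - g z w') \<ge> L * norm (w - w')"
    if "z \<in> B" "w \<in> D" "w' \<in> D" for z w w'
  proof -
    have "norm (\<mu> * (w - w')) \<le> norm (g z w - g z w') + norm (g z w - g z w' - \<mu> * (w - w'))"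
      by (metis norm_triangle_sub norm_minus_commute)
    then have "norm \<mu> * norm (w - w') \<le> norm (g z w - g z w') + L * norm (w - w')"
      using lip[OF that] by (simp add: norm_mult)
    moreover have "2 * L * norm (w - w') \<le> norm \<mu> * norm (w - w')"
      by (intro mult_right_mono \<mu>L) auto
    ultimately show ?thesis
      by linarith
  qed
  have bD: "b \<in> D" "cball b r \<subseteq> D" "sphere b r \<subseteq> D"
    using r by (auto simp: D_def)
  have "isCont (\<lambda>z. g z b) (cvec a)"
  proof -
    have "continuous_on B (\<lambda>z. g z b)"
      unfolding g_def
      by (intro continuous_on_compose2[OF holD_cont[OF F(2)]] continuous_intros) (use upd_in'(1) bD(1) in blast)
    then show ?thesis
      using r by (simp add: B_def continuous_on_eq_continuous_at)
  qed
  moreover have "g (cvec a) b = 0"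
    using F(1) F(3)[of a] G0 by (simp add: g_def b_def del: cvec_nth)
  \<comment> \<open>The bound \<open>L * r / 2\<close> serves twice. It is below
    \<open>L * r\<close>, so \<open>g\<close> has no zero on the circle; and
    \<open>L * r + L * r / 2 < 2 * L * r\<close> fixes the signs at both ends of the real
    interval.\<close>
  ultimately have "\<forall>\<^sub>F z in nhds (cvec a). g z b \<in> ball 0 (L * r / 2)"
    using topological_tendstoD[of "\<lambda>z. g z b" "g (cvec a) b" "nhds (cvec a)" "ball 0 (L * r / 2)"] L r
    by (simp add: continuous_at tendsto_nhds_iff)
  then obtain r1 where r1: "r1 > 0" "\<And>z. dist z (cvec a) < r1 \<Longrightarrow> norm (g z b) < L * r / 2"
    unfolding eventually_nhds_metric by auto
  define r0 where "r0 = min r r1"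
  define B0 where "B0 = ball (cvec a) r0"
  have B0: "B0 \<subseteq> B" "r0 > 0" "\<And>z. z \<in> B0 \<Longrightarrow> norm (g z b) < L * r / 2"
    using r r1 by (auto simp: B0_def B_def r0_def dist_commute)
  have gnz: "g z w \<noteq> 0" if z: "z \<in> B0" and w: "w \<in> sphere b r" for z w
  proof
    assume 0: "g z w = 0"
    have "L * norm (w - b) \<le> norm (g z w - g z b)"
      using lower[of z w b] z w B0(1) bD by blast
    then have "L * r \<le> norm (g z b)"
      using w 0 by (simp add: dist_norm norm_minus_commute)
    moreover have "L * r / 2 < L * r"
      using L r by simp
    ultimately show False
      using B0(3)[OF z] by linarith
  qed
  define H where "H z w = w * T (upd z k w) / g z w" for z w
  have in_upd: "upd z k (w + 0 * z $ k) \<in> ball (cvec a) e"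
      "upd z k (w + 0 * z $ k) \<in> ball (cvec a) (e / 4)" if "z \<in> B0" "w \<in> sphere b r" for z w
  proof -
    have "z \<in> B" "w \<in> D"
      using that B0(1) bD(3) by blast+
    then show "upd z k (w + 0 * z $ k) \<in> ball (cvec a) e"
      "upd z k (w + 0 * z $ k) \<in> ball (cvec a) (e / 4)"
      using upd_in'[of z w] by simp_all
  qed
  have "hol (\<lambda>z. contour_integral (circlepath b r) (H z)) B0"
  proof (rule hol_circle_integral[OF r])
    have "continuous_on (B0 \<times> sphere b r) (\<lambda>p. F (upd (fst p) k (snd p + 0 * fst p $ k)))"
      by (rule cont_upd_pair[OF F(2)]) (rule in_upd(1))
    moreover have "continuous_on (B0 \<times> sphere b r) (\<lambda>p. T (upd (fst p) k (snd p + 0 * fst p $ k)))"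
      by (rule cont_upd_pair[OF hT]) (rule in_upd(2))
    ultimately show "continuous_on (B0 \<times> sphere b r) (\<lambda>(z, w). H z w)"
      unfolding H_def g_def case_prod_beta using gnz
      by (intro continuous_intros) (auto simp: g_def)
    fix w assume w: "w \<in> sphere b r"
    have "hol (\<lambda>z. F (upd z k (w + 0 * z $ k))) B0"
      by (rule hol_upd[OF F(2)]) (rule in_upd(1)[OF _ w])
    moreover have "hol (\<lambda>z. T (upd z k (w + 0 * z $ k))) B0"
      by (rule hol_upd[OF hT]) (rule in_upd(2)[OF _ w])
    ultimately show "hol (\<lambda>z. H z w) B0"
      unfolding H_def g_def using gnz[OF _ w]
      by (intro hol_divide hol_mult hol_const) (auto simp: g_def)
  qed
  then have h\<Phi>: "hol (\<lambda>z. 1 / (2 * pi * \<i>) * contour_integral (circlepath b r) (H z)) B0"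
    by (rule hol_mult[OF hol_const])
  define \<phi> where "\<phi> x = Re (1 / (2 * pi * \<i>) * contour_integral (circlepath b r) (H (cvec x)))" for x
  have "ranalytic \<phi> a"
    by (rule ranalytic_Re[OF B0(2), of "\<lambda>z. 1 / (2 * pi * \<i>) * contour_integral (circlepath b r) (H z)"])
       (use h\<Phi> in \<open>auto simp: \<phi>_def B0_def\<close>)
  moreover have root: "\<phi> x = t" if x: "cvec x \<in> B0" and t: "\<bar>t - a $ k\<bar> \<le> r" "G (upd x k t) = 0" for x t
  proof -
    define z where "z = cvec x"
    define w0 where "w0 = complex_of_real t"
    have z: "z \<in> B0" "z \<in> B"
      using x B0(1) by (auto simp: z_def)
    have "dist b w0 \<le> r"
      using t(1) by (simp add: b_def w0_def dist_norm norm_minus_commute flip: of_real_diff)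
    then have w0D: "w0 \<in> D"
      using bD(2) by auto
    have gw0: "g z w0 = 0"
    proof -
      have "upd z k w0 = cvec (upd x k t)"
        by (simp add: z_def w0_def cvec_upd)
      then show ?thesis
        using upd_in'(1)[OF z(2) w0D] F(3)[of "upd x k t"] t(2) by (simp add: g_def)
    qed
    then have w0: "dist b w0 < r"
      using gnz[OF z(1), of w0] \<open>dist b w0 \<le> r\<close> by (cases "dist b w0 = r") auto
    have gnz': "g z w \<noteq> 0" if "w \<in> D" "w \<noteq> w0" for w
    proof
      assume "g z w = 0"
      then have "L * norm (w - w0) \<le> 0"
        using lower[OF z(2) that(1) w0D] gw0 by simp
      moreover have "L * norm (w - w0) > 0"
        using L that(2) by simp
      ultimately show False
        by linarith
    qed
    \<comment> \<open>The integrand is \<open>q w / (w - w0)\<close>, and \<open>q\<close> has a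
      removable singularity with value \<open>w0\<close> because \<open>g z w / (w - w0)\<close>
      tends to the derivative. Cauchy's formula for \<open>q\<close> then returns the root
      \<open>w0\<close>.\<close>
    define q where "q w = (if w = w0 then w0 else w * T (upd z k w) * (w - w0) / g z w)" for w
    have Thol: "(\<lambda>w. T (upd z k w)) holomorphic_on D"
      using hol_slice[OF hT, of D z k 0] upd_in'(2)[OF z(2)] unfolding D_def by auto
    have qhol: "q holomorphic_on D"
    proof (rule no_isolated_singularity'[where K = "{w0}"])
      show "open D"
        by (simp add: D_def)
      have "(\<lambda>w. w * T (upd z k w) * (w - w0) / g z w) holomorphic_on D - {w0}"
        using gnz' by (intro holomorphic_intros holomorphic_on_subset[OF Thol] holomorphic_on_subset[OF ghol[OF z(2)]]) auto
      then show "q holomorphic_on D - {w0}"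
        by (rule holomorphic_transform) (auto simp: q_def)
      fix u assume "u \<in> {w0}"
      then have u: "u = w0"
        by simp
      have Tw0: "T (upd z k w0) \<noteq> 0"
      proof
        assume "T (upd z k w0) = 0"
        then have "norm \<mu> < L"
          using \<rho>(3)[OF upd_in[OF z(2) w0D]] by simp
        then show False
          using \<mu>L L by linarith
      qed
      have "((\<lambda>w. (g z w - g z w0) / (w - w0)) \<longlongrightarrow> T (upd z k w0)) (at w0)"
        using gder[OF z(2) w0D] by (simp add: has_field_derivative_iff)
      moreover have "isCont (\<lambda>w. T (upd z k w)) w0"
        using holomorphic_on_imp_continuous_on[OF Thol] w0D
        by (simp add: D_def continuous_on_eq_continuous_at)
      then have "((\<lambda>w. w * T (upd z k w)) \<longlongrightarrow> w0 * T (upd z k w0)) (at w0)"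
        by (intro tendsto_intros) (simp add: isCont_def)
      ultimately have "((\<lambda>w. w * T (upd z k w) / ((g z w - g z w0) / (w - w0))) \<longlongrightarrow>
          w0 * T (upd z k w0) / T (upd z k w0)) (at w0)"
        using Tw0 by (intro tendsto_divide)
      moreover have "w0 * T (upd z k w0) / T (upd z k w0) = w0"
        using Tw0 by simp
      ultimately have lim: "((\<lambda>w. w * T (upd z k w) / ((g z w - g z w0) / (w - w0))) \<longlongrightarrow> w0) (at w0)"
        by (simp only:)
      have "w * T (upd z k w) / ((g z w - g z w0) / (w - w0)) = q w" if "w \<noteq> w0" for w
        using that by (simp add: q_def gw0)
      then have "\<forall>\<^sub>F w in at w0. w * T (upd z k w) / ((g z w - g z w0) / (w - w0)) = q w"
        by (simp add: eventually_at_filter)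
      then have "(q \<longlongrightarrow> w0) (at w0)"
        by (rule Lim_transform_eventually[OF lim])
      moreover have "q w0 = w0"
        by (simp add: q_def)
      ultimately show "(q \<longlongrightarrow> q u) (at u within D)"
        unfolding u by (simp only: tendsto_within_subset[OF _ subset_UNIV])
    qed simp
    have qcont: "continuous_on (cball b r) q"
      by (rule holomorphic_on_imp_continuous_on[OF holomorphic_on_subset[OF qhol bD(2)]])
    have "q holomorphic_on ball b r"
      by (rule holomorphic_on_subset[OF qhol order_trans[OF ball_subset_cball bD(2)]])
    moreover have "norm (w0 - b) < r"
      using w0 by (simp add: dist_norm norm_minus_commute)
    ultimately have "((\<lambda>w. q w / (w - w0)) has_contour_integral 2 * pi * \<i> * q w0) (circlepath b r)"
      using Cauchy_integral_circlepath[OF qcont] by simp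
    then have "(H z has_contour_integral 2 * pi * \<i> * q w0) (circlepath b r)"
    proof (rule has_contour_integral_eq)
      fix w assume "w \<in> path_image (circlepath b r)"
      then have w: "w \<in> sphere b r"
        using r by (simp add: path_image_circlepath)
      then have "w \<noteq> w0"
        using w0 by auto
      then show "q w / (w - w0) = H z w"
        by (simp add: q_def H_def)
    qed
    then have "contour_integral (circlepath b r) (H z) = 2 * pi * \<i> * w0"
      by (simp add: contour_integral_unique q_def)
    then show ?thesis
      by (simp add: \<phi>_def z_def w0_def)
  qed
  moreover have "\<phi> a = a $ k"
    by (rule root) (use B0 r G0 in \<open>auto simp: B0_def\<close>)
  moreover have "G (upd x k (\<phi> x)) = 0" if x: "cvec x \<in> B0" for x
  proof -
    define z where "z = cvec x"
    have z: "z \<in> B"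
      using x B0(1) by (auto simp: z_def)
    define h where "h t = G (upd x k t)" for t
    have tD: "of_real t \<in> D" if "\<bar>t - a $ k\<bar> \<le> r" for t
      using that r by (simp add: D_def b_def dist_norm norm_minus_commute flip: of_real_diff)
    have hg: "h t = Re (g z (of_real t))" "upd x k t \<in> ball a e" if "\<bar>t - a $ k\<bar> \<le> r" for t
    proof -
      have "upd z k (of_real t) = cvec (upd x k t)"
        by (simp add: z_def cvec_upd)
      then show "h t = Re (g z (of_real t))" "upd x k t \<in> ball a e"
        using upd_in'(1)[OF z tD[OF that]] F(3)[of "upd x k t"] by (auto simp: g_def h_def)
    qed
    have cont: "continuous_on {a $ k - r..a $ k + r} h"
    proof (rule continuous_on_eq)
      show "continuous_on {a $ k - r..a $ k + r} (\<lambda>t. Re (g z (of_real t)))"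
        by (intro continuous_intros continuous_on_compose2[OF holomorphic_on_imp_continuous_on[OF ghol[OF z]]])
           (auto intro!: tD)
      show "Re (g z (of_real t)) = h t" if "t \<in> {a $ k - r..a $ k + r}" for t
        using that by (intro hg(1)[symmetric]) auto
    qed
    have est: "\<bar>h (a $ k + s) - Re \<mu> * s\<bar> < \<bar>Re \<mu>\<bar> * r" if s: "\<bar>s\<bar> = r" for s
    proof -
      have sD: "b + of_real s \<in> D"
        using tD[of "a $ k + s"] s by (simp add: b_def)
      have "norm (g z (b + of_real s) - g z b - \<mu> * of_real s) \<le> L * r"
        using lip[OF z sD bD(1)] s by simp
      then have "norm (g z (b + of_real s) - \<mu> * of_real s) \<le> L * r + norm (g z b)"
        using norm_triangle_ineq[of "g z (b + of_real s) - g z b - \<mu> * of_real s" "g z b"] by simp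
      also have "\<dots> < L * r + L * r / 2"
        using B0(3)[OF x] by (simp add: z_def)
      also have "\<dots> < \<bar>Re \<mu>\<bar> * r"
        using L r unfolding L_def by (simp add: field_simps)
      finally have "norm (g z (b + of_real s) - \<mu> * of_real s) < \<bar>Re \<mu>\<bar> * r" .
      moreover have "h (a $ k + s) - Re \<mu> * s = Re (g z (b + of_real s) - \<mu> * of_real s)"
        using s by (subst hg) (auto simp: b_def)
      ultimately show ?thesis
        by (metis abs_Re_le_cmod order_le_less_trans)
    qed
    have e1: "\<bar>h (a $ k + r) - Re \<mu> * r\<bar> < \<bar>Re \<mu>\<bar> * r"
      using est[of r] r by simp
    have e2: "\<bar>h (a $ k + - r) + Re \<mu> * r\<bar> < \<bar>Re \<mu>\<bar> * r"
      using est[of "- r"] r by simp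
    have "\<exists>t\<ge>a $ k - r. t \<le> a $ k + r \<and> h t = 0"
    proof (cases "Re \<mu> > 0")
      case True
      then have "\<bar>Re \<mu>\<bar> * r = Re \<mu> * r"
        by simp
      with e1 e2 have "h (a $ k + - r) \<le> 0" "h (a $ k + r) \<ge> 0"
        by linarith+
      then show ?thesis
        using IVT'[of h "a $ k - r" 0 "a $ k + r"] cont r by auto
    next
      case False
      then have "Re \<mu> < 0"
        using L by (auto simp: L_def not_less)
      then have "\<bar>Re \<mu>\<bar> * r = - (Re \<mu> * r)"
        by simp
      with e1 e2 have "h (a $ k + - r) \<ge> 0" "h (a $ k + r) \<le> 0"
        by linarith+
      then show ?thesis
        using IVT2'[of h "a $ k + r" 0 "a $ k - r"] cont r by auto
    qed
    then obtain t where t: "\<bar>t - a $ k\<bar> \<le> r" "h t = 0"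
      by (auto simp: abs_le_iff algebra_simps)
    then have "\<phi> x = t"
      using root[OF x t(1)] by (simp add: h_def)
    then show ?thesis
      using t(2) by (simp add: h_def)
  qed
  then have "\<forall>\<^sub>F x in nhds a. G (upd x k (\<phi> x)) = 0"
    unfolding eventually_nhds_metric using B0(2)
    by (intro exI[of _ r0]) (auto simp: B0_def dist_commute)
  ultimately show thesis
    using that by blast
qed

section \<open>Order in one coordinate\<close>

lemma has_tp_cong:
  assumes "has_tp \<phi> m p" "\<forall>\<^sub>F s in nhds 0. \<psi> s = \<phi> s"
  shows "has_tp \<psi> m p"
proof -
  obtain B where "\<forall>\<^sub>F s in nhds 0. \<bar>\<phi> s - poly p s\<bar> \<le> B * \<bar>s\<bar> ^ Suc m"
    using assms(1) unfolding has_tp_def by blast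
  with assms(2) have "\<forall>\<^sub>F s in nhds 0. \<bar>\<psi> s - poly p s\<bar> \<le> B * \<bar>s\<bar> ^ Suc m"
    by eventually_elim simp
  then show ?thesis
    unfolding has_tp_def ..
qed

lemma has_tp_poly: "has_tp (poly p) m p"
  unfolding has_tp_def by (intro exI[of _ 0]) simp

lemma has_tp_add:
  assumes "has_tp \<phi> m p" "has_tp \<psi> m q"
  shows "has_tp (\<lambda>s. \<phi> s + \<psi> s) m (p + q)"
proof -
  obtain B C where "\<forall>\<^sub>F s in nhds 0. \<bar>\<phi> s - poly p s\<bar> \<le> B * \<bar>s\<bar> ^ Suc m"
    "\<forall>\<^sub>F s in nhds 0. \<bar>\<psi> s - poly q s\<bar> \<le> C * \<bar>s\<bar> ^ Suc m"
    using assms unfolding has_tp_def by blast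
  then have "\<forall>\<^sub>F s in nhds 0. \<bar>\<phi> s + \<psi> s - poly (p + q) s\<bar> \<le> (B + C) * \<bar>s\<bar> ^ Suc m"
    unfolding distrib_right poly_add by eventually_elim linarith
  then show ?thesis
    unfolding has_tp_def ..
qed

lemma eventually_abs_less: "\<epsilon> > 0 \<Longrightarrow> \<forall>\<^sub>F s::real in nhds 0. \<bar>s\<bar> < \<epsilon>"
  unfolding eventually_nhds_metric by (intro exI[of _ \<epsilon>]) auto

lemma has_tp_bounded:
  assumes "has_tp \<phi> m p"
  shows "\<exists>C\<ge>0. \<forall>\<^sub>F s in nhds 0. \<bar>\<phi> s\<bar> \<le> C"
proof -
  obtain B where B: "\<forall>\<^sub>F s in nhds 0. \<bar>\<phi> s - poly p s\<bar> \<le> B * \<bar>s\<bar> ^ Suc m"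
    using assms unfolding has_tp_def by blast
  have "\<forall>\<^sub>F s in nhds 0. poly p s \<in> ball (poly p 0) 1"
    by (rule topological_tendstoD[OF _ open_ball]) (auto simp: tendsto_nhds_iff intro!: tendsto_intros)
  with B eventually_abs_less[OF zero_less_one]
  have "\<forall>\<^sub>F s in nhds 0. \<bar>\<phi> s\<bar> \<le> \<bar>B\<bar> + \<bar>poly p 0\<bar> + 1"
  proof eventually_elim
    case (elim s)
    have "B * \<bar>s\<bar> ^ Suc m \<le> \<bar>B\<bar> * \<bar>s\<bar> ^ Suc m"
      by (intro mult_right_mono) auto
    also have "\<dots> \<le> \<bar>B\<bar> * 1"
      using elim by (intro mult_left_mono power_le_one) auto
    finally show ?case
      using elim(1,3) unfolding mem_ball dist_real_def by linarith
  qed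
  then show ?thesis
    by (intro exI[of _ "\<bar>B\<bar> + \<bar>poly p 0\<bar> + 1"]) simp
qed

lemma has_tp_mult:
  assumes \<phi>: "has_tp \<phi> m p" and \<psi>: "has_tp \<psi> m q"
  shows "has_tp (\<lambda>s. \<phi> s * \<psi> s) m (p * q)"
proof -
  obtain B C where BC: "\<forall>\<^sub>F s in nhds 0. \<bar>\<phi> s - poly p s\<bar> \<le> B * \<bar>s\<bar> ^ Suc m"
    "\<forall>\<^sub>F s in nhds 0. \<bar>\<psi> s - poly q s\<bar> \<le> C * \<bar>s\<bar> ^ Suc m"
    using assms unfolding has_tp_def by blast
  obtain M N where MN: "M \<ge> 0" "\<forall>\<^sub>F s in nhds 0. \<bar>\<phi> s\<bar> \<le> M" "N \<ge> 0" "\<forall>\<^sub>F s in nhds 0. \<bar>poly q s\<bar> \<le> N"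
    using has_tp_bounded[OF \<phi>] has_tp_bounded[OF has_tp_poly[of q m]] by blast
  from BC MN(2,4) have "\<forall>\<^sub>F s in nhds 0. \<bar>\<phi> s * \<psi> s - poly (p * q) s\<bar> \<le> (M * C + N * B) * \<bar>s\<bar> ^ Suc m"
  proof eventually_elim
    case (elim s)
    have "\<phi> s * \<psi> s - poly (p * q) s = \<phi> s * (\<psi> s - poly q s) + poly q s * (\<phi> s - poly p s)"
      by (simp add: algebra_simps)
    also have "\<bar>\<dots>\<bar> \<le> \<bar>\<phi> s\<bar> * \<bar>\<psi> s - poly q s\<bar> + \<bar>poly q s\<bar> * \<bar>\<phi> s - poly p s\<bar>"
      by (metis abs_mult abs_triangle_ineq)
    also have "\<dots> \<le> M * (C * \<bar>s\<bar> ^ Suc m) + N * (B * \<bar>s\<bar> ^ Suc m)"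
      using elim MN by (intro add_mono mult_mono) auto
    finally show ?case
      by (simp add: algebra_simps)
  qed
  then show ?thesis
    unfolding has_tp_def ..
qed

lemma has_tp_scale:
  assumes "has_tp \<phi> m (\<Sum>j\<le>m. monom (U j) j)"
  shows "has_tp (\<lambda>s. \<phi> (l * s)) m (\<Sum>j\<le>m. monom (U j * l ^ j) j)"
proof -
  obtain B where B: "\<forall>\<^sub>F s in nhds 0. \<bar>\<phi> s - poly (\<Sum>j\<le>m. monom (U j) j) s\<bar> \<le> B * \<bar>s\<bar> ^ Suc m"
    using assms unfolding has_tp_def by blast
  have "filterlim (\<lambda>s. l * s) (nhds 0) (nhds 0)"
    by (auto simp: tendsto_nhds_iff intro!: tendsto_eq_intros)
  from eventually_compose_filterlim[OF B this]
  have "\<forall>\<^sub>F s in nhds 0. \<bar>\<phi> (l * s) - poly (\<Sum>j\<le>m. monom (U j * l ^ j) j) s\<bar> \<le> (B * \<bar>l\<bar> ^ Suc m) * \<bar>s\<bar> ^ Suc m"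
    by eventually_elim (simp add: poly_sum poly_monom power_mult_distrib abs_mult mult_ac)
  then show ?thesis
    unfolding has_tp_def ..
qed

lemma has_tp_power_mult:
  assumes "\<forall>\<^sub>F s in nhds 0. \<bar>q s\<bar> \<le> C" "m < d"
  shows "has_tp (\<lambda>s. s ^ d * q s) m 0"
proof -
  from assms(1) eventually_abs_less[OF zero_less_one]
  have "\<forall>\<^sub>F s in nhds 0. \<bar>s ^ d * q s - poly 0 s\<bar> \<le> C * \<bar>s\<bar> ^ Suc m"
  proof eventually_elim
    case (elim s)
    have "\<bar>s\<bar> ^ d * \<bar>q s\<bar> \<le> \<bar>s\<bar> ^ Suc m * C"
      using elim assms(2) by (intro mult_mono power_decreasing) auto
    then show ?case
      by (simp add: abs_mult power_abs mult_ac)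
  qed
  then show ?thesis
    unfolding has_tp_def ..
qed

section \<open>Restriction to lines in a coordinate direction\<close>

lemma tendsto_line: "((\<lambda>s. upd a n (a $ n + s)) \<longlongrightarrow> a) (nhds (0::real))"
proof -
  have "((\<lambda>s. upd a n (a $ n + s)) \<longlongrightarrow> upd a n (a $ n + 0)) (nhds (0::real))"
    by (intro tendsto_intros) (simp add: tendsto_nhds_iff)
  then show ?thesis
    by simp
qed

lemma eventually_line:
  "\<forall>\<^sub>F x in nhds a. P x \<Longrightarrow> \<forall>\<^sub>F s::real in nhds 0. P (upd a n (a $ n + s))"
  by (rule eventually_compose_filterlim[OF _ tendsto_line])

lemma eventually_upd:
  fixes a :: "real ^ 'k"
  assumes "\<forall>\<^sub>F x in nhds a. P x" shows "\<forall>\<^sub>F x in nhds a. P (upd x n (a $ n))"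
proof (rule eventually_compose_filterlim[OF assms])
  have "((\<lambda>x. upd x n (a $ n)) \<longlongrightarrow> upd a n (a $ n)) (nhds a)"
    by (intro tendsto_intros) (simp add: tendsto_nhds_iff)
  then show "((\<lambda>x. upd x n (a $ n)) \<longlongrightarrow> a) (nhds a)"
    by simp
qed

lemma ranalytic_taylor_ex:
  assumes "ranalytic f a"
  shows "\<exists>T. (\<forall>j. ranalytic (T j) a) \<and>
    (\<forall>m. \<forall>\<^sub>F x in nhds a. has_tp (\<lambda>s. f (upd x k (x $ k + s))) m (\<Sum>j\<le>m. monom (T j x) j)) \<and>
    (\<forall>j. \<forall>\<^sub>F x in nhds a. has_tp (\<lambda>s. T j (upd x k (x $ k + s))) 1 [:T j x, of_nat (Suc j) * T (Suc j) x:])"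
  by (rule ranalytic_taylor[OF assms, of k], intro exI conjI allI)

lemma has_tp_ranalytic0:
  assumes "ranalytic u a" shows "has_tp (\<lambda>s. u (upd a n (a $ n + s))) 0 [:u a:]"
proof -
  obtain T where
    "\<And>m. \<forall>\<^sub>F x in nhds a. has_tp (\<lambda>s. u (upd x n (x $ n + s))) m (\<Sum>j\<le>m. monom (T j x) j)"
    using ranalytic_taylor_ex[OF assms, of n] by blast
  from this[of 0] have *: "has_tp (\<lambda>s. u (upd a n (a $ n + s))) 0 (\<Sum>j\<le>0. monom (T j a) j)"
    by (rule eventually_nhds_x_imp_x)
  then obtain B where "\<forall>\<^sub>F s in nhds 0. \<bar>u (upd a n (a $ n + s)) - poly (\<Sum>j\<le>0. monom (T j a) j) s\<bar> \<le> B * \<bar>s\<bar> ^ Suc 0"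
    unfolding has_tp_def by blast
  from eventually_nhds_x_imp_x[OF this] have "T 0 a = u a"
    by (simp add: poly_monom)
  then show ?thesis
    using * by (simp add: monom_0)
qed

text \<open>The restriction of \<open>f\<close> to the line through \<open>a\<close> in direction \<open>n\<close> has order at most \<open>d\<close>.\<close>
definition ordn :: "'k \<Rightarrow> nat \<Rightarrow> (real ^ 'k \<Rightarrow> real) \<Rightarrow> real ^ 'k \<Rightarrow> bool" where
  "ordn n d f a \<longleftrightarrow> (\<exists>p. has_tp (\<lambda>s. f (upd a n (a $ n + s))) d p \<and> coeff p d \<noteq> 0)"

text \<open>The coefficient of \<open>s ^ (d - 1)\<close> is \<open>t0 * (\<Sum>j<d. (d choose Suc j) * (t0 * l) ^ j * U j)\<close>
  with \<open>U j\<close> the Taylor coefficients of \<open>u\<close> at \<open>y\<close>; the bracket tends to \<open>d * u c\<close>.\<close>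
lemma next_coeff_nonzero:
  fixes c :: "real ^ 'k"
  assumes u: "ranalytic u c" and uc: "u c \<noteq> 0" and d: "d \<ge> 1"
  obtains \<delta> where "\<delta> > 0"
    "\<And>y t0 l I e. dist y c < \<delta> \<Longrightarrow> \<bar>t0 * l\<bar> < \<delta> \<Longrightarrow> t0 \<noteq> 0 \<Longrightarrow> I \<subseteq> {..<d - 1} \<Longrightarrow>
      \<exists>p. has_tp (\<lambda>s. (\<Sum>i\<in>I. e i * (t0 + s) ^ i) + (t0 + s) ^ d * u (upd y n (y $ n + l * s))) (d - 1) p \<and>
        coeff p (d - 1) \<noteq> 0"
proof -
  obtain T where T: "\<And>j. ranalytic (T j) c"
    "\<And>m. \<forall>\<^sub>F x in nhds c. has_tp (\<lambda>s. u (upd x n (x $ n + s))) m (\<Sum>j\<le>m. monom (T j x) j)"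
    using ranalytic_taylor_ex[OF u, of n] by blast
  have T0: "T 0 c = u c"
    using has_tp_unique[OF eventually_nhds_x_imp_x[OF T(2)] has_tp_ranalytic0[OF u, of n], of 0] by simp
  \<comment> \<open>Only \<open>y\<close> and the product \<open>t0 * l\<close> enter. The radius is
    therefore the same for all coefficients \<open>e\<close>, index sets \<open>I\<close> and
    individual values of \<open>t0\<close> and \<open>l\<close>.\<close>
  define \<Phi> where "\<Phi> p = (\<Sum>j<d. of_nat (d choose Suc j) * snd p ^ j * T j (fst p))" for p :: "(real ^ 'k) \<times> real"
  have "(\<Phi> \<longlongrightarrow> \<Phi> (c, 0)) (nhds (c, 0))"
  proof -
    have "((\<lambda>p. T j (fst p)) \<longlongrightarrow> T j c) (nhds (c, 0::real))" for j
      by (rule filterlim_compose[OF ranalytic_tendsto[OF T(1)]])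
         (use tendsto_fst[of "\<lambda>x. x" "(c, 0::real)" "nhds (c, 0)"] in \<open>simp add: tendsto_nhds_iff\<close>)
    moreover have "(snd \<longlongrightarrow> 0) (nhds (c, 0::real))"
      using tendsto_snd[of "\<lambda>x. x" "(c, 0::real)" "nhds (c, 0)"] by (simp add: tendsto_nhds_iff)
    ultimately show ?thesis
      unfolding \<Phi>_def fst_conv snd_conv by (intro tendsto_intros)
  qed
  moreover have "\<Phi> (c, 0) = of_nat d * u c"
  proof -
    have "\<Phi> (c, 0) = (\<Sum>j<d. if j = 0 then of_nat d * u c else 0)"
      unfolding \<Phi>_def by (rule sum.cong) (auto simp: T0)
    then show ?thesis
      using d by (simp add: sum.delta)
  qed
  ultimately have "\<forall>\<^sub>F p in nhds (c, 0). \<Phi> p \<noteq> 0"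
    using uc d by (intro tendsto_imp_eventually_ne[of \<Phi> "\<Phi> (c, 0)"]) auto
  then obtain P Q where PQ: "eventually P (nhds c)" "eventually Q (nhds 0)"
      "\<And>y t. P y \<Longrightarrow> Q t \<Longrightarrow> \<Phi> (y, t) \<noteq> 0"
    unfolding nhds_prod eventually_prod_filter by blast
  obtain \<delta>1 where \<delta>1: "\<delta>1 > 0" "\<And>y. dist y c < \<delta>1 \<Longrightarrow> P y \<and>
      has_tp (\<lambda>s. u (upd y n (y $ n + s))) (d - 1) (\<Sum>j\<le>d - 1. monom (T j y) j)"
    using eventually_conj[OF PQ(1) T(2)[of "d - 1"]] unfolding eventually_nhds_metric by blast
  obtain \<delta>2 where \<delta>2: "\<delta>2 > 0" "\<And>t. \<bar>t\<bar> < \<delta>2 \<Longrightarrow> Q t"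
    using PQ(2) unfolding eventually_nhds_metric by auto
  show thesis
  proof (rule that[of "min \<delta>1 \<delta>2"])
    show "min \<delta>1 \<delta>2 > 0"
      using \<delta>1 \<delta>2 by simp
    fix y t0 l I and e :: "nat \<Rightarrow> real"
    assume y: "dist y c < min \<delta>1 \<delta>2" and tl: "\<bar>t0 * l\<bar> < min \<delta>1 \<delta>2" and t0: "t0 \<noteq> 0" and I: "I \<subseteq> {..<d - 1}"
    define V where "V = (\<Sum>j\<le>d - 1. monom (T j y * l ^ j) j)"
    define p where "p = (\<Sum>i\<in>I. smult (e i) ([:t0, 1:] ^ i)) + [:t0, 1:] ^ d * V"
    have "has_tp (\<lambda>s. u (upd y n (y $ n + l * s))) (d - 1) V"
      unfolding V_def using has_tp_scale[of "\<lambda>s. u (upd y n (y $ n + s))"] \<delta>1(2)[of y] y by simp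
    then have "has_tp (\<lambda>s. poly (\<Sum>i\<in>I. smult (e i) ([:t0, 1:] ^ i)) s +
        poly ([:t0, 1:] ^ d) s * u (upd y n (y $ n + l * s))) (d - 1) p"
      unfolding p_def by (intro has_tp_add has_tp_mult has_tp_poly)
    then have hp: "has_tp (\<lambda>s. (\<Sum>i\<in>I. e i * (t0 + s) ^ i) + (t0 + s) ^ d * u (upd y n (y $ n + l * s))) (d - 1) p"
      by (simp add: poly_sum)
    have "coeff (smult (e i) ([:t0, 1:] ^ i)) (d - 1) = 0" if "i \<in> I" for i
    proof -
      have "degree ([:t0, 1:] ^ i) < d - 1"
        using that I degree_power_le[of "[:t0, 1:]" i] by auto
      then show ?thesis
        by (simp add: coeff_eq_0)
    qed
    then have "(\<Sum>i\<in>I. coeff (smult (e i) ([:t0, 1:] ^ i)) (d - 1)) = 0"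
      by (intro sum.neutral) blast
    then have "coeff p (d - 1) = coeff ([:t0, 1:] ^ d * V) (d - 1)"
      unfolding p_def coeff_add coeff_sum by simp
    also have "[:t0, 1:] ^ d * V = V * [:t0, 1:] ^ d"
      by (rule mult.commute)
    also have "coeff (V * [:t0, 1:] ^ d) (d - 1) = (\<Sum>j\<le>d - 1. (T j y * l ^ j) * (of_nat (d choose (d - 1 - j)) * t0 ^ (d - (d - 1 - j))))"
      unfolding coeff_mult
    proof (rule sum.cong)
      fix j assume "j \<in> {..d - 1}"
      then have "coeff V j = T j y * l ^ j"
        by (simp add: V_def coeff_sum)
      moreover have "coeff ([:t0, 1:] ^ d) (d - 1 - j) = of_nat (d choose (d - 1 - j)) * 1 ^ (d - 1 - j) * t0 ^ (d - (d - 1 - j))"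
        by (rule coeff_linear_poly_power) simp
      ultimately show "coeff V j * coeff ([:t0, 1:] ^ d) (d - 1 - j) =
          (T j y * l ^ j) * (of_nat (d choose (d - 1 - j)) * t0 ^ (d - (d - 1 - j)))"
        by simp
    qed simp
    also have "\<dots> = (\<Sum>j\<le>d - 1. t0 * (of_nat (d choose Suc j) * (t0 * l) ^ j * T j y))"
    proof (rule sum.cong)
      fix j assume "j \<in> {..d - 1}"
      then have j: "d - (d - 1 - j) = Suc j" "Suc j \<le> d" "d - 1 - j = d - Suc j"
        using d by auto
      have "d choose (d - 1 - j) = d choose Suc j"
        unfolding j(3) using binomial_symmetric[OF j(2)] by simp
      then show "(T j y * l ^ j) * (of_nat (d choose (d - 1 - j)) * t0 ^ (d - (d - 1 - j))) =
          t0 * (of_nat (d choose Suc j) * (t0 * l) ^ j * T j y)"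
        unfolding j(1) power_mult_distrib by (simp add: mult_ac)
    qed simp
    finally have "coeff p (d - 1) = (\<Sum>j\<le>d - 1. t0 * (of_nat (d choose Suc j) * (t0 * l) ^ j * T j y))" .
    moreover have "{..d - 1} = {..<d}"
      using d by auto
    ultimately have "coeff p (d - 1) = t0 * \<Phi> (y, t0 * l)"
      by (simp only: \<Phi>_def sum_distrib_left fst_conv snd_conv)
    moreover have "\<Phi> (y, t0 * l) \<noteq> 0"
      using y tl \<delta>1(2) \<delta>2(2) by (intro PQ(3)) auto
    ultimately show "\<exists>p. has_tp (\<lambda>s. (\<Sum>i\<in>I. e i * (t0 + s) ^ i) + (t0 + s) ^ d * u (upd y n (y $ n + l * s))) (d - 1) p \<and>
        coeff p (d - 1) \<noteq> 0"
      using hp t0 by auto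
  qed
qed

text \<open>Replaces a change of dimension: the induction on the number of variables runs inside one type
  \<open>real ^ 'k\<close>, over the set \<open>S\<close> of coordinates on which a function depends.\<close>
definition depends_on :: "'k set \<Rightarrow> (real ^ 'k \<Rightarrow> 'b) \<Rightarrow> bool" where
  "depends_on S f \<longleftrightarrow> (\<forall>x y. (\<forall>i\<in>S. x $ i = y $ i) \<longrightarrow> f x = f y)"

lemma depends_onD: "depends_on S f \<Longrightarrow> (\<And>i. i \<in> S \<Longrightarrow> x $ i = y $ i) \<Longrightarrow> f x = f y"
  unfolding depends_on_def by blast

lemma depends_on_mono: "depends_on S f \<Longrightarrow> S \<subseteq> T \<Longrightarrow> depends_on T f"
  unfolding depends_on_def by blast

lemma depends_on_upd: "depends_on S f \<Longrightarrow> n \<notin> S \<Longrightarrow> f (upd x n t) = f x"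
  by (erule depends_onD) auto

text \<open>Freezes the coordinates outside \<open>S\<close> at those of \<open>a\<close>.
  Precomposition turns a germ into a function that depends on \<open>S\<close> everywhere, and keeps
  every germ identity whose other terms depend on \<open>S\<close> only.\<close>

definition proj :: "'k set \<Rightarrow> real ^ 'k \<Rightarrow> real ^ 'k \<Rightarrow> real ^ 'k" where
  "proj S a x = (\<chi> i. if i \<in> S then x $ i else a $ i)"

lemma proj_nth [simp]: "proj S a x $ i = (if i \<in> S then x $ i else a $ i)"
  by (simp add: proj_def)

lemma proj_self [simp]: "proj S a a = a"
  by (simp add: vec_eq_iff)

lemma depends_on_proj: "depends_on S f \<Longrightarrow> f (proj S a x) = f x"
  by (erule depends_onD) simp

lemma depends_on_comp_proj: "depends_on S (\<lambda>x. f (proj S a x))"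
  unfolding depends_on_def by (auto intro!: arg_cong[of _ _ f] simp: vec_eq_iff)

lemma ranalytic_proj: "ranalytic f a \<Longrightarrow> ranalytic (\<lambda>x. f (proj S a x)) a"
proof (rule ranalytic_compose)
  show "ranalytic (\<lambda>x. proj S a x $ i) a" for i
    by (cases "i \<in> S") auto
qed simp

lemma ranalytic_upd:
  assumes "ranalytic f (upd a n (t a))" "ranalytic t a"
  shows "ranalytic (\<lambda>x. f (upd x n (t x))) a"
proof (rule ranalytic_compose[of f "\<lambda>x. upd x n (t x)"])
  show "ranalytic f (upd a n (t a))"
    by (rule assms)
  show "ranalytic (\<lambda>x. upd x n (t x) $ i) a" for i
    using assms(2) by (cases "i = n") auto
qed

lemma eventually_proj:
  assumes "\<forall>\<^sub>F x in nhds a. P x" shows "\<forall>\<^sub>F x in nhds a. P (proj S a x)"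
proof (rule eventually_compose_filterlim[OF assms])
  have "((\<lambda>x. proj S a x) \<longlongrightarrow> proj S a a) (nhds a)"
  proof (rule vec_tendstoI)
    show "((\<lambda>x. proj S a x $ i) \<longlongrightarrow> proj S a a $ i) (nhds a)" for i
      by (cases "i \<in> S") (auto intro!: tendsto_intros simp: tendsto_nhds_iff)
  qed
  then show "((\<lambda>x. proj S a x) \<longlongrightarrow> a) (nhds a)"
    by simp
qed

text \<open>Each step divides \<open>u\<close> minus its restriction to the hyperplane
  \<open>x $ n = a $ n\<close>; that restriction is the next coefficient.\<close>

lemma taylor_division:
  assumes h: "ranalytic h a"
  shows "\<exists>c u. (\<forall>i. ranalytic (c i) a) \<and> (\<forall>i x t. c i (upd x n t) = c i x) \<and> ranalytic u a \<and>
    (\<forall>\<^sub>F x in nhds a. h x = (\<Sum>i<d. c i x * (x $ n - a $ n) ^ i) + (x $ n - a $ n) ^ d * u x)"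
proof (induction d)
    case 0
    show ?case
      by (rule exI[of _ "\<lambda>_ _. 0"], rule exI[of _ h]) (use h in simp)
  next
    case (Suc d)
    then obtain c u where c: "\<And>i. ranalytic (c i) a" "\<And>i x t. c i (upd x n t) = c i x" and u: "ranalytic u a"
      and eq: "\<forall>\<^sub>F x in nhds a. h x = (\<Sum>i<d. c i x * (x $ n - a $ n) ^ i) + (x $ n - a $ n) ^ d * u x"
      by blast
    define c0 where "c0 x = u (upd x n (a $ n))" for x
    have c0: "ranalytic c0 a"
      unfolding c0_def by (rule ranalytic_upd) (use u in auto)
    have "\<forall>\<^sub>F x in nhds a. u (upd x n (a $ n)) - c0 (upd x n (a $ n)) = 0"
      by (simp add: c0_def)
    from ranalytic_division[OF ranalytic_diff[OF u c0] this]
    obtain g where g: "ranalytic g a" "\<forall>\<^sub>F x in nhds a. u x - c0 x = (x $ n - a $ n) * g x" .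
    show ?case
    proof (intro exI conjI allI)
      show "ranalytic ((c(d := c0)) i) a" for i
        using c c0 by simp
      show "(c(d := c0)) i (upd x n t) = (c(d := c0)) i x" for i x t
        using c by (simp add: c0_def)
      show "ranalytic g a"
        by (rule g)
      show "\<forall>\<^sub>F x in nhds a. h x = (\<Sum>i<Suc d. (c(d := c0)) i x * (x $ n - a $ n) ^ i) + (x $ n - a $ n) ^ Suc d * g x"
        using eq g(2)
      proof eventually_elim
        case (elim x)
        have "(\<Sum>i<d. (c(d := c0)) i x * (x $ n - a $ n) ^ i) = (\<Sum>i<d. c i x * (x $ n - a $ n) ^ i)"
          by (rule sum.cong) auto
        moreover have ux: "u x = c0 x + (x $ n - a $ n) * g x"
          using elim(2) by simp
        ultimately show ?case
          unfolding elim(1) ux by (simp add: distrib_left mult_ac)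
      qed
    qed
qed

lemma taylor_division_depends_on:
  assumes h: "ranalytic h a" and dh: "depends_on (insert n S) h"
  obtains c u where "\<And>i. ranalytic (c i) a" "\<And>i. depends_on S (c i)" "ranalytic u a" "depends_on (insert n S) u"
    "\<forall>\<^sub>F x in nhds a. h x = (\<Sum>i<d. c i x * (x $ n - a $ n) ^ i) + (x $ n - a $ n) ^ d * u x"
proof -
  obtain c u where c: "\<And>i. ranalytic (c i) a" "\<And>i x t. c i (upd x n t) = c i x" and u: "ranalytic u a"
    and eq: "\<forall>\<^sub>F x in nhds a. h x = (\<Sum>i<d. c i x * (x $ n - a $ n) ^ i) + (x $ n - a $ n) ^ d * u x"
    using taylor_division[OF h, of n d] by blast
  show thesis
  proof (rule that)
    show "ranalytic (\<lambda>x. c i (proj (insert n S) a x)) a" for i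
      by (rule ranalytic_proj[OF c(1)])
    show "depends_on S (\<lambda>x. c i (proj (insert n S) a x))" for i
      unfolding depends_on_def
    proof (intro allI impI)
      fix x y :: "real ^ 'a" assume "\<forall>i\<in>S. x $ i = y $ i"
      then have "proj (insert n S) a x = upd (proj (insert n S) a y) n (x $ n)"
        by (auto simp: vec_eq_iff)
      then show "c i (proj (insert n S) a x) = c i (proj (insert n S) a y)"
        using c(2) by simp
    qed
    show "ranalytic (\<lambda>x. u (proj (insert n S) a x)) a"
      by (rule ranalytic_proj[OF u])
    show "depends_on (insert n S) (\<lambda>x. u (proj (insert n S) a x))"
      by (rule depends_on_comp_proj)
    show "\<forall>\<^sub>F x in nhds a. h x = (\<Sum>i<d. c i (proj (insert n S) a x) * (x $ n - a $ n) ^ i) +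
        (x $ n - a $ n) ^ d * u (proj (insert n S) a x)"
      using eventually_proj[OF eq, of "insert n S"] by (simp add: depends_on_proj[OF dh])
  qed
qed

section \<open>Normal crossings and hereditary covers\<close>

lemma ranalytic_zero_prod_all:
  assumes "finite I" "\<And>i. i \<in> I \<Longrightarrow> ranalytic (f i) a" "\<And>i. i \<in> I \<Longrightarrow> \<not> (\<forall>\<^sub>F x in nhds a. f i x = 0)"
  shows "\<not> (\<forall>\<^sub>F x in nhds a. (\<Prod>i\<in>I. f i x) = 0)"
  using assms
proof (induction I rule: finite_induct)
  case empty
  have "(nhds a :: (real ^ 'b) filter) \<noteq> bot"
    by simp
  then show ?case
    by simp
next
  case (insert j I)
  have "\<not> (\<forall>\<^sub>F x in nhds a. f j x * (\<Prod>i\<in>I. f i x) = 0)"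
    using ranalytic_zero_prod[of "f j" a "\<lambda>x. \<Prod>i\<in>I. f i x"] insert by blast
  then show ?case
    using insert.hyps by simp
qed

lemma ranalytic_cancel:
  assumes "ranalytic f a" "ranalytic g a" "ranalytic m a" "\<not> (\<forall>\<^sub>F x in nhds a. m x = 0)"
    and "\<forall>\<^sub>F x in nhds a. m x * f x = m x * g x"
  shows "\<forall>\<^sub>F x in nhds a. f x = g x"
proof -
  have "\<forall>\<^sub>F x in nhds a. m x * (f x - g x) = 0"
    using assms(5) by eventually_elim (simp add: algebra_simps)
  then have "\<forall>\<^sub>F x in nhds a. f x - g x = 0"
    using ranalytic_zero_prod[OF assms(3) ranalytic_diff[OF assms(1,2)]] assms(4) by blast
  then show ?thesis
    by simp
qed

text \<open>Test points approaching \<open>c\<close> inside a coordinate subspace: monomials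
  centered at \<open>c\<close> vanish there as soon as they involve a coordinate of
  \<open>Z\<close>, and otherwise do not.\<close>

definition pt :: "real ^ 'k \<Rightarrow> 'k set \<Rightarrow> real \<Rightarrow> real ^ 'k" where
  "pt c Z s = (\<chi> i. if i \<in> Z then c $ i else c $ i + s)"

lemma pt_nth [simp]: "pt c Z s $ i = (if i \<in> Z then c $ i else c $ i + s)"
  by (simp add: pt_def)

lemma eventually_pt:
  assumes "\<forall>\<^sub>F x in nhds c. P x" shows "\<forall>\<^sub>F s in at 0. P (pt c Z s) \<and> s \<noteq> 0"
proof -
  have "((\<lambda>s. pt c Z s) \<longlongrightarrow> c) (at 0)"
  proof (rule vec_tendstoI)
    show "((\<lambda>s. pt c Z s $ i) \<longlongrightarrow> c $ i) (at 0)" for i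
      by (cases "i \<in> Z") (auto intro!: tendsto_eq_intros)
  qed
  then have "\<forall>\<^sub>F s in at 0. P (pt c Z s)"
    by (rule eventually_compose_filterlim[OF assms])
  moreover have "\<forall>\<^sub>F s::real in at 0. s \<noteq> 0"
    by (simp add: eventually_at_filter)
  ultimately show ?thesis
    by (rule eventually_conj)
qed

lemma obtain_pt:
  assumes "\<forall>\<^sub>F x in nhds c. P x"
  obtains s where "s \<noteq> 0" "P (pt c Z s)"
  using eventually_happens[OF eventually_pt[OF assms, of Z]] by (auto simp: trivial_limit_at)

section \<open>Monomials and normal crossings\<close>

definition mon :: "real ^ 'k \<Rightarrow> ('k \<Rightarrow> nat) \<Rightarrow> real ^ 'k \<Rightarrow> real" where
  "mon b \<alpha> x = (\<Prod>i\<in>UNIV. (x $ i - b $ i) ^ \<alpha> i)"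

lemma ranalytic_mon [intro, simp]: "ranalytic (mon b \<alpha>) a"
  unfolding mon_def[abs_def] by (intro ranalytic_prod ranalytic_power ranalytic_diff ranalytic_coord ranalytic_const)

lemma mon_add: "mon b (\<lambda>i. \<alpha> i + \<beta> i) x = mon b \<alpha> x * mon b \<beta> x"
  by (simp add: mon_def power_add prod.distrib)

lemma mon_0 [simp]: "mon b (\<lambda>i. 0) x = 1"
  by (simp add: mon_def)

lemma mon_power: "mon b \<alpha> x ^ n = mon b (\<lambda>i. \<alpha> i * n) x"
  by (simp add: mon_def power_mult prod_power_distrib)

lemma mon_single: "mon b (\<lambda>i. if i = k then n else 0) x = (x $ k - b $ k) ^ n"
proof -
  have "mon b (\<lambda>i. if i = k then n else 0) x = (\<Prod>i\<in>UNIV. if i = k then (x $ k - b $ k) ^ n else 1)"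
    unfolding mon_def by (rule prod.cong) auto
  then show ?thesis
    by simp
qed

lemma mon_split: "\<alpha> i \<ge> n \<Longrightarrow> mon b \<alpha> x = (x $ i - b $ i) ^ n * mon b (\<alpha>(i := \<alpha> i - n)) x"
proof -
  assume n: "\<alpha> i \<ge> n"
  have "\<alpha> = (\<lambda>j. (if j = i then n else 0) + (\<alpha>(i := \<alpha> i - n)) j)"
    using n by (auto simp: fun_eq_iff)
  then have "mon b \<alpha> x = mon b (\<lambda>j. (if j = i then n else 0) + (\<alpha>(i := \<alpha> i - n)) j) x"
    by (rule arg_cong)
  then show ?thesis
    by (simp only: mon_add mon_single)
qed

lemma mon_eq_0_iff: "mon b \<alpha> x = 0 \<longleftrightarrow> (\<exists>i. \<alpha> i > 0 \<and> x $ i = b $ i)"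
  by (auto simp: mon_def)

lemma mon_pt_nonzero: "s \<noteq> 0 \<Longrightarrow> (\<And>i. i \<in> Z \<Longrightarrow> \<alpha> i = 0) \<Longrightarrow> mon c \<alpha> (pt c Z s) \<noteq> 0"
  by (auto simp: mon_eq_0_iff split: if_splits)

lemma mon_nonzero_germ: "\<not> (\<forall>\<^sub>F x in nhds c. mon c \<alpha> x = 0)"
proof
  assume "\<forall>\<^sub>F x in nhds c. mon c \<alpha> x = 0"
  then obtain s where "s \<noteq> 0" "mon c \<alpha> (pt c {} s) = 0"
    by (rule obtain_pt)
  then show False
    using mon_pt_nonzero[of s "{}" \<alpha> c] by simp
qed

text \<open>Normal crossings near \<open>c\<close>; the center \<open>b\<close> of the monomial need not be \<open>c\<close>, and factors with
  \<open>b $ i \<noteq> c $ i\<close> are units at \<open>c\<close>.\<close>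
definition normal_crossing :: "(real ^ 'k \<Rightarrow> real) \<Rightarrow> real ^ 'k \<Rightarrow> bool" where
  "normal_crossing f c \<longleftrightarrow> (\<exists>b \<alpha> u. ranalytic u c \<and> u c \<noteq> 0 \<and> (\<forall>\<^sub>F x in nhds c. f x = mon b \<alpha> x * u x))"

lemma normal_crossingI: "ranalytic u c \<Longrightarrow> u c \<noteq> 0 \<Longrightarrow> \<forall>\<^sub>F x in nhds c. f x = mon b \<alpha> x * u x \<Longrightarrow> normal_crossing f c"
  unfolding normal_crossing_def by blast

lemma normal_crossing_centered:
  assumes "normal_crossing f c"
  obtains \<alpha> u where "ranalytic u c" "u c \<noteq> 0" "\<forall>\<^sub>F x in nhds c. f x = mon c \<alpha> x * u x"
proof -
  obtain b \<beta> u where u: "ranalytic u c" "u c \<noteq> 0" and f: "\<forall>\<^sub>F x in nhds c. f x = mon b \<beta> x * u x"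
    using assms unfolding normal_crossing_def by blast
  define \<alpha> where "\<alpha> i = (if b $ i = c $ i then \<beta> i else 0)" for i
  define \<gamma> where "\<gamma> i = (if b $ i = c $ i then 0 else \<beta> i)" for i
  have "\<beta> = (\<lambda>i. \<alpha> i + \<gamma> i)"
    by (auto simp: \<alpha>_def \<gamma>_def)
  then have "mon b \<beta> x = mon b \<alpha> x * mon b \<gamma> x" for x
    by (metis mon_add)
  moreover have "mon b \<alpha> x = mon c \<alpha> x" for x
    unfolding mon_def by (rule prod.cong) (auto simp: \<alpha>_def)
  ultimately have "\<forall>\<^sub>F x in nhds c. f x = mon c \<alpha> x * (mon b \<gamma> x * u x)"
    using f by (simp add: mult.assoc)
  moreover have "ranalytic (\<lambda>x. mon b \<gamma> x * u x) c"
    using u by (intro ranalytic_mult ranalytic_mon)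
  moreover have "mon b \<gamma> c * u c \<noteq> 0"
    using u by (auto simp: mon_eq_0_iff \<gamma>_def split: if_splits)
  ultimately show thesis
    using that by blast
qed

lemma normal_crossing_cong:
  assumes "normal_crossing f c" "\<forall>\<^sub>F x in nhds c. g x = f x"
  shows "normal_crossing g c"
proof -
  obtain b \<alpha> u where u: "ranalytic u c" "u c \<noteq> 0" and f: "\<forall>\<^sub>F x in nhds c. f x = mon b \<alpha> x * u x"
    using assms(1) unfolding normal_crossing_def by blast
  from assms(2) f have "\<forall>\<^sub>F x in nhds c. g x = mon b \<alpha> x * u x"
    by eventually_elim simp
  then show ?thesis
    by (rule normal_crossingI[OF u])
qed

lemma normal_crossing_unit:
  assumes "ranalytic u c" "u c \<noteq> 0" shows "normal_crossing u c"
  by (rule normal_crossingI[OF assms, of _ c "\<lambda>_. 0"]) simp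

lemma normal_crossing_mult_unit:
  assumes "normal_crossing f c" "ranalytic v c" "v c \<noteq> 0"
  shows "normal_crossing (\<lambda>x. f x * v x) c"
proof -
  obtain b \<beta> u where u: "ranalytic u c" "u c \<noteq> 0" and f: "\<forall>\<^sub>F x in nhds c. f x = mon b \<beta> x * u x"
    using assms unfolding normal_crossing_def by blast
  show ?thesis
    by (rule normal_crossingI[of "\<lambda>x. u x * v x" c _ b \<beta>]) (use u assms f in \<open>auto elim: eventually_mono\<close>)
qed

text \<open>Induction on the degree of the monomial. If a coordinate divides \<open>f * g\<close>,
  the product of the restrictions to the hyperplane is zero, so one of the two restrictions is zero
  and that factor can be divided. As a consequence several germs can be brought to normal crossings
  together through their product.\<close>

lemma normal_crossing_factor_aux:
  assumes "ranalytic f c" "ranalytic g c" "ranalytic u c" "u c \<noteq> 0"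
    "\<forall>\<^sub>F x in nhds c. f x * g x = mon c \<alpha> x * u x" "sum \<alpha> UNIV = n"
  shows "\<exists>\<beta> v. ranalytic v c \<and> v c \<noteq> 0 \<and> (\<forall>\<^sub>F x in nhds c. f x = mon c \<beta> x * v x)"
  using assms
proof (induction n arbitrary: f g \<alpha>)
  case 0
  then have "\<alpha> = (\<lambda>i. 0)"
    by (auto simp: fun_eq_iff)
  then have "f c * g c = u c"
    using eventually_nhds_x_imp_x[OF 0(5)] by simp
  then have "f c \<noteq> 0"
    using 0(4) by auto
  then show ?case
    using 0(1) by (intro exI[of _ "\<lambda>i. 0"] exI[of _ f]) simp
next
  case (Suc n)
  have "\<exists>i. \<alpha> i > 0"
  proof (rule ccontr)
    assume "\<not> ?thesis"
    then show False
      using Suc.prems(6) by simp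
  qed
  then obtain i where i: "\<alpha> i \<ge> 1"
    by (auto simp: Suc_le_eq)
  define \<alpha>' where "\<alpha>' = \<alpha>(i := \<alpha> i - 1)"
  have mon: "mon c \<alpha> x = (x $ i - c $ i) * mon c \<alpha>' x" for x
    using mon_split[of 1 \<alpha> i c x] i by (simp add: \<alpha>'_def)
  have "sum \<alpha>' UNIV + 1 = sum \<alpha> UNIV"
    using i unfolding \<alpha>'_def by (simp add: sum.remove[of UNIV i])
  then have sum: "sum \<alpha>' UNIV = n"
    using Suc.prems(6) by simp
  have zero: "\<forall>\<^sub>F x in nhds c. f (upd x i (c $ i)) * g (upd x i (c $ i)) = 0"
    using eventually_upd[OF Suc.prems(5), of i] by (simp add: mon)
  have an: "ranalytic (\<lambda>x. h (upd x i (c $ i))) c" if "ranalytic h c" for h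
    by (rule ranalytic_upd) (use that in auto)
  have m1: "\<not> (\<forall>\<^sub>F x in nhds c. x $ i - c $ i = 0)"
    using mon_nonzero_germ[of c "\<lambda>j. if j = i then 1 else 0"] by (simp add: mon_single)
  consider "\<forall>\<^sub>F x in nhds c. f (upd x i (c $ i)) = 0" | "\<forall>\<^sub>F x in nhds c. g (upd x i (c $ i)) = 0"
    using ranalytic_zero_prod[OF an[OF Suc.prems(1)] an[OF Suc.prems(2)] zero] by blast
  then show ?case
  proof cases
    case 1
    from ranalytic_division[OF Suc.prems(1) this]
    obtain f' where f': "ranalytic f' c" "\<forall>\<^sub>F x in nhds c. f x = (x $ i - c $ i) * f' x" .
    have "\<forall>\<^sub>F x in nhds c. f' x * g x = mon c \<alpha>' x * u x"
    proof (rule ranalytic_cancel[OF ranalytic_mult[OF f'(1) Suc.prems(2)] ranalytic_mult[OF ranalytic_mon Suc.prems(3)] _ m1])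
      show "ranalytic (\<lambda>x. x $ i - c $ i) c"
        by (intro ranalytic_diff ranalytic_coord ranalytic_const)
      show "\<forall>\<^sub>F x in nhds c. (x $ i - c $ i) * (f' x * g x) = (x $ i - c $ i) * (mon c \<alpha>' x * u x)"
        using f'(2) Suc.prems(5) by eventually_elim (simp add: mon mult.assoc)
    qed
    from Suc.IH[OF f'(1) Suc.prems(2-4) this sum] obtain \<beta> v where
      v: "ranalytic v c" "v c \<noteq> 0" "\<forall>\<^sub>F x in nhds c. f' x = mon c \<beta> x * v x"
      by blast
    have "\<forall>\<^sub>F x in nhds c. f x = mon c (\<lambda>j. (if j = i then 1 else 0) + \<beta> j) x * v x"
      using f'(2) v(3) by eventually_elim (simp add: mon_add mon_single)
    then show ?thesis
      using v by blast
  next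
    case 2
    from ranalytic_division[OF Suc.prems(2) this]
    obtain g' where g': "ranalytic g' c" "\<forall>\<^sub>F x in nhds c. g x = (x $ i - c $ i) * g' x" .
    have "\<forall>\<^sub>F x in nhds c. f x * g' x = mon c \<alpha>' x * u x"
    proof (rule ranalytic_cancel[OF ranalytic_mult[OF Suc.prems(1) g'(1)] ranalytic_mult[OF ranalytic_mon Suc.prems(3)] _ m1])
      show "ranalytic (\<lambda>x. x $ i - c $ i) c"
        by (intro ranalytic_diff ranalytic_coord ranalytic_const)
      show "\<forall>\<^sub>F x in nhds c. (x $ i - c $ i) * (f x * g' x) = (x $ i - c $ i) * (mon c \<alpha>' x * u x)"
        using g'(2) Suc.prems(5) by eventually_elim (simp add: mon mult_ac)
    qed
    from Suc.IH[OF Suc.prems(1) g'(1) Suc.prems(3,4) this sum] show ?thesis .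
  qed
qed

lemma normal_crossing_factor:
  assumes "ranalytic f c" "ranalytic g c" "normal_crossing (\<lambda>x. f x * g x) c"
  shows "normal_crossing f c"
proof -
  obtain \<alpha> u where "ranalytic u c" "u c \<noteq> 0" "\<forall>\<^sub>F x in nhds c. f x * g x = mon c \<alpha> x * u x"
    using normal_crossing_centered[OF assms(3)] by blast
  from normal_crossing_factor_aux[OF assms(1,2) this refl] show ?thesis
    unfolding normal_crossing_def by blast
qed

lemma normal_crossing_prod_factor:
  assumes "finite J" "j \<in> J" "\<And>i. i \<in> J \<Longrightarrow> ranalytic (f i) c" "normal_crossing (\<lambda>x. \<Prod>i\<in>J. f i x) c"
  shows "normal_crossing (f j) c"
proof (rule normal_crossing_factor)
  show "ranalytic (\<lambda>x. \<Prod>i\<in>J - {j}. f i x) c"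
    using assms by (intro ranalytic_prod) auto
  show "normal_crossing (\<lambda>x. f j x * (\<Prod>i\<in>J - {j}. f i x)) c"
  proof -
    have "(\<lambda>x. f j x * (\<Prod>i\<in>J - {j}. f i x)) = (\<lambda>x. \<Prod>i\<in>J. f i x)"
      by (simp add: prod.remove[OF assms(1,2)])
    then show ?thesis
      using assms(4) by simp
  qed
qed (use assms in auto)

text \<open>A positive exponent at some \<open>i\<close> outside \<open>S\<close> would make
  \<open>f\<close> vanish where \<open>x $ i = c $ i\<close>, and hence everywhere near
  \<open>c\<close>, since \<open>f\<close> does not see that coordinate. The unit can then be
  composed with \<open>proj\<close>.\<close>

lemma normal_crossing_depends_on:
  assumes "normal_crossing f c" "depends_on S f"
  obtains \<alpha> u where "\<And>i. i \<notin> S \<Longrightarrow> \<alpha> i = 0" "ranalytic u c" "depends_on S u" "u c \<noteq> 0"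
    "\<forall>\<^sub>F x in nhds c. f x = mon c \<alpha> x * u x"
proof -
  obtain \<alpha> u where u: "ranalytic u c" "u c \<noteq> 0" and f: "\<forall>\<^sub>F x in nhds c. f x = mon c \<alpha> x * u x"
    using normal_crossing_centered[OF assms(1)] by blast
  have u_ev: "\<forall>\<^sub>F x in nhds c. u x \<noteq> 0"
    using u tendsto_imp_eventually_ne[OF ranalytic_tendsto] by blast
  have \<alpha>: "\<alpha> i = 0" if i: "i \<notin> S" for i
  proof (rule ccontr)
    assume "\<alpha> i \<noteq> 0"
    have "\<forall>\<^sub>F x in nhds c. f (upd x i (c $ i)) = mon c \<alpha> (upd x i (c $ i)) * u (upd x i (c $ i))"
      by (rule eventually_upd[OF f])
    then have "\<forall>\<^sub>F x in nhds c. mon c \<alpha> x = 0"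
      using f u_ev
    proof eventually_elim
      case (elim x)
      have "mon c \<alpha> (upd x i (c $ i)) = 0"
        using \<open>\<alpha> i \<noteq> 0\<close> by (auto simp: mon_eq_0_iff)
      then have "f x = 0"
        using elim(1) depends_on_upd[OF assms(2) i] by simp
      then show ?case
        using elim by simp
    qed
    then show False
      using mon_nonzero_germ by blast
  qed
  have "mon c \<alpha> (proj S c x) = mon c \<alpha> x" for x
    unfolding mon_def by (rule prod.cong) (auto simp: \<alpha>)
  then have "\<forall>\<^sub>F x in nhds c. f x = mon c \<alpha> x * u (proj S c x)"
    using eventually_proj[OF f, of S] by (simp add: depends_on_proj[OF assms(2)])
  moreover have "ranalytic (\<lambda>x. u (proj S c x)) c"
    by (rule ranalytic_proj[OF u(1)])
  ultimately show thesis
    using that[of \<alpha> "\<lambda>x. u (proj S c x)"] \<alpha> u depends_on_comp_proj by auto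
qed

text \<open>If both \<open>A \<le> B\<close> and \<open>B \<le> A\<close> fail, cancel the common monomial: the remaining
  difference vanishes at \<open>c\<close>, hence on a coordinate hyperplane, where one of its two terms vanishes
  and the other does not.\<close>
lemma normal_crossing_comparable:
  assumes v: "ranalytic v c" "v c \<noteq> 0" and w: "ranalytic w c" "w c \<noteq> 0"
    and k0: "(\<forall>\<^sub>F x in nhds c. mon c A x * v x - mon c B x * w x = 0) \<or>
      normal_crossing (\<lambda>x. mon c A x * v x - mon c B x * w x) c"
  shows "(\<forall>i. A i \<le> B i) \<or> (\<forall>i. B i \<le> A i)"
proof (rule ccontr)
  assume "\<not> ?thesis"
  then obtain p q where p: "A p > B p" and q: "B q > A q"
    by (auto simp: not_le)
  define \<delta> where "\<delta> i = min (A i) (B i)" for i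
  define A' where "A' i = A i - \<delta> i" for i
  define B' where "B' i = B i - \<delta> i" for i
  have "A = (\<lambda>i. \<delta> i + A' i)" "B = (\<lambda>i. \<delta> i + B' i)"
    by (auto simp: A'_def B'_def \<delta>_def)
  then have mon: "mon c A x = mon c \<delta> x * mon c A' x" "mon c B x = mon c \<delta> x * mon c B' x" for x
    by (metis mon_add)+
  have p': "A' p > 0" "B' p = 0" and q': "B' q > 0" "A' q = 0"
    using p q by (auto simp: A'_def B'_def \<delta>_def)
  define k where "k x = mon c A' x * v x - mon c B' x * w x" for x
  have k: "ranalytic k c"
    unfolding k_def using v w by (intro ranalytic_diff ranalytic_mult ranalytic_mon)
  have k0k: "mon c A x * v x - mon c B x * w x = k x * mon c \<delta> x" for x
    by (simp add: k_def mon algebra_simps)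
  have "mon c A' c = 0" "mon c B' c = 0"
    using p' q' by (auto simp: mon_eq_0_iff)
  then have kc: "k c = 0"
    by (simp add: k_def)
  have "\<exists>i. \<forall>\<^sub>F x in nhds c. x $ i = c $ i \<longrightarrow> k x = 0"
    using k0
  proof
    assume "\<forall>\<^sub>F x in nhds c. mon c A x * v x - mon c B x * w x = 0"
    then have "\<forall>\<^sub>F x in nhds c. k x * mon c \<delta> x = 0"
      by (simp add: k0k)
    then have "\<forall>\<^sub>F x in nhds c. k x = 0"
      using ranalytic_zero_prod[OF k ranalytic_mon] mon_nonzero_germ by blast
    then show ?thesis
      by (auto elim: eventually_mono)
  next
    assume "normal_crossing (\<lambda>x. mon c A x * v x - mon c B x * w x) c"
    then have "normal_crossing (\<lambda>x. k x * mon c \<delta> x) c"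
      by (simp add: k0k)
    then have "normal_crossing k c"
      by (rule normal_crossing_factor[OF k ranalytic_mon])
    then obtain \<Gamma> z where z: "z c \<noteq> 0" "\<forall>\<^sub>F x in nhds c. k x = mon c \<Gamma> x * z x"
      using normal_crossing_centered by blast
    then have "mon c \<Gamma> c = 0"
      using eventually_nhds_x_imp_x[OF z(2)] kc by simp
    then obtain i where i: "\<Gamma> i > 0"
      by (auto simp: mon_eq_0_iff)
    then have "\<forall>\<^sub>F x in nhds c. x $ i = c $ i \<longrightarrow> k x = 0"
      using z(2) by (auto simp: mon_eq_0_iff elim!: eventually_mono)
    then show ?thesis ..
  qed
  then obtain i where i: "\<forall>\<^sub>F x in nhds c. x $ i = c $ i \<longrightarrow> k x = 0"
    by blast
  have vw: "\<forall>\<^sub>F x in nhds c. v x \<noteq> 0" "\<forall>\<^sub>F x in nhds c. w x \<noteq> 0"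
    using v w tendsto_imp_eventually_ne[OF ranalytic_tendsto] by blast+
  have ev: "\<forall>\<^sub>F x in nhds c. (x $ i = c $ i \<longrightarrow> k x = 0) \<and> v x \<noteq> 0 \<and> w x \<noteq> 0"
    using i vw by (intro eventually_conj)
  have "A' i = 0 \<or> B' i = 0"
    by (auto simp: A'_def B'_def \<delta>_def)
  then show False
  proof
    assume "B' i = 0"
    \<comment> \<open>With the coordinates \<open>i\<close> and \<open>p\<close> frozen, the first
      term vanishes because of \<open>p\<close>, and the second does not since
      \<open>B' i = B' p = 0\<close>.\<close>
    from ev obtain s where s: "s \<noteq> 0" "pt c {i, p} s $ i = c $ i \<longrightarrow> k (pt c {i, p} s) = 0"
        "w (pt c {i, p} s) \<noteq> 0"
      by (rule obtain_pt[where Z = "{i, p}"]) auto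
    have "mon c A' (pt c {i, p} s) = 0"
      using p' by (auto simp: mon_eq_0_iff)
    moreover have "mon c B' (pt c {i, p} s) \<noteq> 0"
      using s(1) p' \<open>B' i = 0\<close> by (intro mon_pt_nonzero) auto
    ultimately show False
      using s(2,3) by (simp add: k_def)
  next
    assume "A' i = 0"
    from ev obtain s where s: "s \<noteq> 0" "pt c {i, q} s $ i = c $ i \<longrightarrow> k (pt c {i, q} s) = 0"
        "v (pt c {i, q} s) \<noteq> 0"
      by (rule obtain_pt[where Z = "{i, q}"]) auto
    have "mon c B' (pt c {i, q} s) = 0"
      using q' by (auto simp: mon_eq_0_iff)
    moreover have "mon c A' (pt c {i, q} s) \<noteq> 0"
      using s(1) q' \<open>A' i = 0\<close> by (intro mon_pt_nonzero) auto
    ultimately show False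
      using s(2,3) by (simp add: k_def)
  qed
qed

text \<open>Coordinates outside \<open>S\<close> are left alone, so that substitutions supplied by
  the induction hypothesis for functions of \<open>S\<close> may be applied to functions of more
  variables, whose lines in an outside direction stay lines.\<close>

definition amap :: "'k set \<Rightarrow> (real ^ 'k \<Rightarrow> real ^ 'k) \<Rightarrow> real ^ 'k \<Rightarrow> bool" where
  "amap S \<pi> b \<longleftrightarrow> (\<forall>i\<in>S. depends_on S (\<lambda>x. \<pi> x $ i)) \<and> (\<forall>i. i \<notin> S \<longrightarrow> (\<forall>x. \<pi> x $ i = x $ i)) \<and>
    (\<forall>i. ranalytic (\<lambda>x. \<pi> x $ i) b)"

lemma amap_id: "amap S id b"
  by (auto simp: amap_def depends_on_def)

lemma amap_agree: "amap S \<pi> b \<Longrightarrow> (\<And>i. i \<in> S \<Longrightarrow> x $ i = y $ i) \<Longrightarrow> i \<in> S \<Longrightarrow> \<pi> x $ i = \<pi> y $ i"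
  unfolding amap_def by (metis depends_onD)

lemma amap_outside: "amap S \<pi> b \<Longrightarrow> i \<notin> S \<Longrightarrow> \<pi> x $ i = x $ i"
  unfolding amap_def by blast

lemma amap_ranalytic: "amap S \<pi> b \<Longrightarrow> ranalytic f (\<pi> b) \<Longrightarrow> ranalytic (\<lambda>x. f (\<pi> x)) b"
  unfolding amap_def using ranalytic_compose[of f \<pi> b] by blast

lemma amap_mono:
  assumes "amap S \<pi> b" "S \<subseteq> T" shows "amap T \<pi> b"
  unfolding amap_def
proof (intro conjI ballI allI impI)
  show "depends_on T (\<lambda>x. \<pi> x $ i)" if "i \<in> T" for i
  proof (cases "i \<in> S")
    case True
    then show ?thesis
      using assms depends_on_mono[of S "\<lambda>x. \<pi> x $ i" T] unfolding amap_def by blast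
  next
    case False
    then show ?thesis
      using that amap_outside[OF assms(1)] by (auto simp: depends_on_def)
  qed
qed (use assms in \<open>auto simp: amap_def\<close>)

lemma amap_comp:
  assumes \<psi>: "amap S \<psi> (\<pi> b)" and \<pi>: "amap S \<pi> b"
  shows "amap S (\<psi> \<circ> \<pi>) b"
  unfolding amap_def
proof (intro conjI ballI allI impI)
  show "depends_on S (\<lambda>x. (\<psi> \<circ> \<pi>) x $ i)" if "i \<in> S" for i
    unfolding depends_on_def
  proof (intro allI impI)
    fix x y :: "real ^ 'a" assume xy: "\<forall>i\<in>S. x $ i = y $ i"
    have "\<pi> x $ j = \<pi> y $ j" if "j \<in> S" for j
      by (rule amap_agree[OF \<pi> _ that]) (use xy in blast)
    then have "\<psi> (\<pi> x) $ i = \<psi> (\<pi> y) $ i"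
      by (rule amap_agree[OF \<psi> _ that])
    then show "(\<psi> \<circ> \<pi>) x $ i = (\<psi> \<circ> \<pi>) y $ i"
      by simp
  qed
  show "(\<psi> \<circ> \<pi>) x $ i = x $ i" if "i \<notin> S" for i x
    using amap_outside[OF \<psi> that] amap_outside[OF \<pi> that] by simp
  show "ranalytic (\<lambda>x. (\<psi> \<circ> \<pi>) x $ i) b" for i
  proof -
    have "ranalytic (\<lambda>y. \<psi> y $ i) (\<pi> b)"
      using \<psi> unfolding amap_def by blast
    from amap_ranalytic[OF \<pi> this] show ?thesis
      by simp
  qed
qed

lemma amap_depends_on: "amap S \<pi> b \<Longrightarrow> depends_on S f \<Longrightarrow> depends_on S (\<lambda>x. f (\<pi> x))"
  unfolding depends_on_def using amap_agree[of S \<pi> b] by blast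

lemma amap_eventually:
  assumes "amap S \<pi> b" shows "\<forall>\<^sub>F x in nhds b. amap S \<pi> x"
proof -
  have "\<forall>\<^sub>F x in nhds b. ranalytic (\<lambda>x. \<pi> x $ i) x" for i
    using assms ranalytic_eventually[of "\<lambda>x. \<pi> x $ i" b] unfolding amap_def by blast
  then have "\<forall>\<^sub>F x in nhds b. \<forall>i. ranalytic (\<lambda>x. \<pi> x $ i) x"
    by (simp add: eventually_all_finite)
  then show ?thesis
    by (rule eventually_mono) (use assms in \<open>auto simp: amap_def\<close>)
qed

lemma amap_tendsto:
  assumes "amap S \<pi> b" shows "(\<pi> \<longlongrightarrow> \<pi> b) (nhds b)"
proof (rule vec_tendstoI)
  fix i
  have "ranalytic (\<lambda>x. \<pi> x $ i) b"
    using assms unfolding amap_def by blast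
  then show "((\<lambda>x. \<pi> x $ i) \<longlongrightarrow> \<pi> b $ i) (nhds b)"
    by (rule ranalytic_tendsto)
qed

lemma amap_eventually_comp:
  "amap S \<pi> b \<Longrightarrow> \<forall>\<^sub>F x in nhds (\<pi> b). P x \<Longrightarrow> \<forall>\<^sub>F x in nhds b. P (\<pi> x)"
  by (rule eventually_compose_filterlim[OF _ amap_tendsto])

lemma normal_crossing_comp_cong:
  assumes "amap S \<psi> b" "\<forall>\<^sub>F x in nhds (\<psi> b). f x = g x" "normal_crossing (\<lambda>x. g (\<psi> x)) b"
  shows "normal_crossing (\<lambda>x. f (\<psi> x)) b"
  by (rule normal_crossing_cong[OF assms(3) amap_eventually_comp[OF assms(1,2)]])

text \<open>Property \<open>Q\<close> is reached after finitely many substitutions: at each step a neighborhood of the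
  current point is covered by the images of finitely many compact sets under analytic maps, and one
  continues at every point of these compact sets.\<close>
inductive unif :: "'k set \<Rightarrow> ((real ^ 'k \<Rightarrow> real ^ 'k) \<Rightarrow> real ^ 'k \<Rightarrow> bool) \<Rightarrow>
    (real ^ 'k \<Rightarrow> real ^ 'k) \<Rightarrow> real ^ 'k \<Rightarrow> bool" for S Q where
  unif_base: "Q \<psi> a \<Longrightarrow> unif S Q \<psi> a"
| unif_step: "finite P \<Longrightarrow> (\<And>\<pi> K. (\<pi>, K) \<in> P \<Longrightarrow> compact K) \<Longrightarrow>
    (\<And>\<pi> K c. (\<pi>, K) \<in> P \<Longrightarrow> c \<in> K \<Longrightarrow> amap S \<pi> c \<and> unif S Q (\<psi> \<circ> \<pi>) c) \<Longrightarrow>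
    \<forall>\<^sub>F x in nhds a. \<exists>(\<pi>, K)\<in>P. x \<in> \<pi> ` K \<Longrightarrow> unif S Q \<psi> a"

text \<open>Continues the process at its leaves: wherever \<open>Q\<close> has been reached, further
  substitutions, possibly involving more coordinates, may lead to \<open>Q'\<close>. The set
  \<open>N\<close> carries conditions valid only near the image of the starting point.\<close>

lemma unif_transfer:
  assumes "unif S Q \<psi> a" "amap S \<psi> a" "\<psi> a \<in> N" "open N" "S \<subseteq> T"
    and Q: "\<And>\<psi> b. amap S \<psi> b \<Longrightarrow> \<psi> b \<in> N \<Longrightarrow> Q \<psi> b \<Longrightarrow> unif T Q' \<psi> b"
  shows "unif T Q' \<psi> a"
  using assms(1-3)
proof (induction rule: unif.induct)
  case (unif_base \<psi> a)
  then show ?case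
    using Q by blast
next
  case (unif_step P \<psi> a)
  have "\<forall>\<^sub>F x in nhds a. amap S \<psi> x"
    by (rule amap_eventually) fact
  moreover have "\<forall>\<^sub>F x in nhds a. \<psi> x \<in> N"
    by (rule topological_tendstoD[OF amap_tendsto[OF unif_step.prems(1)] assms(4) unif_step.prems(2)])
  ultimately have "\<forall>\<^sub>F x in nhds a. amap S \<psi> x \<and> \<psi> x \<in> N"
    by (rule eventually_conj)
  then obtain \<delta> where \<delta>: "\<delta> > 0" "\<And>x. dist x a < \<delta> \<Longrightarrow> amap S \<psi> x \<and> \<psi> x \<in> N"
    unfolding eventually_nhds_metric by blast
  define r where "r = \<delta> / 2"
  \<comment> \<open>The pieces are cut down to the part that lands in a small closed ball. There the
    composite remains in \<open>N\<close> and is analytic, the pieces stay compact, and they still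
    cover a smaller neighborhood.\<close>
  define P' where "P' = (\<lambda>(\<pi>, K). (\<pi>, K \<inter> \<pi> -` cball a r)) ` P"
  show ?case
  proof (rule unif.unif_step[of P'])
    show "finite P'"
      using unif_step.hyps(1) by (simp add: P'_def)
    show "compact K'" if K': "(\<pi>, K') \<in> P'" for \<pi> K'
    proof -
      obtain K where K: "(\<pi>, K) \<in> P" "K' = K \<inter> \<pi> -` cball a r"
        using K' by (auto simp: P'_def)
      have "compact K"
        using unif_step.hyps(2) K(1) by blast
      have "isCont \<pi> c" if "c \<in> K" for c
      proof -
        have "amap S \<pi> c"
          using unif_step.IH[OF K(1) that] by blast
        then show ?thesis
          using amap_tendsto by (simp add: continuous_at tendsto_nhds_iff)
      qed
      then have "continuous_on K \<pi>"
        by (simp add: continuous_at_imp_continuous_on)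
      then have "closed K'"
        unfolding K(2) using \<open>compact K\<close> by (intro continuous_closed_preimage compact_imp_closed) auto
      then have "compact (K \<inter> K')"
        by (rule compact_Int_closed[OF \<open>compact K\<close>])
      then show ?thesis
        by (simp add: K(2) Int_absorb1)
    qed
    show "amap T \<pi> c \<and> unif T Q' (\<psi> \<circ> \<pi>) c" if K': "(\<pi>, K') \<in> P'" "c \<in> K'" for \<pi> K' c
    proof -
      obtain K where K: "(\<pi>, K) \<in> P" "K' = K \<inter> \<pi> -` cball a r"
        using K' by (auto simp: P'_def)
      have c: "c \<in> K" "dist (\<pi> c) a < \<delta>"
        using K'(2) K(2) \<delta>(1) by (auto simp: r_def dist_commute)
      have \<pi>: "amap S \<pi> c"
        using unif_step.IH[OF K(1) c(1)] by blast
      have \<psi>: "amap S \<psi> (\<pi> c)" "\<psi> (\<pi> c) \<in> N"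
        using \<delta>(2)[OF c(2)] by auto
      have "unif T Q' (\<psi> \<circ> \<pi>) c"
        using unif_step.IH[OF K(1) c(1)] amap_comp[OF \<psi>(1) \<pi>] \<psi>(2) by (simp add: o_def)
      then show ?thesis
        using amap_mono[OF \<pi> assms(5)] by blast
    qed
    have "\<forall>\<^sub>F x in nhds a. x \<in> ball a r"
      using \<delta>(1) by (intro eventually_nhds_in_open) (auto simp: r_def)
    with unif_step.hyps(3) show "\<forall>\<^sub>F x in nhds a. \<exists>(\<pi>, K)\<in>P'. x \<in> \<pi> ` K"
    proof eventually_elim
      case (elim x)
      then obtain \<pi> K y where y: "(\<pi>, K) \<in> P" "y \<in> K" "x = \<pi> y"
        by auto
      then have x: "x \<in> \<pi> ` (K \<inter> \<pi> -` cball a r)"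
        using elim(2) by auto
      have "(\<pi>, K \<inter> \<pi> -` cball a r) \<in> P'"
        unfolding P'_def using y(1) by force
      with x show ?case
        by (intro bexI[where x = "(\<pi>, K \<inter> \<pi> -` cball a r)"]) (simp_all only: prod.case)
    qed
  qed
qed

text \<open>A process for the pulled back property, begun with its own substitution, is a
  continuation of the process that has already arrived at \<open>\<psi>\<close>.\<close>

lemma unif_shift:
  assumes "unif S (\<lambda>\<phi>. Q (\<psi> \<circ> \<phi>)) \<phi> b"
  shows "unif S Q (\<psi> \<circ> \<phi>) b"
  using assms
proof (induction rule: unif.induct)
  case (unif_base \<phi> a)
  then show ?case
    using unif.unif_base[where Q = Q and \<psi> = "\<psi> \<circ> \<phi>" and a = a and S = S] by blast
next
  case (unif_step P \<phi> a)
  show ?case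
  proof (rule unif.unif_step[where P = P and \<psi> = "\<psi> \<circ> \<phi>", OF unif_step.hyps(1) _ _ unif_step.hyps(3)])
    show "compact K" if "(\<pi>, K) \<in> P" for \<pi> K
      using unif_step.hyps(2)[OF that] .
    show "amap S \<pi> c \<and> unif S Q (\<psi> \<circ> \<phi> \<circ> \<pi>) c" if "(\<pi>, K) \<in> P" "c \<in> K" for \<pi> K c
      using unif_step.IH[OF that] unfolding o_assoc by (elim conjE) (intro conjI)
  qed
qed

definition uniformizable :: "'k set \<Rightarrow> (real ^ 'k \<Rightarrow> real) \<Rightarrow> real ^ 'k \<Rightarrow> bool" where
  "uniformizable S f a \<longleftrightarrow> unif S (\<lambda>\<psi>. normal_crossing (\<lambda>x. f (\<psi> x))) id a"

lemma uniformizable_normal_crossing: "normal_crossing f a \<Longrightarrow> uniformizable S f a"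
  unfolding uniformizable_def by (rule unif_base) simp

lemma uniformizable_compD: "uniformizable S (\<lambda>x. f (\<psi> x)) b \<Longrightarrow> unif S (\<lambda>\<psi>. normal_crossing (\<lambda>x. f (\<psi> x))) \<psi> b"
  using unif_shift[of S "\<lambda>\<psi>. normal_crossing (\<lambda>x. f (\<psi> x))" \<psi> id b] by (simp add: uniformizable_def)

lemma uniformizable_cover:
  assumes "finite P" "\<And>\<pi> K. (\<pi>, K) \<in> P \<Longrightarrow> compact K"
    and "\<And>\<pi> K c. (\<pi>, K) \<in> P \<Longrightarrow> c \<in> K \<Longrightarrow> amap S \<pi> c \<and> uniformizable S (\<lambda>x. f (\<pi> x)) c"
    and "\<forall>\<^sub>F x in nhds a. \<exists>(\<pi>, K)\<in>P. x \<in> \<pi> ` K"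
  shows "uniformizable S f a"
  unfolding uniformizable_def
proof (rule unif_step[where P = P and \<psi> = id, OF assms(1) _ _ assms(4)])
  show "compact K" if "(\<pi>, K) \<in> P" for \<pi> K
    using assms(2)[OF that] .
  show "amap S \<pi> c \<and> unif S (\<lambda>\<psi>. normal_crossing (\<lambda>x. f (\<psi> x))) (id \<circ> \<pi>) c" if "(\<pi>, K) \<in> P" "c \<in> K" for \<pi> K c
    using assms(3)[OF that] uniformizable_compD[of S f \<pi> c] by simp
qed

text \<open>An auxiliary \<open>g\<close> in fewer variables is made a normal crossing beforehand,
  and \<open>f\<close> is treated at each leaf. The predicate \<open>P\<close> collects identities
  of germs at \<open>a\<close> that must survive at the moved points
  \<open>\<psi> b\<close>.\<close>

lemma uniformizable_transfer:
  assumes "uniformizable S g a" "\<forall>\<^sub>F x in nhds a. P x" "S \<subseteq> T"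
    and Q: "\<And>\<psi> b. amap S \<psi> b \<Longrightarrow> \<forall>\<^sub>F x in nhds (\<psi> b). P x \<Longrightarrow> normal_crossing (\<lambda>x. g (\<psi> x)) b \<Longrightarrow> uniformizable T (\<lambda>x. f (\<psi> x)) b"
  shows "uniformizable T f a"
proof -
  obtain N where N: "open N" "a \<in> N" "\<And>x. x \<in> N \<Longrightarrow> P x"
    using assms(2) unfolding eventually_nhds by blast
  show ?thesis
    unfolding uniformizable_def
  proof (rule unif_transfer[OF assms(1)[unfolded uniformizable_def] amap_id _ N(1) assms(3)])
    show "id a \<in> N"
      using N by simp
    fix \<psi> b assume \<psi>: "amap S \<psi> b" "\<psi> b \<in> N" "normal_crossing (\<lambda>x. g (\<psi> x)) b"
    have ev: "\<forall>\<^sub>F x in nhds (\<psi> b). P x"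
      using N \<psi>(2) unfolding eventually_nhds by blast
    show "unif T (\<lambda>\<psi>. normal_crossing (\<lambda>x. f (\<psi> x))) \<psi> b"
      using Q[OF \<psi>(1) ev \<psi>(3)] by (rule uniformizable_compD[of T f \<psi> b])
  qed
qed

lemma uniformizable_cong:
  assumes "uniformizable S g a" "\<forall>\<^sub>F x in nhds a. f x = g x"
  shows "uniformizable S f a"
proof (rule uniformizable_transfer[OF assms order_refl])
  fix \<psi> b assume *: "amap S \<psi> b" "\<forall>\<^sub>F x in nhds (\<psi> b). f x = g x" "normal_crossing (\<lambda>x. g (\<psi> x)) b"
  show "uniformizable S (\<lambda>x. f (\<psi> x)) b"
    by (rule uniformizable_normal_crossing) (rule normal_crossing_comp_cong[OF *])
qed

text \<open>A cover by one chart: a continuous local right inverse fixing \<open>a\<close> shows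
  that the image of a small closed ball contains a neighborhood.\<close>

lemma uniformizable_homeo:
  assumes \<pi>: "\<forall>\<^sub>F x in nhds a. amap S \<pi> x \<and> uniformizable S (\<lambda>x. f (\<pi> x)) x"
    and \<rho>: "(\<rho> \<longlongrightarrow> a) (nhds a)" "\<forall>\<^sub>F x in nhds a. \<pi> (\<rho> x) = x"
  shows "uniformizable S f a"
proof -
  obtain \<delta> where \<delta>: "\<delta> > 0" "\<And>x. dist x a < \<delta> \<Longrightarrow> amap S \<pi> x \<and> uniformizable S (\<lambda>x. f (\<pi> x)) x"
    using \<pi> unfolding eventually_nhds_metric by blast
  define K where "K = cball a (\<delta> / 2)"
  show ?thesis
  proof (rule uniformizable_cover[where P = "{(\<pi>, K)}"])
    show "amap S \<pi>' c \<and> uniformizable S (\<lambda>x. f (\<pi>' x)) c" if "(\<pi>', K') \<in> {(\<pi>, K)}" "c \<in> K'" for \<pi>' K' c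
      using that \<delta> by (auto simp: K_def dist_commute)
    have "\<forall>\<^sub>F x in nhds a. \<rho> x \<in> ball a (\<delta> / 2)"
      using \<delta>(1) by (intro topological_tendstoD[OF \<rho>(1)]) auto
    with \<rho>(2) show "\<forall>\<^sub>F x in nhds a. \<exists>(\<pi>, K)\<in>{(\<pi>, K)}. x \<in> \<pi> ` K"
    proof eventually_elim
      case (elim x)
      then have "\<rho> x \<in> K"
        by (simp add: K_def)
      then have "x \<in> \<pi> ` K"
        using elim(1) by (metis imageI)
      then show ?case
        by simp
    qed
  qed (auto simp: K_def)
qed

section \<open>Blowing up\<close>

text \<open>Separate radii per coordinate are needed because in one blow-up chart the side in
  direction \<open>n\<close> has a prescribed, possibly large length while the other sides
  shrink.\<close>

definition box_around :: "real ^ 'k \<Rightarrow> ('k \<Rightarrow> real) \<Rightarrow> (real ^ 'k) set" where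
  "box_around c r = {x. \<forall>j. \<bar>x $ j - c $ j\<bar> \<le> r j}"

lemma compact_box_around: "compact (box_around c r)"
proof -
  have "box_around c r = cbox (\<chi> j. c $ j - r j) (\<chi> j. c $ j + r j)"
    by (auto simp: box_around_def mem_box_cart abs_le_iff algebra_simps) 
  then show ?thesis
    by simp
qed

lemma eventually_box_around:
  assumes "\<And>j. r j > 0" shows "\<forall>\<^sub>F x in nhds c. x \<in> box_around c r"
proof -
  have "\<forall>\<^sub>F x in nhds c. \<bar>x $ j - c $ j\<bar> \<le> r j" for j
  proof -
    have "((\<lambda>x. x $ j) \<longlongrightarrow> c $ j) (nhds c)"
      by (intro tendsto_intros) (simp add: tendsto_nhds_iff)
    then have "\<forall>\<^sub>F x in nhds c. dist (x $ j) (c $ j) < r j"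
      using assms by (rule tendstoD)
    then show ?thesis
      by (rule eventually_mono) (simp add: dist_real_def)
  qed
  then show ?thesis
    by (simp add: box_around_def eventually_all_finite)
qed

lemma obtain_box_around:
  assumes "\<forall>\<^sub>F x in nhds c. P x"
  obtains \<epsilon> where "\<epsilon> > 0" "\<And>x. x \<in> box_around c (\<lambda>_. \<epsilon>) \<Longrightarrow> P x"
proof -
  obtain d where d: "d > 0" "\<And>x. dist x c < d \<Longrightarrow> P x"
    using assms unfolding eventually_nhds_metric by blast
  define N where "N = real CARD('a)"
  have N: "N > 0"
    by (simp add: N_def)
  define \<epsilon> where "\<epsilon> = d / (2 * N)"
  show thesis
  proof
    show "\<epsilon> > 0"
      using d N by (simp add: \<epsilon>_def)
    fix x assume x: "x \<in> box_around c (\<lambda>_. \<epsilon>)"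
    have "dist x c \<le> (\<Sum>i\<in>UNIV. \<bar>(x - c) $ i\<bar>)"
      unfolding dist_norm by (rule norm_le_l1_cart)
    also have "\<dots> \<le> (\<Sum>i\<in>(UNIV::'a set). \<epsilon>)"
      by (rule sum_mono) (use x in \<open>simp add: box_around_def\<close>)
    also have "\<dots> = N * \<epsilon>"
      by (simp add: N_def)
    also have "\<dots> < d"
      using d N by (simp add: \<epsilon>_def)
    finally show "P x"
      by (rule d(2))
  qed
qed

section \<open>Algebra of functions of selected coordinates\<close>

lemma depends_on_mult: "depends_on S f \<Longrightarrow> depends_on S g \<Longrightarrow> depends_on S (\<lambda>x. f x * g x :: real)"
  unfolding depends_on_def by metis

lemma depends_on_add: "depends_on S f \<Longrightarrow> depends_on S g \<Longrightarrow> depends_on S (\<lambda>x. f x + g x :: real)"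
  unfolding depends_on_def by metis

lemma depends_on_diff: "depends_on S f \<Longrightarrow> depends_on S g \<Longrightarrow> depends_on S (\<lambda>x. f x - g x :: real)"
  unfolding depends_on_def by metis

lemma depends_on_power: "depends_on S f \<Longrightarrow> depends_on S (\<lambda>x. f x ^ m :: real)"
  unfolding depends_on_def by metis

lemma depends_on_sum: "(\<And>i. i \<in> I \<Longrightarrow> depends_on S (f i)) \<Longrightarrow> depends_on S (\<lambda>x. \<Sum>i\<in>I. f i x :: real)"
  unfolding depends_on_def by (intro allI impI sum.cong) auto

lemma depends_on_prod: "(\<And>i. i \<in> I \<Longrightarrow> depends_on S (f i)) \<Longrightarrow> depends_on S (\<lambda>x. \<Prod>i\<in>I. f i x :: real)"
  unfolding depends_on_def by (intro allI impI prod.cong) auto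

lemma depends_on_const: "depends_on S (\<lambda>x. c)"
  by (simp add: depends_on_def)

lemma depends_on_coord: "i \<in> S \<Longrightarrow> depends_on S (\<lambda>x. x $ i)"
  by (simp add: depends_on_def)

lemma depends_on_mon: "(\<And>i. i \<notin> S \<Longrightarrow> \<alpha> i = 0) \<Longrightarrow> depends_on S (mon b \<alpha>)"
  unfolding depends_on_def mon_def by (intro allI impI prod.cong) (auto, metis power_0)

lemma mon_upd_scale: "mon b \<alpha> (upd x k (b $ k + t * (x $ k - b $ k))) = t ^ \<alpha> k * mon b \<alpha> x"
proof -
  have "mon b \<alpha> (upd x k (b $ k + t * (x $ k - b $ k))) =
      (\<Prod>i\<in>UNIV. (if i = k then t ^ \<alpha> k else 1) * (x $ i - b $ i) ^ \<alpha> i)"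
    unfolding mon_def by (rule prod.cong) (auto simp: power_mult_distrib)
  also have "\<dots> = t ^ \<alpha> k * mon b \<alpha> x"
    by (simp add: prod.distrib mon_def)
  finally show ?thesis .
qed

lemma normal_crossing_nonzero_germ:
  assumes "normal_crossing f c" shows "\<not> (\<forall>\<^sub>F x in nhds c. f x = 0)"
proof
  assume f0: "\<forall>\<^sub>F x in nhds c. f x = 0"
  obtain \<alpha> u where u: "ranalytic u c" "u c \<noteq> 0" and f: "\<forall>\<^sub>F x in nhds c. f x = mon c \<alpha> x * u x"
    using normal_crossing_centered[OF assms] by blast
  have "\<forall>\<^sub>F x in nhds c. u x \<noteq> 0"
    using ranalytic_tendsto[OF u(1)] u(2) by (rule tendsto_imp_eventually_ne)
  with f f0 have "\<forall>\<^sub>F x in nhds c. mon c \<alpha> x = 0"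
    by eventually_elim simp
  then show False
    using mon_nonzero_germ by blast
qed

lemma ranalytic_bounded_line:
  assumes "ranalytic u c" shows "\<exists>C. \<forall>\<^sub>F s in nhds 0. \<bar>u (upd c n (c $ n + s))\<bar> \<le> C"
  using has_tp_bounded[OF has_tp_ranalytic0[OF assms]] by blast

text \<open>On the line through \<open>c\<close> the other coefficients are constant and the
  remainder starts in degree \<open>d > i0\<close>, so the Taylor coefficient of degree
  \<open>i0\<close> is \<open>g i0 c\<close>.\<close>

lemma ordn_low:
  assumes h: "\<forall>\<^sub>F x in nhds c. h x = (\<Sum>i\<in>I. g i x * (x $ n - b $ n) ^ i) + (x $ n - b $ n) ^ d * u x"
    and cb: "c $ n = b $ n" and I: "I \<subseteq> {..<d}" and g: "\<And>i. i \<in> I \<Longrightarrow> depends_on S (g i)" and n: "n \<notin> S"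
    and u: "ranalytic u c" and i0: "i0 \<in> I" "g i0 c \<noteq> 0"
  shows "ordn n i0 h c"
proof -
  have fin: "finite I"
    using I finite_subset by blast
  obtain C where "\<forall>\<^sub>F s in nhds 0. \<bar>u (upd c n (c $ n + s))\<bar> \<le> C"
    using ranalytic_bounded_line[OF u] by blast
  then have "has_tp (\<lambda>s. s ^ d * u (upd c n (c $ n + s))) i0 0"
    by (rule has_tp_power_mult) (use I i0 in auto)
  then have "has_tp (\<lambda>s. poly (\<Sum>i\<in>I. monom (g i c) i) s + s ^ d * u (upd c n (c $ n + s))) i0 ((\<Sum>i\<in>I. monom (g i c) i) + 0)"
    by (rule has_tp_add[OF has_tp_poly])
  then have "has_tp (\<lambda>s. h (upd c n (c $ n + s))) i0 ((\<Sum>i\<in>I. monom (g i c) i) + 0)"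
  proof (rule has_tp_cong)
    have g': "g i (upd c n t) = g i c" if "i \<in> I" for i t
      using depends_on_upd[OF g[OF that] n] .
    show "\<forall>\<^sub>F s in nhds 0. h (upd c n (c $ n + s)) =
        poly (\<Sum>i\<in>I. monom (g i c) i) s + s ^ d * u (upd c n (c $ n + s))"
      using eventually_line[OF h, of n] by eventually_elim (simp add: cb poly_sum poly_monom g')
  qed
  moreover have "coeff ((\<Sum>i\<in>I. monom (g i c) i) + 0) i0 = g i0 c"
    using i0 fin by (simp add: coeff_sum)
  ultimately show ?thesis
    using i0(2) unfolding ordn_def by metis
qed

text \<open>The factor \<open>e\<close> receives the powers of coordinates split off by blow-ups. It
  must take part in the statement since normal crossings of two factors separately, after different
  substitutions, would say nothing about their product.\<close>

definition unif_order :: "'k::finite \<Rightarrow> 'k set \<Rightarrow> nat \<Rightarrow> bool" where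
  "unif_order n S d \<longleftrightarrow> (\<forall>e h a. ranalytic e a \<longrightarrow> depends_on S e \<longrightarrow> \<not> (\<forall>\<^sub>F x in nhds a. e x = 0) \<longrightarrow>
     ranalytic h a \<longrightarrow> depends_on (insert n S) h \<longrightarrow> ordn n d h a \<longrightarrow> uniformizable (insert n S) (\<lambda>x. e x * h x) a)"

lemma unif_orderD:
  "unif_order n S d \<Longrightarrow> ranalytic e a \<Longrightarrow> depends_on S e \<Longrightarrow> \<not> (\<forall>\<^sub>F x in nhds a. e x = 0) \<Longrightarrow>
     ranalytic h a \<Longrightarrow> depends_on (insert n S) h \<Longrightarrow> ordn n d h a \<Longrightarrow> uniformizable (insert n S) (\<lambda>x. e x * h x) a"
  unfolding unif_order_def by blast

lemma amap_upd:
  assumes "ranalytic t a" "k \<in> T" "depends_on T t"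
  shows "amap T (\<lambda>x. upd x k (t x)) a"
  unfolding amap_def
proof (intro conjI ballI allI impI)
  show "depends_on T (\<lambda>x. upd x k (t x) $ i)" if "i \<in> T" for i
    using that assms by (cases "i = k") (auto intro: depends_on_coord)
  show "upd x k (t x) $ i = x $ i" if "i \<notin> T" for i x
    using that assms(2) by auto
  show "ranalytic (\<lambda>x. upd x k (t x) $ i) a" for i
    using assms(1) by (cases "i = k") auto
qed

text \<open>The Newton polygon of \<open>h\<close> in \<open>x $ n\<close> has the single slope \<open>\<beta>\<close>, attained at \<open>i0\<close>. Blowing up \<open>x $ n\<close> against a
  coordinate \<open>k\<close> with \<open>\<beta> k > 0\<close> lowers \<open>\<beta> k\<close> by one or the order in one chart, and gives normal crossings in the other, where
  \<open>(x $ n - b $ n) ^ d * u\<close> dominates; for \<open>\<beta> = 0\<close> the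
  order is at most \<open>i0 < d\<close>.\<close>
lemma blow_up:
  fixes n :: "'k::finite"
  assumes n: "n \<notin> S" and low: "\<And>d'. d' < d \<Longrightarrow> unif_order n S d'"
    and I: "I \<subseteq> {..<d - 1}" and i0: "i0 \<in> I"
    and cb: "c $ n = b $ n"
    and e: "ranalytic e c" "depends_on S e" and e_eq: "\<forall>\<^sub>F x in nhds c. e x = mon b \<gamma> x * ve x"
    and ve: "ranalytic ve c" "ve c \<noteq> 0" and \<gamma>: "\<And>i. i \<notin> S \<Longrightarrow> \<gamma> i = 0"
    and h: "ranalytic h c" "depends_on (insert n S) h"
    and h_eq: "\<forall>\<^sub>F x in nhds c. h x = (\<Sum>i\<in>I. mon b (\<alpha> i) x * v i x * (x $ n - b $ n) ^ i) + (x $ n - b $ n) ^ d * u x"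
    and v: "\<And>i. i \<in> I \<Longrightarrow> ranalytic (v i) c" "\<And>i. i \<in> I \<Longrightarrow> v i c \<noteq> 0" "\<And>i. i \<in> I \<Longrightarrow> depends_on S (v i)"
    and \<alpha>S: "\<And>i j. i \<in> I \<Longrightarrow> j \<notin> S \<Longrightarrow> \<alpha> i j = 0"
    and \<alpha>\<beta>: "\<And>i j. i \<in> I \<Longrightarrow> (d - i) * \<beta> j \<le> \<alpha> i j" and \<alpha>0: "\<And>j. \<alpha> i0 j = (d - i0) * \<beta> j"
    and u: "ranalytic u c" "u c \<noteq> 0" "depends_on (insert n S) u"
  shows "uniformizable (insert n S) (\<lambda>x. e x * h x) c"
  using assms(5-)
\<comment> \<open>The measure is the total slope. The center \<open>b\<close> of the monomials stays
  fixed while the point \<open>c\<close> ranges over the charts, so some monomials may be units at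
  \<open>c\<close>.\<close>
proof (induction "sum \<beta> UNIV" arbitrary: c e \<gamma> ve h \<alpha> v \<beta> u rule: less_induct)
  case less
  note cb = less.prems(1) and e = less.prems(2,3) and e_eq = less.prems(4) and ve = less.prems(5,6)
    and \<gamma> = less.prems(7) and h = less.prems(8,9) and h_eq = less.prems(10) and v = less.prems(11-13)
    and \<alpha>S = less.prems(14) and \<alpha>\<beta> = less.prems(15) and \<alpha>0 = less.prems(16) and u = less.prems(17-19)
  let ?T = "insert n S"
  have finI: "finite I"
    using I finite_subset by blast
  have id: "i < d - 1" if "i \<in> I" for i
    using I that by auto
  have d: "d \<ge> 2"
    using id[OF i0] by simp
  have "normal_crossing e c"
    by (rule normal_crossingI[OF ve e_eq])
  then have e_nz: "\<not> (\<forall>\<^sub>F x in nhds c. e x = 0)"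
    by (rule normal_crossing_nonzero_germ)
  show ?case
  proof (cases "mon b \<beta> c = 0")
    \<comment> \<open>Every coordinate with positive slope is away from \<open>b\<close>, so the
      coefficient of index \<open>i0\<close> is nonzero at \<open>c\<close> and the order is at most
      \<open>i0\<close>.\<close>
    case False
    have "mon b (\<alpha> i0) c \<noteq> 0"
      using False id[OF i0] by (auto simp: mon_eq_0_iff \<alpha>0)
    then have "ordn n i0 h c"
      using h_eq cb n u(1) i0 v(2)[OF i0] id
      by (intro ordn_low[where I = I and d = d and b = b and u = u and g = "\<lambda>i x. mon b (\<alpha> i) x * v i x"])
         (auto intro!: depends_on_mult depends_on_mon v(3) \<alpha>S, force)
    then show ?thesis
      using id[OF i0] by (intro unif_orderD[OF low e e_nz h]) auto
  next
    case True
    then obtain k where k: "\<beta> k > 0" "c $ k = b $ k"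
      by (auto simp: mon_eq_0_iff)
    have kS: "k \<in> S"
      using \<alpha>S[OF i0, of k] \<alpha>0[of k] k id[OF i0] by (metis less_imp_le_nat mult_is_0 not_less_iff_gr_or_eq zero_less_diff less_diff_conv add_lessD1)
    have kn: "k \<noteq> n"
      using kS n by blast
    have \<alpha>k: "d - i \<le> \<alpha> i k" if "i \<in> I" for i
    proof -
      have "(d - i) * 1 \<le> (d - i) * \<beta> k"
        by (rule mult_le_mono2) (use k(1) in simp)
      then have "d - i \<le> (d - i) * \<beta> k"
        by simp
      also have "\<dots> \<le> \<alpha> i k"
        by (rule \<alpha>\<beta>[OF that])
      finally show ?thesis .
    qed
    \<comment> \<open>The two standard charts of the blow-up of the codimension two subspace
      \<open>x $ n = b $ n\<close>, \<open>x $ k = b $ k\<close>: \<open>p1\<close> uses the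
      quotient of the \<open>n\<close>-th by the \<open>k\<close>-th coordinate, \<open>p2\<close>
      the inverse quotient.\<close>
    define p1 where "p1 x = upd x n (b $ n + (x $ k - b $ k) * (x $ n - b $ n))" for x
    define p2 where "p2 x = upd x k (b $ k + (x $ n - b $ n) * (x $ k - b $ k))" for x
    have depends_on_coords: "depends_on ?T (\<lambda>x. x $ n)" "depends_on ?T (\<lambda>x. x $ k)"
      using kS by (auto intro: depends_on_coord)
    have p1: "amap ?T p1 x" for x
      unfolding p1_def[abs_def]
      by (intro amap_upd ranalytic_add ranalytic_mult ranalytic_diff ranalytic_coord ranalytic_const
          depends_on_add depends_on_mult depends_on_diff depends_on_const depends_on_coords) simp
    have p2: "amap ?T p2 x" for x
      unfolding p2_def[abs_def]
      by (intro amap_upd ranalytic_add ranalytic_mult ranalytic_diff ranalytic_coord ranalytic_const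
          depends_on_add depends_on_mult depends_on_diff depends_on_const depends_on_coords) (use kS in simp)
    have p2c: "p2 c = c"
      by (simp add: p2_def vec_eq_iff cb k)
    have "\<forall>\<^sub>F x in nhds c. normal_crossing (\<lambda>x. e (p2 x) * h (p2 x)) x"
    proof -
      \<comment> \<open>What remains of \<open>h\<close> after splitting off the power
        \<open>d\<close> of \<open>x $ n - b $ n\<close>. Since
        \<open>\<alpha> i k \<ge> d - i > 0\<close>, every term but \<open>u\<close> contains the
        coordinate \<open>k\<close> and vanishes at \<open>c\<close>; thus \<open>H\<close> is a
        unit.\<close>
      define H where "H x = u (p2 x) + (\<Sum>i\<in>I. (x $ n - b $ n) ^ (\<alpha> i k + i - d) * mon b (\<alpha> i) x * v i (p2 x))" for x
      define w where "w x = ve (p2 x) * H x" for x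
      have comp: "ranalytic (\<lambda>x. f (p2 x)) c" if "ranalytic f c" for f
        using amap_ranalytic[OF p2[of c], of f] that by (simp add: p2c)
      have "ranalytic H c"
        unfolding H_def using u(1) v(1)
        by (intro ranalytic_add ranalytic_sum ranalytic_mult ranalytic_power ranalytic_diff ranalytic_coord ranalytic_const ranalytic_mon comp)
      then have w: "ranalytic w c"
        unfolding w_def by (intro ranalytic_mult comp ve(1))
      have "mon b (\<alpha> i) c = 0" if "i \<in> I" for i
        unfolding mon_eq_0_iff using \<alpha>k[OF that] id[OF that] k(2) by (intro exI[of _ k]) auto
      then have "H c = u c"
        by (simp add: H_def p2c)
      then have wc: "w c \<noteq> 0"
        using u ve by (simp add: w_def p2c)
      have "\<forall>\<^sub>F x in nhds c. e (p2 x) = mon b \<gamma> (p2 x) * ve (p2 x)"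
        using amap_eventually_comp[OF p2[of c], of "\<lambda>x. e x = mon b \<gamma> x * ve x"] e_eq by (simp only: p2c)
      moreover have "\<forall>\<^sub>F x in nhds c. h (p2 x) = (\<Sum>i\<in>I. mon b (\<alpha> i) (p2 x) * v i (p2 x) * (p2 x $ n - b $ n) ^ i) +
          (p2 x $ n - b $ n) ^ d * u (p2 x)"
        using amap_eventually_comp[OF p2[of c], of "\<lambda>x. h x = (\<Sum>i\<in>I. mon b (\<alpha> i) x * v i x * (x $ n - b $ n) ^ i) +
          (x $ n - b $ n) ^ d * u x"] h_eq by (simp only: p2c)
      ultimately have "\<forall>\<^sub>F x in nhds c. e (p2 x) * h (p2 x) =
          mon b (\<lambda>i. \<gamma> i + (if i = n then \<gamma> k + d else 0)) x * w x"
      proof eventually_elim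
        case (elim x)
        define t where "t = x $ n - b $ n"
        have p2n: "p2 x $ n - b $ n = t"
          using kn by (simp add: p2_def t_def)
        have mon: "mon b \<delta> (p2 x) = t ^ \<delta> k * mon b \<delta> x" for \<delta>
          unfolding p2_def t_def by (rule mon_upd_scale)
        have "t ^ \<alpha> i k * mon b (\<alpha> i) x * v i (p2 x) * t ^ i =
            t ^ d * (t ^ (\<alpha> i k + i - d) * mon b (\<alpha> i) x * v i (p2 x))" if "i \<in> I" for i
        proof -
          have "\<alpha> i k + i = d + (\<alpha> i k + i - d)"
            using \<alpha>k[OF that] by simp
          then have "t ^ \<alpha> i k * t ^ i = t ^ d * t ^ (\<alpha> i k + i - d)"
            by (metis power_add)
          then show ?thesis
            by (simp add: mult_ac)
        qed
        then have "(\<Sum>i\<in>I. t ^ \<alpha> i k * mon b (\<alpha> i) x * v i (p2 x) * t ^ i) =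
            t ^ d * (\<Sum>i\<in>I. t ^ (\<alpha> i k + i - d) * mon b (\<alpha> i) x * v i (p2 x))"
          unfolding sum_distrib_left by (rule sum.cong[OF refl])
        then have "h (p2 x) = t ^ d * H x"
          unfolding elim(2) p2n mon H_def t_def[symmetric] by (simp add: distrib_left)
        then show ?case
          unfolding elim(1) mon mon_add mon_single w_def t_def[symmetric] power_add by (simp add: mult_ac)
      qed
      then have "\<forall>\<^sub>F y in nhds c. \<forall>\<^sub>F x in nhds y. e (p2 x) * h (p2 x) =
          mon b (\<lambda>i. \<gamma> i + (if i = n then \<gamma> k + d else 0)) x * w x"
        by (simp add: eventually_eventually)
      moreover have "\<forall>\<^sub>F y in nhds c. w y \<noteq> 0"
        using ranalytic_tendsto[OF w] wc by (rule tendsto_imp_eventually_ne)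
      ultimately show ?thesis
        using ranalytic_eventually[OF w]
      proof eventually_elim
        case (elim y)
        show ?case
          by (rule normal_crossingI[OF elim(3,2,1)])
      qed
    qed
    then obtain \<epsilon>2 where \<epsilon>2: "\<epsilon>2 > 0" and chart2: "\<And>x. x \<in> box_around c (\<lambda>_. \<epsilon>2) \<Longrightarrow> normal_crossing (\<lambda>x. e (p2 x) * h (p2 x)) x"
      using obtain_box_around[of "normal_crossing (\<lambda>x. e (p2 x) * h (p2 x))" c] by blast
    \<comment> \<open>The second chart is good for quotients up to \<open>\<epsilon>2\<close>, so
      the first one has to reach all inverse quotients up to \<open>1 / \<epsilon>2\<close>.\<close>
    define M where "M = 1 / \<epsilon>2"
    have M: "M > 0"
      using \<epsilon>2 by (simp add: M_def)
    obtain \<delta> where \<delta>: "\<delta> > 0" "\<And>y t0 l I e. dist y c < \<delta> \<Longrightarrow> \<bar>t0 * l\<bar> < \<delta> \<Longrightarrow> t0 \<noteq> 0 \<Longrightarrow> I \<subseteq> {..<d - 1} \<Longrightarrow>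
      \<exists>p. has_tp (\<lambda>s. (\<Sum>i\<in>I. e i * (t0 + s) ^ i) + (t0 + s) ^ d * u (upd y n (y $ n + l * s))) (d - 1) p \<and>
        coeff p (d - 1) \<noteq> 0"
      by (rule next_coeff_nonzero[OF u(1,2), of d n]) (use d in auto)
    have "\<forall>\<^sub>F y in nhds c. (\<forall>\<^sub>F x in nhds y. e x = mon b \<gamma> x * ve x) \<and>
        (\<forall>\<^sub>F x in nhds y. h x = (\<Sum>i\<in>I. mon b (\<alpha> i) x * v i x * (x $ n - b $ n) ^ i) + (x $ n - b $ n) ^ d * u x) \<and>
        ranalytic e y \<and> ranalytic ve y \<and> ve y \<noteq> 0 \<and> (\<forall>i\<in>I. ranalytic (v i) y \<and> v i y \<noteq> 0) \<and> ranalytic u y \<and> u y \<noteq> 0 \<and> dist y c < \<delta>"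
    proof (intro eventually_conj)
      show "\<forall>\<^sub>F y in nhds c. \<forall>i\<in>I. ranalytic (v i) y \<and> v i y \<noteq> 0"
        using ranalytic_eventually[OF v(1)] tendsto_imp_eventually_ne[OF ranalytic_tendsto[OF v(1)] v(2)]
        by (intro eventually_ball_finite[OF finI] ballI eventually_conj)
      show "\<forall>\<^sub>F y in nhds c. dist y c < \<delta>"
        unfolding eventually_nhds_metric using \<delta>(1) by blast
    qed (use e_eq h_eq ranalytic_eventually[OF e(1)] ranalytic_eventually[OF ve(1)] ranalytic_eventually[OF u(1)]
        tendsto_imp_eventually_ne[OF ranalytic_tendsto[OF ve(1)] ve(2)]
        tendsto_imp_eventually_ne[OF ranalytic_tendsto[OF u(1)] u(2)] in \<open>simp_all only: eventually_eventually\<close>)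
    then obtain \<epsilon>3 where \<epsilon>3: "\<epsilon>3 > 0" and near: "\<And>y. y \<in> box_around c (\<lambda>_. \<epsilon>3) \<Longrightarrow>
        (\<forall>\<^sub>F x in nhds y. e x = mon b \<gamma> x * ve x) \<and>
        (\<forall>\<^sub>F x in nhds y. h x = (\<Sum>i\<in>I. mon b (\<alpha> i) x * v i x * (x $ n - b $ n) ^ i) + (x $ n - b $ n) ^ d * u x) \<and>
        ranalytic e y \<and> ranalytic ve y \<and> ve y \<noteq> 0 \<and> (\<forall>i\<in>I. ranalytic (v i) y \<and> v i y \<noteq> 0) \<and> ranalytic u y \<and> u y \<noteq> 0 \<and> dist y c < \<delta>"
      by (rule obtain_box_around) blast
    \<comment> \<open>Makes the image of the long box small in all coordinates, since its
      \<open>n\<close>-th one is a product bounded by \<open>\<epsilon>1 * M\<close>, and keeps this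
      product below the radius \<open>\<delta>\<close>.\<close>
    define \<epsilon>1 where "\<epsilon>1 = min \<epsilon>3 (min (\<epsilon>3 / M) (\<delta> / (2 * M)))"
    have \<epsilon>1: "\<epsilon>1 > 0" "\<epsilon>1 \<le> \<epsilon>3" "\<epsilon>1 * M \<le> \<epsilon>3" "\<epsilon>1 * M < \<delta>"
    proof -
      show "\<epsilon>1 > 0" "\<epsilon>1 \<le> \<epsilon>3"
        using \<epsilon>3 M \<delta>(1) by (auto simp: \<epsilon>1_def)
      have "\<epsilon>1 \<le> \<epsilon>3 / M" "\<epsilon>1 \<le> \<delta> / (2 * M)"
        by (auto simp: \<epsilon>1_def)
      then have "\<epsilon>1 * M \<le> \<epsilon>3" "\<epsilon>1 * M \<le> \<delta> / 2"
        using M by (simp_all add: field_simps)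
      then show "\<epsilon>1 * M \<le> \<epsilon>3" "\<epsilon>1 * M < \<delta>"
        using \<delta>(1) by linarith+
    qed
    have chart1: "uniformizable ?T (\<lambda>x. e (p1 x) * h (p1 x)) x" if x: "x \<in> box_around c (\<lambda>j. if j = n then M else \<epsilon>1)" for x
    proof -
      have xn: "\<bar>x $ n - b $ n\<bar> \<le> M" and xj: "\<bar>x $ j - c $ j\<bar> \<le> \<epsilon>1" if "j \<noteq> n" for j
        using x that unfolding box_around_def cb[symmetric] by (auto split: if_splits dest: spec[of _ n] spec[of _ j])
      have prod: "\<bar>(x $ k - b $ k) * (x $ n - b $ n)\<bar> \<le> \<epsilon>1 * M"
        unfolding abs_mult using xn[OF kn] xj[OF kn] \<epsilon>1(1) k(2) by (intro mult_mono) auto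
      have "p1 x \<in> box_around c (\<lambda>_. \<epsilon>3)"
      proof -
        have "\<bar>p1 x $ j - c $ j\<bar> \<le> \<epsilon>3" for j
          using xj[of j] prod \<epsilon>1(2,3) by (cases "j = n") (auto simp: p1_def cb)
        then show ?thesis
          by (simp add: box_around_def)
      qed
      note nr = near[OF this]
      \<comment> \<open>With \<open>y\<close> the coordinate \<open>k\<close> and \<open>t\<close>
        the coordinate \<open>n\<close> relative to \<open>b\<close>, the term of index
        \<open>i\<close> acquires \<open>y ^ i\<close> from the substitution. Splitting off
        \<open>y ^ d\<close> costs \<open>d - i\<close> in its exponent, which for \<open>i0\<close>
        is exactly a decrease of the slope by one.\<close>
      define e' where "e' z = e z * (z $ k - b $ k) ^ d" for z
      define \<gamma>' where "\<gamma>' j = \<gamma> j + (if j = k then d else 0)" for j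
      define \<alpha>' where "\<alpha>' i = (\<alpha> i)(k := \<alpha> i k - (d - i))" for i
      define \<beta>' where "\<beta>' = \<beta>(k := \<beta> k - 1)"
      define h' where "h' z = (\<Sum>i\<in>I. mon b (\<alpha>' i) z * v i z * (z $ n - b $ n) ^ i) + (z $ n - b $ n) ^ d * u (p1 z)" for z
      have depS: "f (p1 z) = f z" if "depends_on S f" for f :: "real ^ 'k \<Rightarrow> real" and z
        unfolding p1_def by (rule depends_on_upd[OF that n])
      have an: "ranalytic (\<lambda>z. f (p1 z)) x" if "ranalytic f (p1 x)" for f
        by (rule amap_ranalytic[OF p1 that])
      have ex: "ranalytic e x"
        using an[of e] nr depS[OF e(2)] by simp
      have vx: "ranalytic (v i) x" "v i x \<noteq> 0" if "i \<in> I" for i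
        using an[of "v i"] nr depS[OF v(3)[OF that]] that by auto
      have ux: "ranalytic (\<lambda>z. u (p1 z)) x" "u (p1 x) \<noteq> 0"
        using an[of u] nr by auto
      have vex: "ranalytic (\<lambda>z. ve (p1 z)) x" "ve (p1 x) \<noteq> 0"
        using an[of ve] nr by auto
      have \<alpha>'S: "\<alpha>' i j = 0" if "i \<in> I" "j \<notin> S" for i j
        using \<alpha>S[OF that] that(2) kS by (auto simp: \<alpha>'_def)
      have e'depends_on: "depends_on S e'"
        unfolding e'_def using kS by (intro depends_on_mult e(2) depends_on_power depends_on_diff depends_on_const depends_on_coord)
      have e': "ranalytic e' x"
        unfolding e'_def by (intro ranalytic_mult ex ranalytic_power ranalytic_diff ranalytic_coord ranalytic_const)
      have h': "ranalytic h' x"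
        unfolding h'_def using vx ux by (intro ranalytic_add ranalytic_sum ranalytic_mult ranalytic_mon ranalytic_power ranalytic_diff ranalytic_coord ranalytic_const)
      have h'depends_on: "depends_on ?T h'"
        unfolding h'_def
        by (intro depends_on_add depends_on_sum depends_on_mult depends_on_power depends_on_diff depends_on_const depends_on_coords amap_depends_on[OF p1 u(3)] depends_on_mono[OF v(3)] depends_on_mon)
           (auto simp: \<alpha>'S)
      have e'_eq: "\<forall>\<^sub>F z in nhds x. e' z = mon b \<gamma>' z * ve (p1 z)"
      proof -
        have "\<forall>\<^sub>F z in nhds x. e (p1 z) = mon b \<gamma> (p1 z) * ve (p1 z)"
          using amap_eventually_comp[OF p1[of x], of "\<lambda>z. e z = mon b \<gamma> z * ve z"] nr by blast
        then show ?thesis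
        proof eventually_elim
          case (elim z)
          have "mon b \<gamma> (p1 z) = mon b \<gamma> z"
            using depends_on_mon[of S \<gamma> b] \<gamma> by (intro depS) blast
          then show ?case
            using elim by (simp add: e'_def \<gamma>'_def[abs_def] mon_add mon_single depS[OF e(2)])
        qed
      qed
      have eq: "\<forall>\<^sub>F z in nhds x. e (p1 z) * h (p1 z) = e' z * h' z"
      proof -
        have "\<forall>\<^sub>F z in nhds x. h (p1 z) = (\<Sum>i\<in>I. mon b (\<alpha> i) (p1 z) * v i (p1 z) * (p1 z $ n - b $ n) ^ i) + (p1 z $ n - b $ n) ^ d * u (p1 z)"
          using amap_eventually_comp[OF p1[of x], of "\<lambda>z. h z = (\<Sum>i\<in>I. mon b (\<alpha> i) z * v i z * (z $ n - b $ n) ^ i) + (z $ n - b $ n) ^ d * u z"] nr by blast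
        then show ?thesis
        proof eventually_elim
          case (elim z)
          define y where "y = z $ k - b $ k"
          define t where "t = z $ n - b $ n"
          have p1n: "p1 z $ n - b $ n = y * t"
            by (simp add: p1_def y_def t_def)
          have "mon b (\<alpha> i) (p1 z) * v i (p1 z) * (y * t) ^ i = y ^ d * (mon b (\<alpha>' i) z * v i z * t ^ i)" if i: "i \<in> I" for i
          proof -
            have "mon b (\<alpha> i) (p1 z) = mon b (\<alpha> i) z"
              using depends_on_mon[of S "\<alpha> i" b] \<alpha>S[OF i] by (intro depS) blast
            also have "\<dots> = y ^ (d - i) * mon b (\<alpha>' i) z"
              unfolding y_def \<alpha>'_def using mon_split[of "d - i" "\<alpha> i" k b z] \<alpha>k[OF i] by simp
            finally have "mon b (\<alpha> i) (p1 z) = y ^ (d - i) * mon b (\<alpha>' i) z" .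
            moreover have "y ^ (d - i) * y ^ i = y ^ d"
              using id[OF i] by (simp flip: power_add)
            ultimately show ?thesis
              unfolding depS[OF v(3)[OF i]] power_mult_distrib
              by (metis (no_types, lifting) mult.assoc mult.commute)
          qed
          then have "(\<Sum>i\<in>I. mon b (\<alpha> i) (p1 z) * v i (p1 z) * (y * t) ^ i) = y ^ d * (\<Sum>i\<in>I. mon b (\<alpha>' i) z * v i z * t ^ i)"
            unfolding sum_distrib_left by (rule sum.cong[OF refl])
          then have "h (p1 z) = y ^ d * h' z"
            unfolding elim p1n h'_def t_def[symmetric] by (simp add: distrib_left power_mult_distrib mult.assoc)
          then show ?case
            by (simp add: e'_def depS[OF e(2)] y_def)
        qed
      qed
      have "uniformizable ?T (\<lambda>z. e' z * h' z) x"
      proof (cases "x $ n = b $ n")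
        case True
        have sum: "sum \<beta>' UNIV < sum \<beta> UNIV"
        proof -
          have "sum \<beta> UNIV = \<beta> k + sum \<beta> (UNIV - {k})" "sum \<beta>' UNIV = \<beta>' k + sum \<beta>' (UNIV - {k})"
            by (simp_all add: sum.remove)
          moreover have "sum \<beta>' (UNIV - {k}) = sum \<beta> (UNIV - {k})"
            by (rule sum.cong) (auto simp: \<beta>'_def)
          ultimately show ?thesis
            using k(1) by (simp add: \<beta>'_def)
        qed
        have \<alpha>\<beta>': "(d - i) * \<beta>' j \<le> \<alpha>' i j" if "i \<in> I" for i j
          using \<alpha>\<beta>[OF that, of j] by (auto simp: \<alpha>'_def \<beta>'_def diff_mult_distrib2)
        have \<alpha>0': "\<alpha>' i0 j = (d - i0) * \<beta>' j" for j
          using \<alpha>0[of j] by (auto simp: \<alpha>'_def \<beta>'_def diff_mult_distrib2)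
        have \<gamma>'S: "\<gamma>' i = 0" if "i \<notin> S" for i
          using that \<gamma>[OF that] kS by (auto simp: \<gamma>'_def)
        have h'_eq: "\<forall>\<^sub>F z in nhds x. h' z = (\<Sum>i\<in>I. mon b (\<alpha>' i) z * v i z * (z $ n - b $ n) ^ i) + (z $ n - b $ n) ^ d * u (p1 z)"
          by (simp add: h'_def)
        show ?thesis
          by (rule less.hyps[OF sum True e' e'depends_on e'_eq vex \<gamma>'S h' h'depends_on h'_eq vx(1) vx(2) v(3) \<alpha>'S \<alpha>\<beta>' \<alpha>0' ux amap_depends_on[OF p1 u(3)]])
      next
        case False
        \<comment> \<open>The value \<open>t0\<close> may be as large as \<open>M\<close>, but
          \<open>p1\<close> runs through the line in direction \<open>n\<close> with the small speed
          \<open>l\<close>, and the radius restricts only the product \<open>t0 * l\<close>.\<close>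
        define t0 where "t0 = x $ n - b $ n"
        define l where "l = x $ k - b $ k"
        have "\<bar>t0 * l\<bar> < \<delta>"
          using prod \<epsilon>1(4) by (simp add: t0_def l_def mult.commute)
        moreover have "t0 \<noteq> 0"
          using False by (simp add: t0_def)
        ultimately obtain p where p: "has_tp (\<lambda>s. (\<Sum>i\<in>I. mon b (\<alpha>' i) x * v i x * (t0 + s) ^ i) +
            (t0 + s) ^ d * u (upd (p1 x) n (p1 x $ n + l * s))) (d - 1) p" "coeff p (d - 1) \<noteq> 0"
          using \<delta>(2)[of "p1 x" t0 l I "\<lambda>i. mon b (\<alpha>' i) x * v i x"] nr I by blast
        have "h' (upd x n (x $ n + s)) = (\<Sum>i\<in>I. mon b (\<alpha>' i) x * v i x * (t0 + s) ^ i) +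
            (t0 + s) ^ d * u (upd (p1 x) n (p1 x $ n + l * s))" for s
        proof -
          have "p1 (upd x n (x $ n + s)) = upd (p1 x) n (p1 x $ n + l * s)"
            using kn by (simp add: p1_def l_def algebra_simps)
          moreover have "mon b (\<alpha>' i) (upd x n t) = mon b (\<alpha>' i) x" "v i (upd x n t) = v i x" if "i \<in> I" for i t
            using depends_on_upd[OF depends_on_mon[of S "\<alpha>' i" b] n] \<alpha>'S[OF that] depends_on_upd[OF v(3)[OF that] n] by blast+
          moreover have "upd x n (x $ n + s) $ n - b $ n = t0 + s"
            by (simp add: t0_def)
          ultimately show ?thesis
            unfolding h'_def by (simp only: cong: sum.cong)
        qed
        then have "ordn n (d - 1) h' x"
          unfolding ordn_def using p by (intro exI[of _ p]) simp
        moreover have "normal_crossing e' x"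
        proof (rule normal_crossingI[OF _ _ e'_eq])
        qed (use vex in auto)
        then have "\<not> (\<forall>\<^sub>F z in nhds x. e' z = 0)"
          by (rule normal_crossing_nonzero_germ)
        ultimately show ?thesis
          using d by (intro unif_orderD[OF low e' e'depends_on _ h' h'depends_on]) auto
      qed
      then show ?thesis
        by (rule uniformizable_cong[OF _ eq])
    qed
    show ?thesis
    proof (rule uniformizable_cover[where P = "{(p1, box_around c (\<lambda>j. if j = n then M else \<epsilon>1)),
          (p2, box_around c (\<lambda>_. \<epsilon>2))}"])
      show "amap ?T \<pi> x \<and> uniformizable ?T (\<lambda>x. e (\<pi> x) * h (\<pi> x)) x"
        if "(\<pi>, K) \<in> {(p1, box_around c (\<lambda>j. if j = n then M else \<epsilon>1)),
          (p2, box_around c (\<lambda>_. \<epsilon>2))}" "x \<in> K" for \<pi> K x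
      proof (cases "K = box_around c (\<lambda>_. \<epsilon>2) \<and> \<pi> = p2")
        case True
        then show ?thesis
          using chart2[of x] that(2) uniformizable_normal_crossing[of "\<lambda>x. e (p2 x) * h (p2 x)" x ?T] p2 by auto
      next
        case False
        then show ?thesis
          using chart1[of x] that p1 by auto
      qed
      show "compact K" if "(\<pi>, K) \<in> {(p1, box_around c (\<lambda>j. if j = n then M else \<epsilon>1)),
          (p2, box_around c (\<lambda>_. \<epsilon>2))}" for \<pi> K
        using that compact_box_around by blast
      have "\<forall>\<^sub>F x in nhds c. x \<in> box_around c (\<lambda>_. min \<epsilon>1 \<epsilon>2)"
        by (rule eventually_box_around) (use \<epsilon>1 \<epsilon>2 in auto)
      then show "\<forall>\<^sub>F x in nhds c. \<exists>(\<pi>, K)\<in>{(p1, box_around c (\<lambda>j. if j = n then M else \<epsilon>1)),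
          (p2, box_around c (\<lambda>_. \<epsilon>2))}. x \<in> \<pi> ` K"
      proof eventually_elim
        case (elim x)
        define t where "t = x $ n - b $ n"
        define y where "y = x $ k - b $ k"
        have xb: "\<bar>x $ j - c $ j\<bar> \<le> \<epsilon>1" "\<bar>x $ j - c $ j\<bar> \<le> \<epsilon>2" for j
          using elim by (auto simp: box_around_def)
        show ?case
        proof (cases "\<bar>t\<bar> \<le> M * \<bar>y\<bar>")
          case True
          define z where "z = upd x n (b $ n + t / y)"
          \<comment> \<open>If \<open>y = 0\<close> then \<open>t = 0\<close> as well, and the
            convention \<open>t / 0 = 0\<close> gives a valid point of the chart.\<close>
          have "y * (t / y) = t"
            using True by (cases "y = 0") auto
          then have "p1 z = x"
            using kn by (simp add: p1_def z_def vec_eq_iff y_def[symmetric]) (simp add: t_def)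
          moreover have "\<bar>t / y\<bar> \<le> M"
            using True \<epsilon>2 by (cases "y = 0") (auto simp: M_def abs_divide pos_divide_le_eq)
          then have "z \<in> box_around c (\<lambda>j. if j = n then M else \<epsilon>1)"
            using xb(1) by (auto simp: box_around_def z_def cb)
          ultimately have "x \<in> p1 ` box_around c (\<lambda>j. if j = n then M else \<epsilon>1)"
            by blast
          then show ?thesis
            by simp
        next
          case False
          define z where "z = upd x k (b $ k + y / t)"
          have "M * \<bar>y\<bar> \<ge> 0"
            using \<epsilon>2 by (simp add: M_def)
          then have t: "t \<noteq> 0"
            using False by auto
          then have "t * (y / t) = y"
            by simp
          then have "p2 z = x"
            using kn by (simp add: p2_def z_def vec_eq_iff t_def[symmetric]) (simp add: y_def)
          moreover have "\<bar>y / t\<bar> \<le> \<epsilon>2"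
            using False \<epsilon>2 t by (simp add: M_def abs_divide divide_le_eq field_simps)
          then have "z \<in> box_around c (\<lambda>_. \<epsilon>2)"
            using xb(2) by (auto simp: box_around_def z_def k(2))
          ultimately have "x \<in> p2 ` box_around c (\<lambda>_. \<epsilon>2)"
            by blast
          then show ?thesis
            by simp
        qed
      qed
    qed simp
  qed
qed

section \<open>Power substitution\<close>

text \<open>Off the hyperplane \<open>t = 0\<close> the order of \<open>(\<Sum>i\<in>I. e i * t ^ i) + t ^ d * u\<close> in \<open>t\<close> is at most \<open>d - 1\<close>, with a
  radius that depends neither on the coefficients \<open>e\<close> nor on the slope \<open>l\<close>.\<close>
definition next_radius :: "'k::finite \<Rightarrow> nat \<Rightarrow> (real ^ 'k \<Rightarrow> real) \<Rightarrow> real ^ 'k \<Rightarrow> real \<Rightarrow> bool" where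
  "next_radius n d u c \<delta> \<longleftrightarrow> \<delta> > 0 \<and> (\<forall>y t0 l I e. dist y c < \<delta> \<longrightarrow> \<bar>t0 * l\<bar> < \<delta> \<longrightarrow> t0 \<noteq> 0 \<longrightarrow> I \<subseteq> {..<d - 1} \<longrightarrow>
      (\<exists>p. has_tp (\<lambda>s. (\<Sum>i\<in>I. e i * (t0 + s) ^ i) + (t0 + s) ^ d * u (upd y n (y $ n + l * s))) (d - 1) p \<and>
        coeff p (d - 1) \<noteq> 0))"

lemma next_radius_exists:
  assumes "ranalytic u c" "u c \<noteq> 0" "d \<ge> 1"
  obtains \<delta> where "next_radius n d u c \<delta>"
  unfolding next_radius_def by (rule next_coeff_nonzero[OF assms, of n]) blast

text \<open>Since \<open>n\<close> is outside \<open>S\<close>, the map \<open>\<psi>\<close>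
  carries lines in direction \<open>n\<close> to such lines with unit speed; this is slope
  \<open>l = 1\<close> in \<open>next_radius\<close>.\<close>

lemma ordn_off_center:
  assumes \<delta>: "next_radius n d u c \<delta>" and x: "dist (\<psi> x) c < \<delta>" "\<bar>x $ n - b $ n\<bar> < \<delta>" "x $ n \<noteq> b $ n"
    and I: "I \<subseteq> {..<d - 1}" and g: "\<And>i. i \<in> I \<Longrightarrow> depends_on S (g i)" and n: "n \<notin> S" and \<psi>: "amap S \<psi> x"
    and h: "\<forall>\<^sub>F z in nhds x. h z = (\<Sum>i\<in>I. g i z * (z $ n - b $ n) ^ i) + (z $ n - b $ n) ^ d * u (\<psi> z)"
  shows "ordn n (d - 1) h x"
proof -
  obtain p where p: "has_tp (\<lambda>s. (\<Sum>i\<in>I. g i x * ((x $ n - b $ n) + s) ^ i) +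
      ((x $ n - b $ n) + s) ^ d * u (upd (\<psi> x) n (\<psi> x $ n + 1 * s))) (d - 1) p" "coeff p (d - 1) \<noteq> 0"
  proof -
    have "\<bar>(x $ n - b $ n) * 1\<bar> < \<delta>" "x $ n - b $ n \<noteq> 0"
      using x by auto
    from conjunct2[OF \<delta>[unfolded next_radius_def], rule_format, OF x(1) this I, of "\<lambda>i. g i x"]
    show thesis
      using that by blast
  qed
  have \<psi>line: "\<psi> (upd x n (x $ n + s)) = upd (\<psi> x) n (\<psi> x $ n + 1 * s)" for s
  proof -
    have "\<psi> (upd x n (x $ n + s)) $ i = upd (\<psi> x) n (\<psi> x $ n + 1 * s) $ i" for i
    proof (cases "i \<in> S")
      case True
      then have "\<psi> (upd x n (x $ n + s)) $ i = \<psi> x $ i"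
        using n by (intro amap_agree[OF \<psi>]) auto
      then show ?thesis
        using True n by auto
    next
      case False
      then show ?thesis
        using amap_outside[OF \<psi>] n by auto
    qed
    then show ?thesis
      by (simp add: vec_eq_iff)
  qed
  have gi: "g i (upd x n t) = g i x" if "i \<in> I" for i t
    by (rule depends_on_upd[OF g[OF that] n])
  have "has_tp (\<lambda>s. h (upd x n (x $ n + s))) (d - 1) p"
  proof (rule has_tp_cong[OF p(1)])
    show "\<forall>\<^sub>F s in nhds 0. h (upd x n (x $ n + s)) = (\<Sum>i\<in>I. g i x * ((x $ n - b $ n) + s) ^ i) +
      ((x $ n - b $ n) + s) ^ d * u (upd (\<psi> x) n (\<psi> x $ n + 1 * s))"
      using eventually_line[OF h, of n]
    proof eventually_elim
      case (elim s)
      have "upd x n (x $ n + s) $ n - b $ n = (x $ n - b $ n) + s"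
        by simp
      then show ?case
        unfolding elim \<psi>line by (simp only: gi cong: sum.cong)
    qed
  qed
  then show ?thesis
    using p(2) unfolding ordn_def by blast
qed

text \<open>Substituting \<open>b $ k \<plusminus> (x $ k - b $ k) ^ fact d\<close> makes the slopes \<open>\<alpha> i / (d - i)\<close> of the Newton polygon integral.\<close>
lemma power_substitution:
  fixes n :: "'k::finite"
  assumes n: "n \<notin> S" and low: "\<And>d'. d' < d \<Longrightarrow> unif_order n S d'"
    and I: "I \<subseteq> {..<d - 1}" and i0: "i0 \<in> I"
    and e: "ranalytic e b" "depends_on S e" and e_eq: "\<forall>\<^sub>F x in nhds b. e x = mon b \<gamma> x * ve x"
    and ve: "ranalytic ve b" "ve b \<noteq> 0" and \<gamma>: "\<And>i. i \<notin> S \<Longrightarrow> \<gamma> i = 0"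
    and h: "ranalytic h b" "depends_on (insert n S) h"
    and h_eq: "\<forall>\<^sub>F x in nhds b. h x = (\<Sum>i\<in>I. mon b (\<alpha> i) x * v i x * (x $ n - b $ n) ^ i) + (x $ n - b $ n) ^ d * u x"
    and v: "\<And>i. i \<in> I \<Longrightarrow> ranalytic (v i) b" "\<And>i. i \<in> I \<Longrightarrow> v i b \<noteq> 0" "\<And>i. i \<in> I \<Longrightarrow> depends_on S (v i)"
    and \<alpha>S: "\<And>i j. i \<in> I \<Longrightarrow> j \<notin> S \<Longrightarrow> \<alpha> i j = 0"
    and min: "\<And>i j. i \<in> I \<Longrightarrow> \<alpha> i0 j * (fact d div (d - i0)) \<le> \<alpha> i j * (fact d div (d - i))"
    and u: "ranalytic u b" "u b \<noteq> 0" "depends_on (insert n S) u"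
  shows "uniformizable (insert n S) (\<lambda>x. e x * h x) b"
proof -
  let ?T = "insert n S"
  have finI: "finite I"
    using I finite_subset by blast
  have id: "i < d - 1" if "i \<in> I" for i
    using I that by auto
  have d: "d \<ge> 2"
    using id[OF i0] by simp
  \<comment> \<open>For \<open>i\<close> in \<open>I\<close> the number \<open>d - i\<close> lies
    between 2 and \<open>d\<close> and therefore divides \<open>m\<close>.\<close>
  define m where "m = (fact d :: nat)"
  have m: "m \<ge> 1"
    by (simp add: m_def)
  have mdiv: "m = (d - i) * (m div (d - i))" if "i \<in> I" for i
  proof -
    have "d - i dvd m"
      unfolding m_def using id[OF that] by (intro dvd_fact) auto
    then show ?thesis
      by simp
  qed
  \<comment> \<open>Here \<open>d \<ge> 2\<close>, so \<open>m\<close> is even and a power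
    substitution reaches only one side of each hyperplane; one chart is used for every choice of
    signs.\<close>
  define sg :: "bool \<Rightarrow> real" where "sg \<sigma> = (if \<sigma> then 1 else -1)" for \<sigma>
  have sg: "\<bar>sg \<sigma>\<bar> = 1" "sg \<sigma> \<noteq> 0" for \<sigma>
    by (auto simp: sg_def)
  define p :: "('k \<Rightarrow> bool) \<Rightarrow> real ^ 'k \<Rightarrow> real ^ 'k"
    where "p \<sigma> x = (\<chi> k. if k \<in> S then b $ k + sg (\<sigma> k) * (x $ k - b $ k) ^ m else x $ k)" for \<sigma> x
  define \<kappa> where "\<kappa> \<sigma> \<delta> = (\<Prod>k\<in>UNIV. sg (\<sigma> k) ^ \<delta> k)" for \<sigma> and \<delta> :: "'k \<Rightarrow> nat"
  have \<kappa>: "\<kappa> \<sigma> \<delta> \<noteq> 0" for \<sigma> \<delta>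
    using sg by (simp add: \<kappa>_def)
  have mon_p: "mon b \<delta> (p \<sigma> x) = \<kappa> \<sigma> \<delta> * mon b (\<lambda>k. m * \<delta> k) x" if "\<And>k. k \<notin> S \<Longrightarrow> \<delta> k = 0" for \<delta> \<sigma> x
  proof -
    have "mon b \<delta> (p \<sigma> x) = (\<Prod>k\<in>UNIV. sg (\<sigma> k) ^ \<delta> k * (x $ k - b $ k) ^ (m * \<delta> k))"
      unfolding mon_def
    proof (rule prod.cong)
      fix k :: 'k
      show "(p \<sigma> x $ k - b $ k) ^ \<delta> k = sg (\<sigma> k) ^ \<delta> k * (x $ k - b $ k) ^ (m * \<delta> k)"
        by (cases "k \<in> S") (simp_all add: p_def power_mult_distrib power_mult that)
    qed simp
    then show ?thesis
      by (simp add: prod.distrib \<kappa>_def mon_def)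
  qed
  have pS: "amap S (p \<sigma>) x" for \<sigma> x
    unfolding amap_def
  proof (intro conjI ballI allI impI)
    show "depends_on S (\<lambda>x. p \<sigma> x $ i)" if "i \<in> S" for i
      using that by (auto simp: p_def depends_on_def)
    show "p \<sigma> x $ i = x $ i" if "i \<notin> S" for i x
      using that by (simp add: p_def)
    show "ranalytic (\<lambda>x. p \<sigma> x $ i) x" for i
      by (cases "i \<in> S") (auto simp: p_def intro!: ranalytic_add ranalytic_mult ranalytic_power ranalytic_diff)
  qed
  have pT: "amap ?T (p \<sigma>) x" for \<sigma> x
    by (rule amap_mono[OF pS]) blast
  obtain \<delta> where \<delta>: "next_radius n d u b \<delta>"
    using next_radius_exists[OF u(1,2), of d n] d by auto
  have \<delta>0: "\<delta> > 0"
    using \<delta> by (simp add: next_radius_def)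
  have "\<forall>\<^sub>F y in nhds b. (\<forall>\<^sub>F x in nhds y. e x = mon b \<gamma> x * ve x) \<and>
      (\<forall>\<^sub>F x in nhds y. h x = (\<Sum>i\<in>I. mon b (\<alpha> i) x * v i x * (x $ n - b $ n) ^ i) + (x $ n - b $ n) ^ d * u x) \<and>
      ranalytic e y \<and> ranalytic h y \<and> ranalytic ve y \<and> ve y \<noteq> 0 \<and> (\<forall>i\<in>I. ranalytic (v i) y \<and> v i y \<noteq> 0) \<and> ranalytic u y \<and> u y \<noteq> 0 \<and> dist y b < \<delta>"
  proof (intro eventually_conj)
    show "\<forall>\<^sub>F y in nhds b. \<forall>i\<in>I. ranalytic (v i) y \<and> v i y \<noteq> 0"
      using ranalytic_eventually[OF v(1)] tendsto_imp_eventually_ne[OF ranalytic_tendsto[OF v(1)] v(2)]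
      by (intro eventually_ball_finite[OF finI] ballI eventually_conj)
    show "\<forall>\<^sub>F y in nhds b. dist y b < \<delta>"
      unfolding eventually_nhds_metric using \<delta>0 by blast
  qed (use e_eq h_eq ranalytic_eventually[OF e(1)] ranalytic_eventually[OF h(1)] ranalytic_eventually[OF ve(1)] ranalytic_eventually[OF u(1)]
      tendsto_imp_eventually_ne[OF ranalytic_tendsto[OF ve(1)] ve(2)]
      tendsto_imp_eventually_ne[OF ranalytic_tendsto[OF u(1)] u(2)] in \<open>simp_all only: eventually_eventually\<close>)
  then obtain \<epsilon>3 where \<epsilon>3: "\<epsilon>3 > 0" and near: "\<And>y. y \<in> box_around b (\<lambda>_. \<epsilon>3) \<Longrightarrow>
      (\<forall>\<^sub>F x in nhds y. e x = mon b \<gamma> x * ve x) \<and>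
      (\<forall>\<^sub>F x in nhds y. h x = (\<Sum>i\<in>I. mon b (\<alpha> i) x * v i x * (x $ n - b $ n) ^ i) + (x $ n - b $ n) ^ d * u x) \<and>
      ranalytic e y \<and> ranalytic h y \<and> ranalytic ve y \<and> ve y \<noteq> 0 \<and> (\<forall>i\<in>I. ranalytic (v i) y \<and> v i y \<noteq> 0) \<and> ranalytic u y \<and> u y \<noteq> 0 \<and> dist y b < \<delta>"
    by (rule obtain_box_around) blast
  define \<epsilon> where "\<epsilon> = min \<epsilon>3 1"
  have \<epsilon>: "\<epsilon> > 0" "\<epsilon> \<le> 1" "\<epsilon> \<le> \<epsilon>3"
    using \<epsilon>3 by (auto simp: \<epsilon>_def)
  have chart: "uniformizable ?T (\<lambda>x. e (p \<sigma> x) * h (p \<sigma> x)) x" if x: "x \<in> box_around b (\<lambda>_. \<epsilon>)" for \<sigma> x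
  proof -
    have "p \<sigma> x \<in> box_around b (\<lambda>_. \<epsilon>3)"
    proof -
      have "\<bar>p \<sigma> x $ j - b $ j\<bar> \<le> \<epsilon>3" for j
      proof -
        have xj: "\<bar>x $ j - b $ j\<bar> \<le> \<epsilon>"
          using x by (simp add: box_around_def)
        show ?thesis
        proof (cases "j \<in> S")
          case True
          have "\<bar>x $ j - b $ j\<bar> ^ m \<le> \<bar>x $ j - b $ j\<bar> ^ 1"
            using xj \<epsilon> m by (intro power_decreasing) auto
          then show ?thesis
            using True xj \<epsilon> by (simp add: p_def abs_mult sg power_abs)
        next
          case False
          then show ?thesis
            using xj \<epsilon> by (simp add: p_def)
        qed
      qed
      then show ?thesis
        by (simp add: box_around_def)
    qed
    note nr = near[OF this]
    have pn: "p \<sigma> z $ n = z $ n" for z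
      using n by (simp add: p_def)
    have an: "ranalytic (\<lambda>z. f (p \<sigma> z)) x" if "ranalytic f (p \<sigma> x)" for f
      by (rule amap_ranalytic[OF pS that])
    have e': "ranalytic (\<lambda>z. e (p \<sigma> z)) x" "depends_on S (\<lambda>z. e (p \<sigma> z))"
      using an[of e] nr amap_depends_on[OF pS e(2)] by auto
    have h': "ranalytic (\<lambda>z. h (p \<sigma> z)) x" "depends_on ?T (\<lambda>z. h (p \<sigma> z))"
      using an[of h] nr amap_depends_on[OF pT h(2)] by auto
    have u': "ranalytic (\<lambda>z. u (p \<sigma> z)) x" "u (p \<sigma> x) \<noteq> 0" "depends_on ?T (\<lambda>z. u (p \<sigma> z))"
      using an[of u] nr amap_depends_on[OF pT u(3)] by auto
    have e'_eq: "\<forall>\<^sub>F z in nhds x. e (p \<sigma> z) = mon b (\<lambda>k. m * \<gamma> k) z * (\<kappa> \<sigma> \<gamma> * ve (p \<sigma> z))"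
    proof -
      have "\<forall>\<^sub>F z in nhds x. e (p \<sigma> z) = mon b \<gamma> (p \<sigma> z) * ve (p \<sigma> z)"
        using amap_eventually_comp[OF pS[of \<sigma> x], of "\<lambda>z. e z = mon b \<gamma> z * ve z"] nr by blast
      then show ?thesis
        by eventually_elim (simp add: mon_p[OF \<gamma>] mult_ac)
    qed
    have ve': "ranalytic (\<lambda>z. \<kappa> \<sigma> \<gamma> * ve (p \<sigma> z)) x" "\<kappa> \<sigma> \<gamma> * ve (p \<sigma> x) \<noteq> 0"
      using an[of ve] nr \<kappa> by auto
    have v': "ranalytic (\<lambda>z. \<kappa> \<sigma> (\<alpha> i) * v i (p \<sigma> z)) x" "\<kappa> \<sigma> (\<alpha> i) * v i (p \<sigma> x) \<noteq> 0"
        "depends_on S (\<lambda>z. \<kappa> \<sigma> (\<alpha> i) * v i (p \<sigma> z))" if "i \<in> I" for i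
      using an[of "v i"] nr \<kappa> that depends_on_mult[OF depends_on_const amap_depends_on[OF pS v(3)[OF that]]] by auto
    have h'_eq: "\<forall>\<^sub>F z in nhds x. h (p \<sigma> z) = (\<Sum>i\<in>I. mon b (\<lambda>k. m * \<alpha> i k) z * (\<kappa> \<sigma> (\<alpha> i) * v i (p \<sigma> z)) * (z $ n - b $ n) ^ i) +
        (z $ n - b $ n) ^ d * u (p \<sigma> z)"
    proof -
      have "\<forall>\<^sub>F z in nhds x. h (p \<sigma> z) = (\<Sum>i\<in>I. mon b (\<alpha> i) (p \<sigma> z) * v i (p \<sigma> z) * (p \<sigma> z $ n - b $ n) ^ i) + (p \<sigma> z $ n - b $ n) ^ d * u (p \<sigma> z)"
        using amap_eventually_comp[OF pS[of \<sigma> x], of "\<lambda>z. h z = (\<Sum>i\<in>I. mon b (\<alpha> i) z * v i z * (z $ n - b $ n) ^ i) + (z $ n - b $ n) ^ d * u z"] nr by blast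
      then show ?thesis
      proof eventually_elim
        case (elim z)
        have "mon b (\<alpha> i) (p \<sigma> z) * v i (p \<sigma> z) * (z $ n - b $ n) ^ i =
            mon b (\<lambda>k. m * \<alpha> i k) z * (\<kappa> \<sigma> (\<alpha> i) * v i (p \<sigma> z)) * (z $ n - b $ n) ^ i" if "i \<in> I" for i
          using mon_p[of "\<alpha> i" \<sigma> z] \<alpha>S[OF that] by (simp add: mult_ac)
        then have "(\<Sum>i\<in>I. mon b (\<alpha> i) (p \<sigma> z) * v i (p \<sigma> z) * (z $ n - b $ n) ^ i) =
            (\<Sum>i\<in>I. mon b (\<lambda>k. m * \<alpha> i k) z * (\<kappa> \<sigma> (\<alpha> i) * v i (p \<sigma> z)) * (z $ n - b $ n) ^ i)"
          by (rule sum.cong[OF refl])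
        then show ?case
          unfolding elim pn by simp
      qed
    qed
    show ?thesis
    proof (cases "x $ n = b $ n")
      case True
      \<comment> \<open>The smallest slope after the substitution: the exponents have become
        \<open>m * \<alpha> i\<close>, and \<open>m\<close> is a multiple of
        \<open>d - i0\<close>.\<close>
      define \<beta> where "\<beta> k = (m div (d - i0)) * \<alpha> i0 k" for k
      have mi: "m * \<alpha> i j = (d - i) * (\<alpha> i j * (m div (d - i)))" if "i \<in> I" for i j
        using mdiv[OF that] by (metis mult.assoc mult.commute)
      have \<alpha>\<beta>: "(d - i) * \<beta> j \<le> m * \<alpha> i j" if "i \<in> I" for i j
        unfolding mi[OF that] \<beta>_def using min[OF that, of j] by (intro mult_le_mono2) (simp add: m_def mult.commute)
      have \<alpha>0: "m * \<alpha> i0 j = (d - i0) * \<beta> j" for j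
        unfolding mi[OF i0] \<beta>_def by simp
      have S0: "m * \<gamma> i = 0" if "i \<notin> S" for i
        using \<gamma>[OF that] by simp
      have S1: "m * \<alpha> i j = 0" if "i \<in> I" "j \<notin> S" for i j
        using \<alpha>S[OF that] by simp
      show ?thesis
        by (rule blow_up[OF n low I i0 True e' e'_eq ve' S0 h' h'_eq v' S1 \<alpha>\<beta> \<alpha>0 u'])
    next
      case False
      have "dist (p \<sigma> x) b < \<delta>"
        using nr by blast
      moreover have "\<bar>x $ n - b $ n\<bar> < \<delta>"
        using dist_vec_nth_le[of "p \<sigma> x" n b] calculation by (simp add: pn dist_real_def)
      ultimately have "ordn n (d - 1) (\<lambda>z. h (p \<sigma> z)) x"
        using h'_eq I v'(3) \<alpha>S n pS False
        by (intro ordn_off_center[OF \<delta>, where \<psi> = "p \<sigma>" and b = b and I = I and S = S and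
              g = "\<lambda>i z. mon b (\<lambda>k. m * \<alpha> i k) z * (\<kappa> \<sigma> (\<alpha> i) * v i (p \<sigma> z))"]) (auto intro!: depends_on_mult[OF depends_on_mon])
      moreover have "normal_crossing (\<lambda>z. e (p \<sigma> z)) x"
        by (rule normal_crossingI[OF ve' e'_eq])
      then have "\<not> (\<forall>\<^sub>F z in nhds x. e (p \<sigma> z) = 0)"
        by (rule normal_crossing_nonzero_germ)
      ultimately show ?thesis
        using d by (intro unif_orderD[OF low e' _ h']) auto
    qed
  qed
  show ?thesis
  proof (rule uniformizable_cover[where P = "range (\<lambda>\<sigma>. (p \<sigma>, box_around b (\<lambda>_. \<epsilon>)))"])
    show "finite (range (\<lambda>\<sigma>. (p \<sigma>, box_around b (\<lambda>_. \<epsilon>))))"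
      by (intro finite_imageI finite)
    show "amap ?T \<pi> x \<and> uniformizable ?T (\<lambda>x. e (\<pi> x) * h (\<pi> x)) x"
      if "(\<pi>, K) \<in> range (\<lambda>\<sigma>. (p \<sigma>, box_around b (\<lambda>_. \<epsilon>)))" "x \<in> K" for \<pi> K x
      using that chart pT by auto
    show "compact K" if "(\<pi>, K) \<in> range (\<lambda>\<sigma>. (p \<sigma>, box_around b (\<lambda>_. \<epsilon>)))" for \<pi> K
      using that compact_box_around by auto
    \<comment> \<open>Preimages are \<open>m\<close>-th roots in the coordinates of
      \<open>S\<close>, hence at most \<open>\<epsilon>\<close>; in the other coordinates
      \<open>\<epsilon> \<le> 1\<close> gives the same bound.\<close>
    have "\<forall>\<^sub>F x in nhds b. x \<in> box_around b (\<lambda>_. \<epsilon> ^ m)"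
      by (rule eventually_box_around) (use \<epsilon> in auto)
    then show "\<forall>\<^sub>F x in nhds b. \<exists>(\<pi>, K)\<in>range (\<lambda>\<sigma>. (p \<sigma>, box_around b (\<lambda>_. \<epsilon>))). x \<in> \<pi> ` K"
    proof eventually_elim
      case (elim x)
      define \<sigma> where "\<sigma> k = (x $ k \<ge> b $ k)" for k
      define z where "z = (\<chi> k. if k \<in> S then b $ k + root m \<bar>x $ k - b $ k\<bar> else x $ k)"
      have xk: "\<bar>x $ k - b $ k\<bar> \<le> \<epsilon> ^ m" for k
        using elim by (simp add: box_around_def)
      have "\<bar>z $ k - b $ k\<bar> \<le> \<epsilon>" for k
      proof (cases "k \<in> S")
        case True
        have "root m \<bar>x $ k - b $ k\<bar> \<le> root m (\<epsilon> ^ m)"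
          using m xk by (intro real_root_le_mono) auto
        also have "\<dots> = \<epsilon>"
          using m \<epsilon> by (intro real_root_power_cancel) auto
        finally show ?thesis
          using True m by (simp add: z_def real_root_ge_zero)
      next
        case False
        have "\<epsilon> ^ m \<le> \<epsilon> ^ 1"
          using \<epsilon> m by (intro power_decreasing) auto
        then show ?thesis
          using False xk[of k] by (simp add: z_def)
      qed
      then have "z \<in> box_around b (\<lambda>_. \<epsilon>)"
        by (simp add: box_around_def)
      moreover have "p \<sigma> z $ k = x $ k" for k
      proof (cases "k \<in> S")
        case True
        have "root m \<bar>x $ k - b $ k\<bar> ^ m = \<bar>x $ k - b $ k\<bar>"
          using m by (intro real_root_pow_pos2) auto
        then show ?thesis
          using True by (auto simp: p_def z_def \<sigma>_def sg_def)
      next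
        case False
        then show ?thesis
          by (simp add: p_def z_def)
      qed
      then have "x = p \<sigma> z"
        by (simp add: vec_eq_iff)
      ultimately show ?case
        by auto
    qed
  qed
qed

section \<open>Uniformization\<close>

text \<open>The differences of powers of coefficients are included in the product that is brought to normal
  crossings because then the slopes of the Newton polygon become totally ordered (\<open>normal_crossing_comparable\<close>).\<close>
lemma uniformize_central:
  fixes n :: "'k::finite"
  assumes n: "n \<notin> S" and low: "\<And>d'. d' < d \<Longrightarrow> unif_order n S d'"
    and N: "\<And>f a. ranalytic f a \<Longrightarrow> depends_on S f \<Longrightarrow> \<not> (\<forall>\<^sub>F x in nhds a. f x = 0) \<Longrightarrow> uniformizable S f a"
    and d: "d \<ge> 1"
    and e: "ranalytic e a" "depends_on S e" "\<not> (\<forall>\<^sub>F x in nhds a. e x = 0)"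
    and h: "ranalytic h a" "depends_on (insert n S) h"
    and h_eq: "\<forall>\<^sub>F x in nhds a. h x = (\<Sum>i<d. c i x * (x $ n - a $ n) ^ i) + (x $ n - a $ n) ^ d * u x"
    and c: "\<And>i. ranalytic (c i) a" "\<And>i. depends_on S (c i)" and c0: "\<forall>\<^sub>F x in nhds a. c (d - 1) x = 0"
    and u: "ranalytic u a" "u a \<noteq> 0" "depends_on (insert n S) u"
  shows "uniformizable (insert n S) (\<lambda>x. e x * h x) a"
proof -
  let ?T = "insert n S"
  define m where "m = (fact d :: nat)"
  \<comment> \<open>Coefficients with zero germ are dropped, because they can never become normal
    crossings and would make the product below vanish.\<close>
  define I where "I = {i. i < d - 1 \<and> \<not> (\<forall>\<^sub>F x in nhds a. c i x = 0)}"
  have I: "I \<subseteq> {..<d - 1}" and finI: "finite I"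
    by (auto simp: I_def)
  have "\<forall>\<^sub>F x in nhds a. \<forall>i\<in>{..<d} - I. c i x = 0"
  proof (intro eventually_ball_finite ballI)
    fix i assume i: "i \<in> {..<d} - I"
    show "\<forall>\<^sub>F x in nhds a. c i x = 0"
    proof (cases "i = d - 1")
      case True
      then show ?thesis
        using c0 by simp
    next
      case False
      then have "i < d - 1"
        using i by auto
      then show ?thesis
        using i by (simp add: I_def)
    qed
  qed simp
  with h_eq have h_eq': "\<forall>\<^sub>F x in nhds a. h x = (\<Sum>i\<in>I. c i x * (x $ n - a $ n) ^ i) + (x $ n - a $ n) ^ d * u x"
  proof eventually_elim
    case (elim x)
    have "(\<Sum>i<d. c i x * (x $ n - a $ n) ^ i) = (\<Sum>i\<in>I. c i x * (x $ n - a $ n) ^ i)"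
      by (rule sum.mono_neutral_right) (use elim(2) I in auto)
    then show ?case
      using elim(1) by simp
  qed
  \<comment> \<open>Raising coefficient \<open>i\<close> to the power \<open>m div (d - i)\<close>
    multiplies its exponents so that they become \<open>m\<close> times its slopes; a difference of
    two such powers thus compares two slopes within the integers.\<close>
  define D where "D p x = c (fst p) x ^ (m div (d - fst p)) - c (snd p) x ^ (m div (d - snd p))" for p x
  define J where "J = {p \<in> I \<times> I. \<not> (\<forall>\<^sub>F x in nhds a. D p x = 0)}"
  have finJ: "finite J"
    using finI by (simp add: J_def)
  have Dan: "ranalytic (D p) x" if "ranalytic (c (fst p)) x" "ranalytic (c (snd p)) x" for p x
    unfolding D_def using that by (intro ranalytic_diff ranalytic_power)
  have Ddep: "depends_on S (D p)" for p
    unfolding D_def by (intro depends_on_diff depends_on_power c(2))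
  define C1 where "C1 x = (\<Prod>i\<in>I. c i x)" for x
  define C2 where "C2 x = (\<Prod>p\<in>J. D p x)" for x
  have C1: "ranalytic C1 a" "depends_on S C1" "\<not> (\<forall>\<^sub>F x in nhds a. C1 x = 0)"
  proof -
    show "ranalytic C1 a" "depends_on S C1"
      unfolding C1_def[abs_def] by (rule ranalytic_prod, rule c) (rule depends_on_prod, rule c)
    show "\<not> (\<forall>\<^sub>F x in nhds a. C1 x = 0)"
      unfolding C1_def by (rule ranalytic_zero_prod_all[OF finI c(1)]) (simp add: I_def)
  qed
  have C2: "ranalytic C2 a" "depends_on S C2" "\<not> (\<forall>\<^sub>F x in nhds a. C2 x = 0)"
  proof -
    show "ranalytic C2 a" "depends_on S C2"
      unfolding C2_def[abs_def] by (rule ranalytic_prod, rule Dan[OF c(1) c(1)]) (rule depends_on_prod, rule Ddep)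
    show "\<not> (\<forall>\<^sub>F x in nhds a. C2 x = 0)"
      unfolding C2_def by (rule ranalytic_zero_prod_all[OF finJ Dan[OF c(1) c(1)]]) (simp add: J_def)
  qed
  have C12: "ranalytic (\<lambda>x. C1 x * C2 x) a" "depends_on S (\<lambda>x. C1 x * C2 x)" "\<not> (\<forall>\<^sub>F x in nhds a. C1 x * C2 x = 0)"
  proof -
    show "ranalytic (\<lambda>x. C1 x * C2 x) a" "depends_on S (\<lambda>x. C1 x * C2 x)"
      by (rule ranalytic_mult[OF C1(1) C2(1)]) (rule depends_on_mult[OF C1(2) C2(2)])
    show "\<not> (\<forall>\<^sub>F x in nhds a. C1 x * C2 x = 0)"
      using C1(3) C2(3) ranalytic_zero_prod[OF C1(1) C2(1)] by blast
  qed
  \<comment> \<open>One application to the whole product yields charts in which \<open>e\<close>,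
    all coefficients and all nonzero differences have normal crossings simultaneously.\<close>
  have "uniformizable S (\<lambda>x. e x * (C1 x * C2 x)) a"
  proof (rule N)
    show "ranalytic (\<lambda>x. e x * (C1 x * C2 x)) a"
      by (rule ranalytic_mult[OF e(1) C12(1)])
    show "depends_on S (\<lambda>x. e x * (C1 x * C2 x))"
      by (rule depends_on_mult[OF e(2) C12(2)])
    show "\<not> (\<forall>\<^sub>F x in nhds a. e x * (C1 x * C2 x) = 0)"
      using ranalytic_zero_prod[OF e(1) C12(1)] e(3) C12(3) by blast
  qed
  obtain \<delta> where \<delta>: "next_radius n d u a \<delta>"
    using next_radius_exists[OF u(1,2) d, of n] by blast
  define P where "P x \<longleftrightarrow> h x = (\<Sum>i\<in>I. c i x * (x $ n - a $ n) ^ i) + (x $ n - a $ n) ^ d * u x \<and>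
      (\<forall>p\<in>I \<times> I - J. D p x = 0) \<and> ranalytic e x \<and> ranalytic h x \<and> ranalytic u x \<and> u x \<noteq> 0 \<and> (\<forall>i\<in>I. ranalytic (c i) x) \<and> dist x a < \<delta>" for x
  have "\<forall>\<^sub>F x in nhds a. P x"
    unfolding P_def
  proof (intro eventually_conj)
    show "\<forall>\<^sub>F x in nhds a. \<forall>p\<in>I \<times> I - J. D p x = 0"
      using finI by (intro eventually_ball_finite ballI) (auto simp: J_def)
    show "\<forall>\<^sub>F x in nhds a. \<forall>i\<in>I. ranalytic (c i) x"
      using finI ranalytic_eventually[OF c(1)] by (intro eventually_ball_finite ballI) auto
    show "\<forall>\<^sub>F x in nhds a. dist x a < \<delta>"
      unfolding eventually_nhds_metric using \<delta> by (auto simp: next_radius_def)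
    show "\<forall>\<^sub>F x in nhds a. u x \<noteq> 0"
      using ranalytic_tendsto[OF u(1)] u(2) by (rule tendsto_imp_eventually_ne)
  qed (use h_eq' ranalytic_eventually[OF e(1)] ranalytic_eventually[OF h(1)] ranalytic_eventually[OF u(1)] in simp_all)
  then show ?thesis
  proof (rule uniformizable_transfer[OF \<open>uniformizable S (\<lambda>x. e x * (C1 x * C2 x)) a\<close> _ subset_insertI])
    fix \<psi> b assume \<psi>: "amap S \<psi> b" and Pev: "\<forall>\<^sub>F x in nhds (\<psi> b). P x"
      and normal_crossing: "normal_crossing (\<lambda>x. e (\<psi> x) * (C1 (\<psi> x) * C2 (\<psi> x))) b"
    have Pb: "P (\<psi> b)"
      by (rule eventually_nhds_x_imp_x[OF Pev])
    have P\<psi>: "\<forall>\<^sub>F x in nhds b. P (\<psi> x)"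
      by (rule amap_eventually_comp[OF \<psi> Pev])
    have \<psi>T: "amap ?T \<psi> b"
      by (rule amap_mono[OF \<psi>]) blast
    have \<psi>n: "\<psi> x $ n = x $ n" for x
      by (rule amap_outside[OF \<psi> n])
    have an: "ranalytic (\<lambda>x. f (\<psi> x)) b" if "ranalytic f (\<psi> b)" for f
      by (rule amap_ranalytic[OF \<psi> that])
    have e1: "ranalytic (\<lambda>x. e (\<psi> x)) b" "depends_on S (\<lambda>x. e (\<psi> x))"
      using Pb an[of e] amap_depends_on[OF \<psi> e(2)] by (auto simp: P_def)
    have h1: "ranalytic (\<lambda>x. h (\<psi> x)) b" "depends_on ?T (\<lambda>x. h (\<psi> x))"
      using Pb an[of h] amap_depends_on[OF \<psi>T h(2)] by (auto simp: P_def)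
    have u1: "ranalytic (\<lambda>x. u (\<psi> x)) b" "u (\<psi> b) \<noteq> 0" "depends_on ?T (\<lambda>x. u (\<psi> x))"
      using Pb an[of u] amap_depends_on[OF \<psi>T u(3)] by (auto simp: P_def)
    have c1: "ranalytic (\<lambda>x. c i (\<psi> x)) b" "depends_on S (\<lambda>x. c i (\<psi> x))" if "i \<in> I" for i
      using that Pb an[of "c i"] amap_depends_on[OF \<psi> c(2)] by (auto simp: P_def)
    have C1\<psi>: "ranalytic (\<lambda>x. C1 (\<psi> x)) b"
      unfolding C1_def by (intro ranalytic_prod c1)
    have D\<psi>: "ranalytic (\<lambda>x. D p (\<psi> x)) b" if "p \<in> I \<times> I" for p
      using that unfolding D_def by (intro ranalytic_diff ranalytic_power c1) auto
    have C2\<psi>: "ranalytic (\<lambda>x. C2 (\<psi> x)) b"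
      unfolding C2_def by (intro ranalytic_prod D\<psi>) (auto simp: J_def)
    have C12\<psi>: "ranalytic (\<lambda>x. C1 (\<psi> x) * C2 (\<psi> x)) b"
      by (rule ranalytic_mult[OF C1\<psi> C2\<psi>])
    have normal_crossing_e: "normal_crossing (\<lambda>x. e (\<psi> x)) b"
      by (rule normal_crossing_factor[OF e1(1) C12\<psi> normal_crossing])
    have normal_crossing_C12: "normal_crossing (\<lambda>x. C1 (\<psi> x) * C2 (\<psi> x)) b"
      by (rule normal_crossing_factor[OF C12\<psi> e1(1)]) (use normal_crossing in \<open>simp only: mult.commute\<close>)
    have normal_crossing_C1: "normal_crossing (\<lambda>x. \<Prod>i\<in>I. c i (\<psi> x)) b"
      using normal_crossing_factor[OF C1\<psi> C2\<psi> normal_crossing_C12] by (simp add: C1_def)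
    have normal_crossing_C2: "normal_crossing (\<lambda>x. \<Prod>p\<in>J. D p (\<psi> x)) b"
    proof -
      have "normal_crossing (\<lambda>x. C2 (\<psi> x) * C1 (\<psi> x)) b"
        using normal_crossing_C12 by (simp only: mult.commute)
      from normal_crossing_factor[OF C2\<psi> C1\<psi> this] show ?thesis
        by (simp add: C2_def)
    qed
    have normal_crossing_c: "normal_crossing (\<lambda>x. c i (\<psi> x)) b" if "i \<in> I" for i
      using normal_crossing_prod_factor[OF finI that, of "\<lambda>i x. c i (\<psi> x)" b] c1 normal_crossing_C1 by blast
    have normal_crossing_D: "normal_crossing (\<lambda>x. D p (\<psi> x)) b" if "p \<in> J" for p
      using normal_crossing_prod_factor[OF finJ that, of "\<lambda>p x. D p (\<psi> x)" b] D\<psi> normal_crossing_C2 unfolding J_def by blast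
    have h1_eq: "\<forall>\<^sub>F x in nhds b. h (\<psi> x) = (\<Sum>i\<in>I. c i (\<psi> x) * (x $ n - a $ n) ^ i) + (x $ n - a $ n) ^ d * u (\<psi> x)"
      using P\<psi> by (rule eventually_mono) (simp add: P_def \<psi>n)
    show "uniformizable ?T (\<lambda>x. e (\<psi> x) * h (\<psi> x)) b"
    proof (cases "b $ n = a $ n")
      case False
      have 1: "dist (\<psi> b) a < \<delta>"
        using Pb by (simp add: P_def)
      have "\<bar>b $ n - a $ n\<bar> < \<delta>"
        using dist_vec_nth_le[of "\<psi> b" n a] 1 by (simp add: \<psi>n dist_real_def)
      then have "ordn n (d - 1) (\<lambda>x. h (\<psi> x)) b"
        by (rule ordn_off_center[OF \<delta> 1 _ False I c1(2) n \<psi> h1_eq])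
      then show ?thesis
        using d by (intro unif_orderD[OF low e1 normal_crossing_nonzero_germ[OF normal_crossing_e] h1]) auto
    next
      case True
      obtain \<gamma> ve where \<gamma>: "\<And>i. i \<notin> S \<Longrightarrow> \<gamma> i = 0" and ve: "ranalytic ve b" "depends_on S ve" "ve b \<noteq> 0"
        and e1_eq: "\<forall>\<^sub>F x in nhds b. e (\<psi> x) = mon b \<gamma> x * ve x"
        by (rule normal_crossing_depends_on[OF normal_crossing_e e1(2)]) blast
      show ?thesis
      proof (cases "I = {}")
        case I0: True
        have "\<forall>\<^sub>F x in nhds b. e (\<psi> x) * h (\<psi> x) = mon b (\<lambda>i. \<gamma> i + (if i = n then d else 0)) x * (ve x * u (\<psi> x))"
          using e1_eq h1_eq by eventually_elim (simp add: I0 True mon_add mon_single)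
        then show ?thesis
          by (intro uniformizable_normal_crossing normal_crossingI[OF ranalytic_mult[OF ve(1) u1(1)]]) (use ve u1 in auto)
      next
        case I1: False
        have "\<forall>i\<in>I. \<exists>\<alpha> v. (\<forall>j. j \<notin> S \<longrightarrow> \<alpha> j = 0) \<and> ranalytic v b \<and> depends_on S v \<and> v b \<noteq> 0 \<and>
            (\<forall>\<^sub>F x in nhds b. c i (\<psi> x) = mon b \<alpha> x * v x)"
        proof
          fix i assume i: "i \<in> I"
          show "\<exists>\<alpha> v. (\<forall>j. j \<notin> S \<longrightarrow> \<alpha> j = 0) \<and> ranalytic v b \<and> depends_on S v \<and> v b \<noteq> 0 \<and>
            (\<forall>\<^sub>F x in nhds b. c i (\<psi> x) = mon b \<alpha> x * v x)"
            by (rule normal_crossing_depends_on[OF normal_crossing_c[OF i] c1(2)[OF i]]) blast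
        qed
        from bchoice[OF this] obtain \<alpha> where "\<forall>i\<in>I. \<exists>v. (\<forall>j. j \<notin> S \<longrightarrow> \<alpha> i j = 0) \<and> ranalytic v b \<and> depends_on S v \<and> v b \<noteq> 0 \<and>
            (\<forall>\<^sub>F x in nhds b. c i (\<psi> x) = mon b (\<alpha> i) x * v x)"
          by blast
        from bchoice[OF this] obtain v where \<alpha>v: "\<forall>i\<in>I. (\<forall>j. j \<notin> S \<longrightarrow> \<alpha> i j = 0) \<and> ranalytic (v i) b \<and> depends_on S (v i) \<and> v i b \<noteq> 0 \<and>
            (\<forall>\<^sub>F x in nhds b. c i (\<psi> x) = mon b (\<alpha> i) x * v i x)"
          by blast
        have \<alpha>S: "\<alpha> i j = 0" if "i \<in> I" "j \<notin> S" for i j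
          using \<alpha>v that by blast
        have v: "ranalytic (v i) b" "v i b \<noteq> 0" "depends_on S (v i)" if "i \<in> I" for i
          using \<alpha>v that by blast+
        have c_eq: "\<forall>\<^sub>F x in nhds b. c i (\<psi> x) = mon b (\<alpha> i) x * v i x" if "i \<in> I" for i
          using \<alpha>v that by blast
        define A where "A i j = \<alpha> i j * (m div (d - i))" for i j
        have comparable: "(\<forall>k. A i k \<le> A j k) \<or> (\<forall>k. A j k \<le> A i k)" if ij: "i \<in> I" "j \<in> I" for i j
        proof (rule normal_crossing_comparable)
          show "ranalytic (\<lambda>x. v i x ^ (m div (d - i))) b" "v i b ^ (m div (d - i)) \<noteq> 0"
            "ranalytic (\<lambda>x. v j x ^ (m div (d - j))) b" "v j b ^ (m div (d - j)) \<noteq> 0"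
            using v ij by (auto intro: ranalytic_power)
          have eq: "\<forall>\<^sub>F x in nhds b. mon b (A i) x * v i x ^ (m div (d - i)) - mon b (A j) x * v j x ^ (m div (d - j)) = D (i, j) (\<psi> x)"
            using c_eq[OF ij(1)] c_eq[OF ij(2)]
            by eventually_elim (simp add: D_def A_def[abs_def] power_mult_distrib mon_power)
          show "(\<forall>\<^sub>F x in nhds b. mon b (A i) x * v i x ^ (m div (d - i)) - mon b (A j) x * v j x ^ (m div (d - j)) = 0) \<or>
              normal_crossing (\<lambda>x. mon b (A i) x * v i x ^ (m div (d - i)) - mon b (A j) x * v j x ^ (m div (d - j))) b"
          proof (cases "(i, j) \<in> J")
            case True
            then show ?thesis
              using normal_crossing_cong[OF normal_crossing_D eq] by blast
          next
            case False
            have "\<forall>\<^sub>F x in nhds b. D (i, j) (\<psi> x) = 0"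
              using P\<psi> by (rule eventually_mono) (use False ij in \<open>auto simp: P_def\<close>)
            with eq have "\<forall>\<^sub>F x in nhds b. mon b (A i) x * v i x ^ (m div (d - i)) - mon b (A j) x * v j x ^ (m div (d - j)) = 0"
              by eventually_elim simp
            then show ?thesis ..
          qed
        qed
        obtain i1 where "i1 \<in> I"
          using I1 by blast
        \<comment> \<open>Slopes are pairwise comparable as vectors, so an index with the least
          coordinate sum is minimal in every coordinate.\<close>
        from ex_has_least_nat[of "\<lambda>i. i \<in> I", OF this, of "\<lambda>i. sum (A i) UNIV"]
        obtain i0 where i0: "i0 \<in> I" "\<And>i. i \<in> I \<Longrightarrow> sum (A i0) UNIV \<le> sum (A i) UNIV"
          by blast
        have min: "A i0 k \<le> A i k" if i: "i \<in> I" for i k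
        proof (rule ccontr)
          assume k: "\<not> ?thesis"
          then have "\<forall>k. A i k \<le> A i0 k"
            using comparable[OF i0(1) i] by blast
          then have "sum (A i) UNIV < sum (A i0) UNIV"
            using k by (intro sum_strict_mono_ex1) (auto simp: not_le)
          then show False
            using i0(2)[OF i] by simp
        qed
        have "\<forall>\<^sub>F x in nhds b. \<forall>i\<in>I. c i (\<psi> x) = mon b (\<alpha> i) x * v i x"
          using c_eq finI by (intro eventually_ball_finite ballI)
        with h1_eq have h1_eq': "\<forall>\<^sub>F x in nhds b. h (\<psi> x) =
            (\<Sum>i\<in>I. mon b (\<alpha> i) x * v i x * (x $ n - b $ n) ^ i) + (x $ n - b $ n) ^ d * u (\<psi> x)"
        proof eventually_elim
          case (elim x)
          have "(\<Sum>i\<in>I. c i (\<psi> x) * (x $ n - a $ n) ^ i) = (\<Sum>i\<in>I. mon b (\<alpha> i) x * v i x * (x $ n - a $ n) ^ i)"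
            by (rule sum.cong) (use elim(2) in auto)
          then show ?case
            unfolding elim(1) True by simp
        qed
        have min': "\<alpha> i0 j * (fact d div (d - i0)) \<le> \<alpha> i j * (fact d div (d - i))" if "i \<in> I" for i j
          using min[OF that, of j] by (simp add: A_def m_def)
        show ?thesis
          by (rule power_substitution[OF n low I i0(1) e1 e1_eq ve(1,3) \<gamma> h1 h1_eq' v \<alpha>S min' u1])
      qed
    qed
  qed
qed

text \<open>The Taylor coefficient of degree \<open>d\<close> depends continuously on the point, so
  it stays nonzero.\<close>

lemma ordn_eventually:
  assumes f: "ranalytic f a" and o: "ordn n d f a"
  shows "\<forall>\<^sub>F x in nhds a. ordn n d f x"
proof -
  obtain p where p: "has_tp (\<lambda>s. f (upd a n (a $ n + s))) d p" "coeff p d \<noteq> 0"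
    using o unfolding ordn_def by blast
  obtain T where T: "\<And>j. ranalytic (T j) a"
    "\<forall>\<^sub>F x in nhds a. has_tp (\<lambda>s. f (upd x n (x $ n + s))) d (\<Sum>j\<le>d. monom (T j x) j)"
    using ranalytic_taylor_ex[OF f, of n] by blast
  have co: "coeff (\<Sum>j\<le>d. monom (T j x) j) d = T d x" for x
    by (simp add: coeff_sum)
  have "T d a = coeff p d"
    using has_tp_unique[OF eventually_nhds_x_imp_x[OF T(2)] p(1), of d] by (simp add: co)
  then have "\<forall>\<^sub>F x in nhds a. T d x \<noteq> 0"
    using p(2) by (intro tendsto_imp_eventually_ne[OF ranalytic_tendsto[OF T(1)]]) simp
  with T(2) show ?thesis
    by eventually_elim (auto simp: ordn_def co intro: exI)
qed

text \<open>Strong induction on \<open>d\<close>. For \<open>d = 0\<close> the factor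
  \<open>h\<close> is a unit. A nonzero coefficient of degree \<open>d - 1\<close> means smaller
  order. If that coefficient vanishes at \<open>a\<close>, its derivative there is \<open>d\<close>
  times the nonzero coefficient of degree \<open>d\<close>, and its zero set gives the new
  center.\<close>

lemma unif_order_all:
  fixes n :: "'k::finite"
  assumes n: "n \<notin> S"
    and N: "\<And>f a. ranalytic f a \<Longrightarrow> depends_on S f \<Longrightarrow> \<not> (\<forall>\<^sub>F x in nhds a. f x = 0) \<Longrightarrow> uniformizable S f a"
  shows "unif_order n S d"
proof (induction d rule: less_induct)
  case (less d)
  let ?T = "insert n S"
  show ?case
    unfolding unif_order_def
  proof (intro allI impI)
    fix e h :: "real ^ 'k \<Rightarrow> real" and a
    assume e: "ranalytic e a" "depends_on S e" "\<not> (\<forall>\<^sub>F x in nhds a. e x = 0)" and h: "ranalytic h a" "depends_on ?T h" and o: "ordn n d h a"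
    obtain p where p: "has_tp (\<lambda>s. h (upd a n (a $ n + s))) d p" "coeff p d \<noteq> 0"
      using o unfolding ordn_def by blast
    show "uniformizable ?T (\<lambda>x. e x * h x) a"
    proof (cases "d = 0")
      case True
      have "h a = coeff p 0"
        using has_tp_unique[OF has_tp_ranalytic0[OF h(1), of n], of p 0] p True by simp
      then have ha: "h a \<noteq> 0"
        using p(2) True by simp
      have "\<forall>\<^sub>F x in nhds a. ranalytic h x \<and> h x \<noteq> 0"
        using ranalytic_eventually[OF h(1)] tendsto_imp_eventually_ne[OF ranalytic_tendsto[OF h(1)] ha]
        by (rule eventually_conj)
      then show ?thesis
      proof (rule uniformizable_transfer[OF N[OF e] _ subset_insertI])
        fix \<psi> b assume \<psi>: "amap S \<psi> b" "\<forall>\<^sub>F x in nhds (\<psi> b). ranalytic h x \<and> h x \<noteq> 0" "normal_crossing (\<lambda>x. e (\<psi> x)) b"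
        have "ranalytic h (\<psi> b)" "h (\<psi> b) \<noteq> 0"
          using eventually_nhds_x_imp_x[OF \<psi>(2)] by auto
        then show "uniformizable ?T (\<lambda>x. e (\<psi> x) * h (\<psi> x)) b"
          by (intro uniformizable_normal_crossing normal_crossing_mult_unit[OF \<psi>(3)] amap_ranalytic[OF \<psi>(1)])
      qed
    next
      case False
      then have d: "d \<ge> 1"
        by simp
      obtain T where T: "\<And>j. ranalytic (T j) a"
        "\<And>m. \<forall>\<^sub>F x in nhds a. has_tp (\<lambda>s. h (upd x n (x $ n + s))) m (\<Sum>j\<le>m. monom (T j x) j)"
        "\<And>j. \<forall>\<^sub>F x in nhds a. has_tp (\<lambda>s. T j (upd x n (x $ n + s))) 1 [:T j x, of_nat (Suc j) * T (Suc j) x:]"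
        using ranalytic_taylor_ex[OF h(1), of n] by blast
      have coT: "coeff (\<Sum>j\<le>m. monom (T j x) j) i = T i x" if "i \<le> m" for i m x
        using that by (simp add: coeff_sum)
      have Ta: "T i a = coeff p i" if "i \<le> d" for i
        using has_tp_unique[OF eventually_nhds_x_imp_x[OF T(2)] p(1) that] that by (simp add: coT)
      show ?thesis
      proof (cases "T (d - 1) a = 0")
        case False
        have "ordn n (d - 1) h a"
          unfolding ordn_def
          by (rule exI, rule conjI, rule eventually_nhds_x_imp_x[OF T(2)[of "d - 1"]]) (use False in \<open>simp add: coT\<close>)
        then show ?thesis
          using d by (intro unif_orderD[OF less.IH e h]) auto
      next
        case True
        have Sd: "Suc (d - 1) = d"
          using d by simp
        have "coeff [:T (d - 1) a, of_nat d * T d a:] 1 \<noteq> 0"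
          using Ta[of d] p(2) d by simp
        from ranalytic_implicit[OF T(1) True eventually_nhds_x_imp_x[OF T(3)[of "d - 1"]], unfolded Sd, OF this]
        \<comment> \<open>Tschirnhausen: recentering \<open>x $ n\<close> at the zero of the derivative of order \<open>d - 1\<close> kills \<open>c (d - 1)\<close>\<close>
        obtain \<phi>0 where \<phi>0: "ranalytic \<phi>0 a" "\<phi>0 a = a $ n" "\<forall>\<^sub>F x in nhds a. T (d - 1) (upd x n (\<phi>0 x)) = 0" .
        \<comment> \<open>The implicit function may involve any coordinate. Freezing all but
          \<open>S\<close> makes the translation by it along \<open>n\<close> a map with the obvious
          inverse \<open>\<rho>\<close>.\<close>
        define \<phi> where "\<phi> x = \<phi>0 (proj S a x)" for x
        have \<phi>: "ranalytic \<phi> a" "depends_on S \<phi>" "\<phi> a = a $ n"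
          unfolding \<phi>_def using \<phi>0 by (auto intro: ranalytic_proj depends_on_comp_proj)
        define y where "y x = upd (proj S a x) n (\<phi> x)" for x
        have y_tendsto: "(y \<longlongrightarrow> a) (nhds a)"
        proof -
          have "filterlim (proj S a) (nhds a) (nhds a)"
            using eventually_proj[where S = S] by (auto simp: filterlim_iff)
          then have "(y \<longlongrightarrow> upd a n (\<phi> a)) (nhds a)"
            unfolding y_def by (intro tendsto_upd ranalytic_tendsto[OF \<phi>(1)])
          then show ?thesis
            by (simp add: \<phi>(3))
        qed
        have "\<forall>\<^sub>F x in nhds a. T (d - 1) (y x) = 0"
          using eventually_proj[OF \<phi>0(3), of S] by (simp add: y_def \<phi>_def)
        moreover have "\<forall>\<^sub>F x in nhds a. has_tp (\<lambda>s. h (upd (y x) n (y x $ n + s))) (d - 1) (\<Sum>j\<le>d - 1. monom (T j (y x)) j)"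
          by (rule eventually_compose_filterlim[OF T(2) y_tendsto])
        ultimately have crit: "\<forall>\<^sub>F x in nhds a. \<exists>q. has_tp (\<lambda>s. h (upd x n (\<phi> x + s))) (d - 1) q \<and> coeff q (d - 1) = 0"
        proof eventually_elim
          case (elim x)
          have "h (upd (y x) n (y x $ n + s)) = h (upd x n (\<phi> x + s))" for s
            by (rule depends_onD[OF h(2)]) (auto simp: y_def)
          then show ?case
            using elim coT[of "d - 1" "d - 1" "y x"] by (intro exI[of _ "\<Sum>j\<le>d - 1. monom (T j (y x)) j"]) simp
        qed
        define \<pi> where "\<pi> x = upd x n (x $ n + (\<phi> x - a $ n))" for x
        define \<rho> where "\<rho> x = upd x n (x $ n - (\<phi> x - a $ n))" for x
        have \<pi>a: "\<pi> a = a"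
          by (simp add: \<pi>_def \<phi>(3))
        have \<pi>: "amap ?T \<pi> x" if "ranalytic \<phi> x" for x
          unfolding \<pi>_def[abs_def]
          by (intro amap_upd ranalytic_add ranalytic_diff ranalytic_coord ranalytic_const that depends_on_add depends_on_diff depends_on_const
              depends_on_coord depends_on_mono[OF \<phi>(2)]) auto
        have \<pi>\<rho>: "\<pi> (\<rho> x) = x" for x
          using depends_on_upd[OF \<phi>(2) n] by (simp add: \<pi>_def \<rho>_def)
        have \<rho>: "(\<rho> \<longlongrightarrow> a) (nhds a)"
        proof -
          have "(\<rho> \<longlongrightarrow> upd a n (a $ n - (\<phi> a - a $ n))) (nhds a)"
            unfolding \<rho>_def
            by (intro tendsto_upd tendsto_diff tendsto_const ranalytic_tendsto[OF \<phi>(1)] tendsto_vec_nth)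
               (simp_all add: tendsto_nhds_iff)
          then show ?thesis
            by (simp add: \<phi>(3))
        qed
        define h1 where "h1 x = h (\<pi> x)" for x
        have h1: "ranalytic h1 a" "depends_on ?T h1"
          unfolding h1_def using amap_ranalytic[OF \<pi>[OF \<phi>(1)], of h] h amap_depends_on[OF \<pi>[OF \<phi>(1)] h(2)] by (auto simp: \<pi>a)
        obtain c u where c: "\<And>i. ranalytic (c i) a" "\<And>i. depends_on S (c i)" and u: "ranalytic u a" "depends_on ?T u"
          and h1_eq: "\<forall>\<^sub>F x in nhds a. h1 x = (\<Sum>i<d. c i x * (x $ n - a $ n) ^ i) + (x $ n - a $ n) ^ d * u x"
          by (rule taylor_division_depends_on[OF h1, of d]) blast
        have c_upd: "c i (upd x n t) = c i x" for i x t
          by (rule depends_on_upd[OF c(2) n])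
        have h1_line: "h1 (upd x n (a $ n + s)) = h (upd x n (\<phi> x + s))" for x s
          using depends_on_upd[OF \<phi>(2) n] by (simp add: h1_def \<pi>_def add.commute)
        have ev0: "\<forall>\<^sub>F x in nhds a. (\<forall>\<^sub>F z in nhds (upd x n (a $ n)). h1 z = (\<Sum>i<d. c i z * (z $ n - a $ n) ^ i) + (z $ n - a $ n) ^ d * u z) \<and> ranalytic u (upd x n (a $ n))"
          by (rule eventually_upd) (intro eventually_conj ranalytic_eventually[OF u(1)], use h1_eq in \<open>simp only: eventually_eventually\<close>)
        \<comment> \<open>By uniqueness of Taylor polynomials \<open>c (d - 1) x\<close> is the
          coefficient of degree \<open>d - 1\<close> of \<open>h\<close> along \<open>n\<close> at
          the new center, which is zero by the choice of \<open>\<phi>\<close>.\<close>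
        have c0: "\<forall>\<^sub>F x in nhds a. c (d - 1) x = 0"
          using ev0 crit
        proof eventually_elim
          case (elim x)
          define x0 where "x0 = upd x n (a $ n)"
          obtain q where q: "has_tp (\<lambda>s. h (upd x n (\<phi> x + s))) (d - 1) q" "coeff q (d - 1) = 0"
            using elim(2) by blast
          obtain C where "\<forall>\<^sub>F s in nhds 0. \<bar>u (upd x0 n (x0 $ n + s))\<bar> \<le> C"
            using ranalytic_bounded_line[of u x0 n] elim(1) by (auto simp: x0_def)
          then have "has_tp (\<lambda>s. s ^ d * u (upd x0 n (x0 $ n + s))) (d - 1) 0"
            by (rule has_tp_power_mult) (use d in simp)
          from has_tp_add[OF has_tp_poly this, of "\<Sum>i<d. monom (c i x) i"]
          have "has_tp (\<lambda>s. poly (\<Sum>i<d. monom (c i x) i) s + s ^ d * u (upd x0 n (x0 $ n + s))) (d - 1) (\<Sum>i<d. monom (c i x) i)"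
            by simp
          then have "has_tp (\<lambda>s. h (upd x n (\<phi> x + s))) (d - 1) (\<Sum>i<d. monom (c i x) i)"
          proof (rule has_tp_cong)
            have "\<forall>\<^sub>F z in nhds x0. h1 z = (\<Sum>i<d. c i z * (z $ n - a $ n) ^ i) + (z $ n - a $ n) ^ d * u z"
              using elim(1) by (simp add: x0_def)
            from eventually_line[OF this, of n]
            show "\<forall>\<^sub>F s in nhds 0. h (upd x n (\<phi> x + s)) = poly (\<Sum>i<d. monom (c i x) i) s + s ^ d * u (upd x0 n (x0 $ n + s))"
              by eventually_elim (simp add: x0_def h1_line c_upd poly_sum poly_monom)
          qed
          from has_tp_unique[OF this q(1), of "d - 1"] show ?case
            using q(2) d by (simp add: coeff_sum)
        qed
        \<comment> \<open>The same uniqueness identifies \<open>u a\<close> with the coefficient of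
          degree \<open>d\<close> at \<open>a\<close>, which is nonzero.\<close>
        have ua: "u a \<noteq> 0"
        proof -
          obtain B where B: "\<forall>\<^sub>F s in nhds 0. \<bar>u (upd a n (a $ n + s)) - poly [:u a:] s\<bar> \<le> B * \<bar>s\<bar> ^ Suc 0"
            using has_tp_ranalytic0[OF u(1), of n] unfolding has_tp_def by blast
          define P where "P = (\<Sum>i<d. monom (c i a) i) + monom (u a) d"
          have "\<forall>\<^sub>F s in nhds 0. h1 (upd a n (a $ n + s)) = (\<Sum>i<d. c i (upd a n (a $ n + s)) * (upd a n (a $ n + s) $ n - a $ n) ^ i) +
              (upd a n (a $ n + s) $ n - a $ n) ^ d * u (upd a n (a $ n + s))"
            by (rule eventually_line[OF h1_eq])
          with B have "\<forall>\<^sub>F s in nhds 0. \<bar>h (upd a n (a $ n + s)) - poly P s\<bar> \<le> B * \<bar>s\<bar> ^ Suc d"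
          proof eventually_elim
            case (elim s)
            have "h (upd a n (a $ n + s)) = (\<Sum>i<d. c i a * s ^ i) + s ^ d * u (upd a n (a $ n + s))"
              using elim(2) by (simp add: h1_line \<phi>(3) c_upd)
            then have "h (upd a n (a $ n + s)) - poly P s = s ^ d * (u (upd a n (a $ n + s)) - u a)"
              by (simp add: P_def poly_sum poly_monom algebra_simps)
            then have "\<bar>h (upd a n (a $ n + s)) - poly P s\<bar> = \<bar>s\<bar> ^ d * \<bar>u (upd a n (a $ n + s)) - u a\<bar>"
              by (simp add: abs_mult power_abs)
            also have "\<dots> \<le> \<bar>s\<bar> ^ d * (B * \<bar>s\<bar> ^ Suc 0)"
              using elim(1) by (intro mult_left_mono) auto
            finally show ?case
              by (simp add: mult_ac)
          qed
          then have "has_tp (\<lambda>s. h (upd a n (a $ n + s))) d P"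
            unfolding has_tp_def by blast
          from has_tp_unique[OF this p(1), of d] show ?thesis
            using p(2) by (simp add: P_def coeff_sum)
        qed
        obtain \<delta> where \<delta>: "next_radius n d u a \<delta>"
          using next_radius_exists[OF u(1) ua d, of n] by blast
        have "\<forall>\<^sub>F b in nhds a. (\<forall>\<^sub>F x in nhds b. h1 x = (\<Sum>i<d. c i x * (x $ n - a $ n) ^ i) + (x $ n - a $ n) ^ d * u x) \<and>
            (\<forall>\<^sub>F x in nhds b. c (d - 1) x = 0) \<and> \<not> (\<forall>\<^sub>F x in nhds b. e x = 0) \<and> ranalytic e b \<and> ranalytic h1 b \<and> ranalytic \<phi> b \<and>
            ranalytic u b \<and> u b \<noteq> 0 \<and> (\<forall>i\<in>{..<d}. ranalytic (c i) b) \<and> dist b a < \<delta>"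
        proof (intro eventually_conj)
          show "\<forall>\<^sub>F b in nhds a. \<not> (\<forall>\<^sub>F x in nhds b. e x = 0)"
            by (rule ranalytic_nonzero_nearby[OF e(1,3)])
          show "\<forall>\<^sub>F b in nhds a. \<forall>i\<in>{..<d}. ranalytic (c i) b"
            using ranalytic_eventually[OF c(1)] by (intro eventually_ball_finite ballI) auto
          show "\<forall>\<^sub>F b in nhds a. dist b a < \<delta>"
            unfolding eventually_nhds_metric using \<delta> by (auto simp: next_radius_def)
          show "\<forall>\<^sub>F b in nhds a. u b \<noteq> 0"
            using ranalytic_tendsto[OF u(1)] ua by (rule tendsto_imp_eventually_ne)
        qed (use h1_eq c0 ranalytic_eventually[OF e(1)] ranalytic_eventually[OF h1(1)] ranalytic_eventually[OF \<phi>(1)] ranalytic_eventually[OF u(1)]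
            in \<open>simp_all only: eventually_eventually\<close>)
        then have "\<forall>\<^sub>F b in nhds a. amap ?T \<pi> b \<and> uniformizable ?T (\<lambda>x. e (\<pi> x) * h (\<pi> x)) b"
        proof eventually_elim
          case (elim b)
          have e\<pi>: "e (\<pi> x) = e x" for x
            unfolding \<pi>_def by (rule depends_on_upd[OF e(2) n])
          have "uniformizable ?T (\<lambda>x. e x * h1 x) b"
          proof (cases "b $ n = a $ n")
            case True
            \<comment> \<open>Analyticity at the nearby point \<open>b\<close> is available for the
              finitely many indices below \<open>d\<close> only, whereas
              \<open>uniformize_central\<close> speaks of all indices.\<close>
            define c' where "c' i x = (if i < d then c i x else 0)" for i x
            have c': "ranalytic (c' i) b" "depends_on S (c' i)" for i
            proof -
              have "\<forall>i\<in>{..<d}. ranalytic (c i) b"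
                using elim by blast
              moreover have "c' i = (if i < d then c i else (\<lambda>_. 0))"
                by (simp add: c'_def fun_eq_iff)
              ultimately show "ranalytic (c' i) b" "depends_on S (c' i)"
                using c(2)[of i] by (simp_all add: depends_on_const)
            qed
            have c0': "\<forall>\<^sub>F x in nhds b. c' (d - 1) x = 0"
              using conjunct1[OF conjunct2[OF elim]] d by (simp add: c'_def)
            have h1_eq': "\<forall>\<^sub>F x in nhds b. h1 x = (\<Sum>i<d. c' i x * (x $ n - b $ n) ^ i) + (x $ n - b $ n) ^ d * u x"
            proof -
              have "(\<Sum>i<d. c' i x * t ^ i) = (\<Sum>i<d. c i x * t ^ i)" for x t
                by (rule sum.cong) (auto simp: c'_def)
              then show ?thesis
                unfolding True using conjunct1[OF elim] by simp
            qed
            have b: "ranalytic e b" "\<not> (\<forall>\<^sub>F x in nhds b. e x = 0)" "ranalytic h1 b" "ranalytic u b" "u b \<noteq> 0"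
              using elim by auto
            show ?thesis
              by (rule uniformize_central[OF n less.IH N d b(1) e(2) b(2,3) h1(2) h1_eq' c' c0' b(4,5) u(2)])
          next
            case False
            have b: "ranalytic e b" "\<not> (\<forall>\<^sub>F x in nhds b. e x = 0)" "ranalytic h1 b" "dist (id b) a < \<delta>"
              using elim by auto
            have "\<forall>\<^sub>F x in nhds b. h1 x = (\<Sum>i<d. c i x * (x $ n - a $ n) ^ i) + (x $ n - a $ n) ^ d * u x"
                "\<forall>\<^sub>F x in nhds b. c (d - 1) x = 0"
              using elim by auto
            then have eq: "\<forall>\<^sub>F x in nhds b. h1 x = (\<Sum>i\<in>{..<d - 1}. c i x * (x $ n - a $ n) ^ i) + (x $ n - a $ n) ^ d * u (id x)"
            proof eventually_elim
              case (elim x)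
              have "(\<Sum>i<Suc (d - 1). c i x * (x $ n - a $ n) ^ i) = (\<Sum>i<d - 1. c i x * (x $ n - a $ n) ^ i)"
                unfolding sum.lessThan_Suc elim(2) by simp
              then show ?case
                using elim(1) unfolding Sd by simp
            qed
            have "\<bar>b $ n - a $ n\<bar> < \<delta>"
              using dist_vec_nth_le[of b n a] b(4) by (simp add: dist_real_def)
            then have "ordn n (d - 1) h1 b"
              by (rule ordn_off_center[OF \<delta> b(4) _ False order_refl c(2) n amap_id eq])
            then show ?thesis
              using d by (intro unif_orderD[OF less.IH b(1) e(2) b(2,3) h1(2)]) auto
          qed
          moreover have "amap ?T \<pi> b"
            using elim by (intro \<pi>) blast
          ultimately show ?case
            by (simp add: e\<pi> h1_def)
        qed
        then show ?thesis
          by (rule uniformizable_homeo[OF _ \<rho>]) (simp add: \<pi>\<rho>)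
      qed
    qed
  qed
qed

text \<open>Induction on the set of variables. \<open>ranalytic_direction\<close> gives a line on
  which the germ has finite order, and the shear \<open>\<pi>\<close> turns it into the axis
  \<open>n\<close>. The induction hypothesis for \<open>S\<close> is what
  \<open>unif_order_all\<close> requires, here with trivial factor 1.\<close>

theorem uniformization:
  fixes S :: "'k::finite set"
  assumes "ranalytic f a" "depends_on S f" "\<not> (\<forall>\<^sub>F x in nhds a. f x = 0)"
  shows "uniformizable S f a"
proof -
  have "finite S"
    by simp
  then show ?thesis
    using assms
  proof (induction S arbitrary: f a rule: finite_induct)
    case empty
    have "f x = f a" for x
      by (rule depends_onD[OF empty.prems(2)]) auto
    then have "f a \<noteq> 0"
      using empty.prems(3) by (metis (mono_tags, lifting) always_eventually)
    then show ?case
      by (intro uniformizable_normal_crossing normal_crossing_unit empty.prems(1))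
  next
    case (insert n S)
    let ?T = "insert n S"
    obtain v d p where v: "v $ n = 1" "has_tp (\<lambda>s. f (a + s *s v)) d p" "coeff p d \<noteq> 0"
      by (rule ranalytic_direction[OF insert.prems(1,3)])
    define \<pi> where "\<pi> x = (\<chi> i. if i \<in> S then x $ i + v $ i * (x $ n - a $ n) else x $ i)" for x
    define \<rho> where "\<rho> x = (\<chi> i. if i \<in> S then x $ i - v $ i * (x $ n - a $ n) else x $ i)" for x
    have \<pi>a: "\<pi> a = a"
      by (simp add: \<pi>_def vec_eq_iff)
    have \<pi>: "amap ?T \<pi> x" for x
      unfolding amap_def
    proof (intro conjI ballI allI impI)
      show "depends_on ?T (\<lambda>x. \<pi> x $ i)" if "i \<in> ?T" for i
        using that by (auto simp: \<pi>_def depends_on_def)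
      show "\<pi> x $ i = x $ i" if "i \<notin> ?T" for i x
        using that by (simp add: \<pi>_def)
      show "ranalytic (\<lambda>x. \<pi> x $ i) x" for i
        by (cases "i \<in> S") (auto simp: \<pi>_def intro!: ranalytic_add ranalytic_mult ranalytic_diff)
    qed
    have \<pi>\<rho>: "\<pi> (\<rho> x) = x" for x
      using insert.hyps(2) by (simp add: \<pi>_def \<rho>_def vec_eq_iff)
    have \<rho>: "(\<rho> \<longlongrightarrow> a) (nhds a)"
    proof -
      have nth: "((\<lambda>x. x $ i) \<longlongrightarrow> a $ i) (nhds a)" for i
        by (intro tendsto_vec_nth) (simp add: tendsto_nhds_iff)
      have "(\<rho> \<longlongrightarrow> \<rho> a) (nhds a)"
      proof (rule vec_tendstoI)
        show "((\<lambda>x. \<rho> x $ i) \<longlongrightarrow> \<rho> a $ i) (nhds a)" for i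
        proof (cases "i \<in> S")
          case True
          have "((\<lambda>x. x $ i - v $ i * (x $ n - a $ n)) \<longlongrightarrow> a $ i - v $ i * (a $ n - a $ n)) (nhds a)"
            by (intro tendsto_intros nth)
          then show ?thesis
            using True by (simp add: \<rho>_def)
        next
          case False
          then show ?thesis
            using nth by (simp add: \<rho>_def)
        qed
      qed
      moreover have "\<rho> a = a"
        by (simp add: \<rho>_def vec_eq_iff)
      ultimately show ?thesis
        by simp
    qed
    define f1 where "f1 x = f (\<pi> x)" for x
    have f1: "ranalytic f1 a" "depends_on ?T f1"
      unfolding f1_def using amap_ranalytic[OF \<pi>, of f] insert.prems amap_depends_on[OF \<pi>] by (auto simp: \<pi>a)
    have "f1 (upd a n (a $ n + s)) = f (a + s *s v)" for s
      unfolding f1_def using insert.hyps(2) v(1) by (intro depends_onD[OF insert.prems(2)]) (auto simp: \<pi>_def)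
    then have "ordn n d f1 a"
      unfolding ordn_def using v by (intro exI[of _ p]) simp
    then have ev: "\<forall>\<^sub>F b in nhds a. ordn n d f1 b \<and> ranalytic f1 b"
      by (intro eventually_conj ordn_eventually[OF f1(1)] ranalytic_eventually[OF f1(1)])
    have order: "unif_order n S d"
      by (rule unif_order_all[OF insert.hyps(2) insert.IH])
    from ev have "\<forall>\<^sub>F b in nhds a. amap ?T \<pi> b \<and> uniformizable ?T (\<lambda>x. f (\<pi> x)) b"
    proof eventually_elim
      case (elim b)
      have "uniformizable ?T (\<lambda>x. 1 * f1 x) b"
        by (rule unif_orderD[OF order]) (use elim f1(2) depends_on_const in auto)
      then show ?case
        using \<pi> by (simp add: f1_def)
    qed
    then show ?case
      by (rule uniformizable_homeo[OF _ \<rho>]) (simp add: \<pi>\<rho>)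
  qed
qed

section \<open>Lojasiewicz's inequality\<close>

text \<open>The bounds on \<open>G\<close> and \<open>F\<close> belong to the notion so that
  exponent and constant may be enlarged, which makes it stable under finite unions.\<close>

definition pow_dominated :: "('a \<Rightarrow> real) \<Rightarrow> ('a \<Rightarrow> real) \<Rightarrow> 'a set \<Rightarrow> bool" where
  "pow_dominated G F X \<longleftrightarrow> (\<exists>n C. C \<ge> 0 \<and> (\<forall>x\<in>X. 0 \<le> G x \<and> G x \<le> 1 \<and> 0 \<le> F x \<and> G x ^ n \<le> C * F x))"

lemma pow_dominated_subset: "pow_dominated G F X \<Longrightarrow> Y \<subseteq> X \<Longrightarrow> pow_dominated G F Y"
  unfolding pow_dominated_def by blast

lemma pow_dominated_Un:
  assumes "pow_dominated G F X" "pow_dominated G F Y"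
  shows "pow_dominated G F (X \<union> Y)"
proof -
  obtain m C where C: "C \<ge> 0" "\<And>x. x \<in> X \<Longrightarrow> 0 \<le> G x \<and> G x \<le> 1 \<and> 0 \<le> F x \<and> G x ^ m \<le> C * F x"
    using assms(1) unfolding pow_dominated_def by blast
  obtain n D where D: "D \<ge> 0" "\<And>x. x \<in> Y \<Longrightarrow> 0 \<le> G x \<and> G x \<le> 1 \<and> 0 \<le> F x \<and> G x ^ n \<le> D * F x"
    using assms(2) unfolding pow_dominated_def by blast
  have "G x ^ (m + n) \<le> (C + D) * F x" if "x \<in> X \<union> Y" for x
    using that
  proof
    assume x: "x \<in> X"
    have "G x ^ (m + n) \<le> G x ^ m"
      using C(2)[OF x] by (intro power_decreasing) auto
    also have "\<dots> \<le> C * F x"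
      using C(2)[OF x] by blast
    also have "\<dots> \<le> (C + D) * F x"
      using C(2)[OF x] D(1) by (intro mult_right_mono) auto
    finally show ?thesis .
  next
    assume x: "x \<in> Y"
    have "G x ^ (m + n) \<le> G x ^ n"
      using D(2)[OF x] by (intro power_decreasing) auto
    also have "\<dots> \<le> D * F x"
      using D(2)[OF x] by blast
    also have "\<dots> \<le> (C + D) * F x"
      using D(2)[OF x] C(1) by (intro mult_right_mono) auto
    finally show ?thesis .
  qed
  then show ?thesis
    unfolding pow_dominated_def using C D by (intro exI[of _ "m + n"] exI[of _ "C + D"]) auto
qed

lemma pow_dominated_Union:
  assumes "finite \<X>" "\<And>X. X \<in> \<X> \<Longrightarrow> pow_dominated G F X"
  shows "pow_dominated G F (\<Union>\<X>)"
  using assms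
proof (induction \<X> rule: finite_induct)
  case empty
  show ?case
    unfolding pow_dominated_def by (intro exI[of _ 0]) simp
next
  case (insert X \<X>)
  then show ?case
    using pow_dominated_Un[of G F X "\<Union>\<X>"] by simp
qed

lemma pow_dominated_compact:
  assumes K: "compact K"
    and loc: "\<And>c. c \<in> K \<Longrightarrow> \<exists>U. open U \<and> c \<in> U \<and> pow_dominated G F (K \<inter> U)"
  shows "pow_dominated G F K"
proof -
  obtain U where U: "\<And>c. c \<in> K \<Longrightarrow> open (U c)" "\<And>c. c \<in> K \<Longrightarrow> c \<in> U c"
      "\<And>c. c \<in> K \<Longrightarrow> pow_dominated G F (K \<inter> U c)"
    using loc by metis
  have "K \<subseteq> (\<Union>c\<in>K. U c)"
    using U(2) by blast
  with K U(1) obtain D where D: "D \<subseteq> K" "finite D" "K \<subseteq> (\<Union>c\<in>D. U c)"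
    by (rule compactE_image)
  have "pow_dominated G F (\<Union>((\<lambda>c. K \<inter> U c) ` D))"
    using D U(3) by (intro pow_dominated_Union) auto
  then show ?thesis
    by (rule pow_dominated_subset) (use D(3) in blast)
qed

lemma pow_dominated_eventually:
  assumes "\<forall>\<^sub>F x in nhds a. x \<in> X" "pow_dominated G F X"
  shows "\<exists>U. open U \<and> a \<in> U \<and> pow_dominated G F U"
  using assms pow_dominated_subset unfolding eventually_nhds by (metis subsetI)

text \<open>Each \<open>g (\<psi> x)\<close> is at most a multiple of \<open>\<bar>x $ i - b $ i\<bar>\<close> for every coordinate \<open>i\<close> occurring
  in the monomial, since \<open>g \<circ> \<psi>\<close> vanishes where \<open>x $ i = b $ i\<close>.\<close>
lemma pow_dominated_normal_crossing:
  fixes f g :: "real ^ 'k \<Rightarrow> real"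
  assumes normal_crossing: "normal_crossing (\<lambda>x. f (\<psi> x)) b" and \<psi>: "amap S \<psi> b" and N: "open N" "\<psi> b \<in> N"
    and lip: "\<And>x y. x \<in> N \<Longrightarrow> y \<in> N \<Longrightarrow> \<bar>g x - g y\<bar> \<le> L * dist x y"
    and zero: "\<And>x. x \<in> N \<Longrightarrow> f x = 0 \<Longrightarrow> g x = 0" and g1: "\<And>x. x \<in> N \<Longrightarrow> \<bar>g x\<bar> \<le> 1"
  shows "\<exists>U. open U \<and> b \<in> U \<and> pow_dominated (\<lambda>x. \<bar>g (\<psi> x)\<bar>) (\<lambda>x. \<bar>f (\<psi> x)\<bar>) U"
proof -
  obtain \<alpha> u where u: "ranalytic u b" "u b \<noteq> 0" and f_eq: "\<forall>\<^sub>F x in nhds b. f (\<psi> x) = mon b \<alpha> x * u x"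
    by (rule normal_crossing_centered[OF normal_crossing])
  have inN: "\<forall>\<^sub>F x in nhds b. \<psi> x \<in> N"
    by (rule topological_tendstoD[OF amap_tendsto[OF \<psi>] N])
  have "\<forall>\<^sub>F x in nhds b. \<bar>u x - u b\<bar> < \<bar>u b\<bar> / 2"
    using tendstoD[OF ranalytic_tendsto[OF u(1)], of "\<bar>u b\<bar> / 2"] u(2) by (simp add: dist_real_def)
  then have u_low: "\<forall>\<^sub>F x in nhds b. \<bar>u b\<bar> / 2 \<le> \<bar>u x\<bar>"
    by (rule eventually_mono) (simp add: abs_if split: if_splits)
  have "\<exists>D\<ge>0. \<forall>\<^sub>F x in nhds b. \<bar>g (\<psi> x)\<bar> \<le> D * \<bar>x $ i - b $ i\<bar>" if i: "\<alpha> i > 0" for i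
  proof -
    \<comment> \<open>Division replaces a mean value estimate: moving \<open>x\<close> to the
      hyperplane changes \<open>\<psi>\<close> by a multiple of \<open>x $ i - b $ i\<close> with a
      quotient bounded near \<open>b\<close>.\<close>
    have "\<exists>q. ranalytic q b \<and> (\<forall>\<^sub>F x in nhds b. \<psi> x $ j - \<psi> (upd x i (b $ i)) $ j = (x $ i - b $ i) * q x)" for j
    proof -
      have "ranalytic (\<lambda>x. \<psi> x $ j) b"
        using \<psi> by (simp add: amap_def)
      moreover have "ranalytic (\<lambda>x. \<psi> (upd x i (b $ i)) $ j) b"
        by (rule ranalytic_upd[where f = "\<lambda>x. \<psi> x $ j" and t = "\<lambda>_. b $ i"]) (use calculation in simp_all)
      ultimately have an: "ranalytic (\<lambda>x. \<psi> x $ j - \<psi> (upd x i (b $ i)) $ j) b"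
        by (rule ranalytic_diff)
      have "\<forall>\<^sub>F x in nhds b. \<psi> (upd x i (b $ i)) $ j - \<psi> (upd (upd x i (b $ i)) i (b $ i)) $ j = 0"
        by simp
      from ranalytic_division[where f = "\<lambda>x. \<psi> x $ j - \<psi> (upd x i (b $ i)) $ j", OF an this]
      obtain q where "ranalytic q b" "\<forall>\<^sub>F x in nhds b. \<psi> x $ j - \<psi> (upd x i (b $ i)) $ j = (x $ i - b $ i) * q x" .
      then show ?thesis
        by blast
    qed
    then have "\<forall>j. \<exists>q. ranalytic q b \<and> (\<forall>\<^sub>F x in nhds b. \<psi> x $ j - \<psi> (upd x i (b $ i)) $ j = (x $ i - b $ i) * q x)" ..
    from choice[OF this] obtain q where "\<forall>j. ranalytic (q j) b \<and> (\<forall>\<^sub>F x in nhds b. \<psi> x $ j - \<psi> (upd x i (b $ i)) $ j = (x $ i - b $ i) * q j x)" ..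
    then have q: "ranalytic (q j) b" "\<forall>\<^sub>F x in nhds b. \<psi> x $ j - \<psi> (upd x i (b $ i)) $ j = (x $ i - b $ i) * q j x" for j
      by blast+
    define D where "D = \<bar>L\<bar> * (\<Sum>j\<in>UNIV. \<bar>q j b\<bar> + 1)"
    have "\<forall>\<^sub>F x in nhds b. \<bar>q j x\<bar> \<le> \<bar>q j b\<bar> + 1" for j
      using tendstoD[OF ranalytic_tendsto[OF q(1)[of j]] zero_less_one] by (rule eventually_mono) (auto simp: dist_real_def)
    then have "\<forall>\<^sub>F x in nhds b. \<forall>j. \<psi> x $ j - \<psi> (upd x i (b $ i)) $ j = (x $ i - b $ i) * q j x \<and> \<bar>q j x\<bar> \<le> \<bar>q j b\<bar> + 1"
      using q(2) by (intro eventually_all_finite eventually_conj)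
    moreover have "\<forall>\<^sub>F x in nhds b. f (\<psi> (upd x i (b $ i))) = mon b \<alpha> (upd x i (b $ i)) * u (upd x i (b $ i))"
      by (rule eventually_upd[OF f_eq])
    moreover have "\<forall>\<^sub>F x in nhds b. \<psi> (upd x i (b $ i)) \<in> N"
      by (rule eventually_upd[OF inN])
    ultimately have "\<forall>\<^sub>F x in nhds b. \<bar>g (\<psi> x)\<bar> \<le> D * \<bar>x $ i - b $ i\<bar>"
      using inN
    proof eventually_elim
      case (elim x)
      define y where "y = upd x i (b $ i)"
      have "mon b \<alpha> y = 0"
        using i by (auto simp: mon_eq_0_iff y_def)
      then have "g (\<psi> y) = 0"
        using elim(2,3) zero by (simp add: y_def)
      then have "\<bar>g (\<psi> x)\<bar> \<le> L * dist (\<psi> x) (\<psi> y)"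
        using lip[OF elim(4), of "\<psi> y"] elim(3) by (simp add: y_def)
      also have "\<dots> \<le> \<bar>L\<bar> * dist (\<psi> x) (\<psi> y)"
        by (intro mult_right_mono) auto
      also have "dist (\<psi> x) (\<psi> y) \<le> (\<Sum>j\<in>UNIV. \<bar>(\<psi> x - \<psi> y) $ j\<bar>)"
        unfolding dist_norm by (rule norm_le_l1_cart)
      also have "\<dots> \<le> (\<Sum>j\<in>UNIV. \<bar>x $ i - b $ i\<bar> * (\<bar>q j b\<bar> + 1))"
        using elim(1) by (intro sum_mono) (auto simp: y_def abs_mult intro!: mult_left_mono)
      finally have "\<bar>g (\<psi> x)\<bar> \<le> \<bar>L\<bar> * (\<Sum>j\<in>UNIV. \<bar>x $ i - b $ i\<bar> * (\<bar>q j b\<bar> + 1))"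
        by (simp add: mult_left_mono)
      also have "\<dots> = D * \<bar>x $ i - b $ i\<bar>"
        by (simp add: D_def sum_distrib_left sum_distrib_right mult_ac)
      finally show ?case .
    qed
    moreover have "D \<ge> 0"
      unfolding D_def by (intro mult_nonneg_nonneg sum_nonneg) auto
    ultimately show ?thesis
      by blast
  qed
  then have "\<forall>i. \<exists>D. \<alpha> i > 0 \<longrightarrow> D \<ge> 0 \<and> (\<forall>\<^sub>F x in nhds b. \<bar>g (\<psi> x)\<bar> \<le> D * \<bar>x $ i - b $ i\<bar>)"
    by blast
  from choice[OF this] obtain D where "\<forall>i. \<alpha> i > 0 \<longrightarrow> D i \<ge> 0 \<and> (\<forall>\<^sub>F x in nhds b. \<bar>g (\<psi> x)\<bar> \<le> D i * \<bar>x $ i - b $ i\<bar>)" ..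
  then have D: "\<And>i. \<alpha> i > 0 \<Longrightarrow> D i \<ge> 0" "\<And>i. \<alpha> i > 0 \<Longrightarrow> \<forall>\<^sub>F x in nhds b. \<bar>g (\<psi> x)\<bar> \<le> D i * \<bar>x $ i - b $ i\<bar>"
    by blast+
  \<comment> \<open>The power of \<open>g\<close> of total degree \<open>n\<close> is distributed
    over the coordinates, \<open>\<alpha> i\<close> factors being bounded by coordinate
    \<open>i\<close>. The number \<open>2 / \<bar>u b\<bar>\<close> in \<open>C\<close> bounds the
    inverse of the unit.\<close>
  define n where "n = sum \<alpha> UNIV"
  define C where "C = (\<Prod>i\<in>UNIV. D i ^ \<alpha> i) * (2 / \<bar>u b\<bar>)"
  have prod0: "(\<Prod>i\<in>UNIV. D i ^ \<alpha> i) \<ge> 0"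
  proof (rule prod_nonneg)
    fix i
    show "D i ^ \<alpha> i \<ge> 0"
      using D(1)[of i] by (cases "\<alpha> i = 0") auto
  qed
  have "\<forall>\<^sub>F x in nhds b. \<forall>i. \<alpha> i > 0 \<longrightarrow> \<bar>g (\<psi> x)\<bar> \<le> D i * \<bar>x $ i - b $ i\<bar>"
  proof (rule eventually_all_finite)
    show "\<forall>\<^sub>F x in nhds b. \<alpha> i > 0 \<longrightarrow> \<bar>g (\<psi> x)\<bar> \<le> D i * \<bar>x $ i - b $ i\<bar>" for i
      using D(2)[of i] by (cases "\<alpha> i > 0") (auto elim: eventually_mono)
  qed
  with f_eq u_low inN have ev: "\<forall>\<^sub>F x in nhds b. x \<in> {x. \<bar>g (\<psi> x)\<bar> \<le> 1 \<and> \<bar>g (\<psi> x)\<bar> ^ n \<le> C * \<bar>f (\<psi> x)\<bar>}"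
  proof eventually_elim
    case (elim x)
    have "\<bar>g (\<psi> x)\<bar> ^ n = (\<Prod>i\<in>UNIV. \<bar>g (\<psi> x)\<bar> ^ \<alpha> i)"
      by (simp add: n_def power_sum)
    also have "\<dots> \<le> (\<Prod>i\<in>UNIV. (D i * \<bar>x $ i - b $ i\<bar>) ^ \<alpha> i)"
    proof (rule prod_mono)
      show "0 \<le> \<bar>g (\<psi> x)\<bar> ^ \<alpha> i \<and> \<bar>g (\<psi> x)\<bar> ^ \<alpha> i \<le> (D i * \<bar>x $ i - b $ i\<bar>) ^ \<alpha> i" for i
        using elim(4) by (cases "\<alpha> i = 0") (auto intro!: power_mono)
    qed
    also have "\<dots> = (\<Prod>i\<in>UNIV. D i ^ \<alpha> i) * \<bar>mon b \<alpha> x\<bar>"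
      by (simp add: power_mult_distrib prod.distrib mon_def abs_prod power_abs)
    also have "\<bar>mon b \<alpha> x\<bar> \<le> 2 / \<bar>u b\<bar> * \<bar>f (\<psi> x)\<bar>"
    proof -
      have "\<bar>mon b \<alpha> x\<bar> * (\<bar>u b\<bar> / 2) \<le> \<bar>mon b \<alpha> x\<bar> * \<bar>u x\<bar>"
        using elim(2) by (intro mult_left_mono) auto
      then show ?thesis
        using u(2) unfolding elim(1) abs_mult by (simp add: field_simps)
    qed
    finally have "\<bar>g (\<psi> x)\<bar> ^ n \<le> (\<Prod>i\<in>UNIV. D i ^ \<alpha> i) * (2 / \<bar>u b\<bar> * \<bar>f (\<psi> x)\<bar>)"
      using prod0 by (simp add: mult_left_mono)
    then show ?case
      using g1[OF elim(3)] by (simp add: C_def)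
  qed
  have "C \<ge> 0"
    using prod0 by (simp add: C_def)
  then have "pow_dominated (\<lambda>x. \<bar>g (\<psi> x)\<bar>) (\<lambda>x. \<bar>f (\<psi> x)\<bar>) {x. \<bar>g (\<psi> x)\<bar> \<le> 1 \<and> \<bar>g (\<psi> x)\<bar> ^ n \<le> C * \<bar>f (\<psi> x)\<bar>}"
    unfolding pow_dominated_def by (intro exI[of _ n] exI[of _ C]) auto
  from pow_dominated_eventually[OF ev this] show ?thesis .
qed

text \<open>Goes back from the leaves to the start: local estimates combine on each compact piece,
  pass to its image because they involve values only, and combine over the finitely many images
  covering a neighborhood.\<close>

lemma pow_dominated_unif:
  assumes "unif S (\<lambda>\<psi> b. \<exists>U. open U \<and> b \<in> U \<and> pow_dominated (\<lambda>x. G (\<psi> x)) (\<lambda>x. F (\<psi> x)) U) \<psi> a"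
  shows "\<exists>U. open U \<and> a \<in> U \<and> pow_dominated (\<lambda>x. G (\<psi> x)) (\<lambda>x. F (\<psi> x)) U"
  using assms
proof (induction rule: unif.induct)
  case (unif_base \<psi> a)
  then show ?case .
next
  case (unif_step P \<psi> a)
  have image: "pow_dominated (\<lambda>x. G (\<psi> x)) (\<lambda>x. F (\<psi> x)) (\<pi> ` K)" if P: "(\<pi>, K) \<in> P" for \<pi> K
  proof -
    have "pow_dominated (\<lambda>x. G ((\<psi> \<circ> \<pi>) x)) (\<lambda>x. F ((\<psi> \<circ> \<pi>) x)) K"
    proof (rule pow_dominated_compact)
      show "compact K"
        by (rule unif_step.hyps(2)[OF P])
      fix c assume c: "c \<in> K"
      have "\<exists>U. open U \<and> c \<in> U \<and> pow_dominated (\<lambda>x. G ((\<psi> \<circ> \<pi>) x)) (\<lambda>x. F ((\<psi> \<circ> \<pi>) x)) U"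
        using unif_step.IH[OF P c] by (elim conjE)
      then show "\<exists>U. open U \<and> c \<in> U \<and> pow_dominated (\<lambda>x. G ((\<psi> \<circ> \<pi>) x)) (\<lambda>x. F ((\<psi> \<circ> \<pi>) x)) (K \<inter> U)"
        by (meson Int_lower2 pow_dominated_subset)
    qed
    then show ?thesis
      unfolding pow_dominated_def by simp
  qed
  have "pow_dominated (\<lambda>x. G (\<psi> x)) (\<lambda>x. F (\<psi> x)) (\<Union>((\<lambda>(\<pi>, K). \<pi> ` K) ` P))"
    using unif_step.hyps(1) image by (intro pow_dominated_Union) auto
  moreover have "\<forall>\<^sub>F x in nhds a. x \<in> \<Union>((\<lambda>(\<pi>, K). \<pi> ` K) ` P)"
    using unif_step.hyps(3) by (rule eventually_mono) auto
  ultimately show ?case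
    by (rule pow_dominated_eventually[rotated])
qed

theorem lojasiewicz_local:
  fixes f g :: "real ^ 'k \<Rightarrow> real"
  assumes f: "ranalytic f a" and N: "open N" "a \<in> N"
    and lip: "\<And>x y. x \<in> N \<Longrightarrow> y \<in> N \<Longrightarrow> \<bar>g x - g y\<bar> \<le> L * dist x y"
    and zero: "\<And>x. x \<in> N \<Longrightarrow> f x = 0 \<Longrightarrow> g x = 0"
  shows "\<exists>n C. C \<ge> 0 \<and> (\<forall>\<^sub>F x in nhds a. \<bar>g x\<bar> ^ n \<le> C * \<bar>f x\<bar>)"
proof (cases "f a = 0")
  case False
  have "\<forall>\<^sub>F x in nhds a. \<bar>f x - f a\<bar> < \<bar>f a\<bar> / 2"
    using tendstoD[OF ranalytic_tendsto[OF f], of "\<bar>f a\<bar> / 2"] False by (simp add: dist_real_def)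
  then have "\<forall>\<^sub>F x in nhds a. \<bar>g x\<bar> ^ 0 \<le> 2 / \<bar>f a\<bar> * \<bar>f x\<bar>"
  proof eventually_elim
    case (elim x)
    then have "\<bar>f a\<bar> / 2 \<le> \<bar>f x\<bar>"
      by (simp add: abs_if split: if_splits)
    then show ?case
      using False by (simp add: field_simps)
  qed
  then show ?thesis
    by (intro exI[of _ 0] exI[of _ "2 / \<bar>f a\<bar>"]) simp
next
  case True
  then have ga: "g a = 0"
    using zero N by blast
  obtain r where r: "r > 0" "ball a r \<subseteq> N"
    using N open_contains_ball by blast
  \<comment> \<open>Since \<open>g a = 0\<close>, the Lipschitz bound gives
    \<open>\<bar>g\<bar> \<le> 1\<close> within radius
    \<open>1 / (\<bar>L\<bar> + 1)\<close>.\<close>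
  define M where "M = ball a (min r (1 / (\<bar>L\<bar> + 1)))"
  have M: "open M" "a \<in> M" "M \<subseteq> N"
    using r by (auto simp: M_def)
  have g1: "\<bar>g x\<bar> \<le> 1" if x: "x \<in> M" for x
  proof -
    have "\<bar>g x\<bar> \<le> L * dist x a"
      using lip[of x a] x M N ga by auto
    also have "\<dots> \<le> (\<bar>L\<bar> + 1) * dist x a"
      by (intro mult_right_mono) auto
    also have "\<dots> \<le> (\<bar>L\<bar> + 1) * (1 / (\<bar>L\<bar> + 1))"
      using x by (intro mult_left_mono) (auto simp: M_def dist_commute)
    also have "\<dots> = 1"
    proof -
      have "\<bar>L\<bar> + 1 \<noteq> 0"
        by linarith
      then show ?thesis
        by simp
    qed
    finally show ?thesis .
  qed
  show ?thesis
  proof (cases "\<forall>\<^sub>F x in nhds a. f x = 0")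
    case True
    have "\<forall>\<^sub>F x in nhds a. x \<in> N"
      using N by (rule eventually_nhds_in_open)
    with True have "\<forall>\<^sub>F x in nhds a. \<bar>g x\<bar> ^ 1 \<le> 0 * \<bar>f x\<bar>"
      by eventually_elim (simp add: zero)
    then show ?thesis
      by blast
  next
    case False
    have "depends_on UNIV f"
      by (simp add: depends_on_def flip: vec_eq_iff)
    then have "unif UNIV (\<lambda>\<psi>. normal_crossing (\<lambda>x. f (\<psi> x))) id a"
      using uniformization[OF f _ False] by (simp add: uniformizable_def)
    then have "unif UNIV (\<lambda>\<psi> b. \<exists>U. open U \<and> b \<in> U \<and> pow_dominated (\<lambda>x. \<bar>g (\<psi> x)\<bar>) (\<lambda>x. \<bar>f (\<psi> x)\<bar>) U) id a"
    proof (rule unif_transfer[OF _ amap_id _ M(1) order_refl])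
      show "id a \<in> M"
        using M by simp
      fix \<psi> b assume \<psi>: "amap UNIV \<psi> b" "\<psi> b \<in> M" "normal_crossing (\<lambda>x. f (\<psi> x)) b"
      have "\<exists>U. open U \<and> b \<in> U \<and> pow_dominated (\<lambda>x. \<bar>g (\<psi> x)\<bar>) (\<lambda>x. \<bar>f (\<psi> x)\<bar>) U"
        using M(3) by (intro pow_dominated_normal_crossing[where f = f and \<psi> = \<psi> and g = g and L = L and N = M, OF \<psi>(3,1) M(1) \<psi>(2)]
            lip zero g1) blast+
      then show "unif UNIV (\<lambda>\<psi> b. \<exists>U. open U \<and> b \<in> U \<and> pow_dominated (\<lambda>x. \<bar>g (\<psi> x)\<bar>) (\<lambda>x. \<bar>f (\<psi> x)\<bar>) U) \<psi> b"
        by (rule unif_base[where \<psi> = \<psi> and a = b])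
    qed
    from pow_dominated_unif[where G = "\<lambda>x. \<bar>g x\<bar>" and F = "\<lambda>x. \<bar>f x\<bar>", OF this]
    obtain U n C where U: "open U" "a \<in> U" "C \<ge> 0" "\<And>x. x \<in> U \<Longrightarrow> \<bar>g x\<bar> ^ n \<le> C * \<bar>f x\<bar>"
      unfolding pow_dominated_def by auto
    have "\<forall>\<^sub>F x in nhds a. \<bar>g x\<bar> ^ n \<le> C * \<bar>f x\<bar>"
      using eventually_nhds_in_open[OF U(1,2)] by (rule eventually_mono) (rule U(4))
    then show ?thesis
      using U(3) by blast
  qed
qed

section \<open>Complexification of operator-valued power series\<close>

text \<open>Expands one slot at a time: the first \<open>r\<close> slots contain sums and the
  remaining ones arbitrary vectors \<open>y\<close>, which is the generality the induction on
  \<open>r\<close> requires.\<close>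

lemma multilinear_expand:
  fixes A :: "(nat \<Rightarrow> 'a::real_vector) \<Rightarrow> 'b::real_vector"
  assumes lin: "\<And>v i. v \<in> {..<k} \<rightarrow>\<^sub>E UNIV \<Longrightarrow> i < k \<Longrightarrow> linear (\<lambda>x. A (v(i := x)))"
  shows "A (\<lambda>i\<in>{..<k}. \<Sum>j\<in>J. c i j *\<^sub>R w i j) =
    (\<Sum>\<phi>\<in>{..<k} \<rightarrow>\<^sub>E J. (\<Prod>i<k. c i (\<phi> i)) *\<^sub>R A (\<lambda>i\<in>{..<k}. w i (\<phi> i)))"
proof -
  define s where "s i = (\<Sum>j\<in>J. c i j *\<^sub>R w i j)" for i
  have "A (\<lambda>i\<in>{..<k}. if i < r then s i else y i) =
    (\<Sum>\<phi>\<in>{..<r} \<rightarrow>\<^sub>E J. (\<Prod>i<r. c i (\<phi> i)) *\<^sub>R A (\<lambda>i\<in>{..<k}. if i < r then w i (\<phi> i) else y i))"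
    if "r \<le> k" for r y
    using that
  proof (induction r arbitrary: y)
    case 0
    then show ?case
      by simp
  next
    case (Suc r)
    define V where "V = (\<lambda>i\<in>{..<k}. if i < r then s i else y i)"
    have V: "V \<in> {..<k} \<rightarrow>\<^sub>E UNIV"
      by (simp add: V_def)
    have lin_r: "linear (\<lambda>x. A (V(r := x)))"
      using Suc.prems by (intro lin[OF V]) simp
    have Vr: "V(r := x) = (\<lambda>i\<in>{..<k}. if i < r then s i else (y(r := x)) i)" for x
      using Suc.prems by (auto simp: V_def fun_eq_iff)
    have "(\<lambda>i\<in>{..<k}. if i < Suc r then s i else y i) = V(r := s r)"
      using Suc.prems by (auto simp: V_def fun_eq_iff less_Suc_eq)
    then have "A (\<lambda>i\<in>{..<k}. if i < Suc r then s i else y i) = A (V(r := \<Sum>j\<in>J. c r j *\<^sub>R w r j))"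
      by (simp add: s_def)
    also have "\<dots> = (\<Sum>j\<in>J. c r j *\<^sub>R A (V(r := w r j)))"
      by (simp add: linear_sum[OF lin_r] linear_scale[OF lin_r])
    also have "\<dots> = (\<Sum>j\<in>J. c r j *\<^sub>R (\<Sum>\<phi>\<in>{..<r} \<rightarrow>\<^sub>E J. (\<Prod>i<r. c i (\<phi> i)) *\<^sub>R
        A (\<lambda>i\<in>{..<k}. if i < r then w i (\<phi> i) else (y(r := w r j)) i)))"
      by (simp only: Vr Suc.IH[OF Suc_leD[OF Suc.prems]])
    also have "\<dots> = (\<Sum>(j, \<phi>)\<in>J \<times> ({..<r} \<rightarrow>\<^sub>E J). (\<Prod>i<Suc r. c i ((\<phi>(r := j)) i)) *\<^sub>R
        A (\<lambda>i\<in>{..<k}. if i < Suc r then w i ((\<phi>(r := j)) i) else y i))"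
      unfolding scaleR_right.sum scaleR_scaleR sum.cartesian_product
    proof (rule sum.cong[OF refl], clarify)
      fix j \<phi>
      have "(\<Prod>i<r. c i ((\<phi>(r := j)) i)) = (\<Prod>i<r. c i (\<phi> i))"
        by (rule prod.cong) auto
      moreover have "(\<lambda>i\<in>{..<k}. if i < Suc r then w i ((\<phi>(r := j)) i) else y i) =
          (\<lambda>i\<in>{..<k}. if i < r then w i (\<phi> i) else (y(r := w r j)) i)"
        by (auto simp: fun_eq_iff less_Suc_eq)
      ultimately show "(c r j * (\<Prod>i<r. c i (\<phi> i))) *\<^sub>R A (\<lambda>i\<in>{..<k}. if i < r then w i (\<phi> i) else (y(r := w r j)) i) =
          (\<Prod>i<Suc r. c i ((\<phi>(r := j)) i)) *\<^sub>R A (\<lambda>i\<in>{..<k}. if i < Suc r then w i ((\<phi>(r := j)) i) else y i)"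
        by (simp add: mult.commute)
    qed
    also have "\<dots> = (\<Sum>\<phi>\<in>{..<Suc r} \<rightarrow>\<^sub>E J. (\<Prod>i<Suc r. c i (\<phi> i)) *\<^sub>R
        A (\<lambda>i\<in>{..<k}. if i < Suc r then w i (\<phi> i) else y i))"
    proof (rule sum.reindex_cong[symmetric])
      show "inj_on (\<lambda>(j, \<phi>). \<phi>(r := j)) (J \<times> ({..<r} \<rightarrow>\<^sub>E J))"
        by (rule inj_combinator) simp
      show "({..<Suc r} \<rightarrow>\<^sub>E J) = (\<lambda>(j, \<phi>). \<phi>(r := j)) ` (J \<times> ({..<r} \<rightarrow>\<^sub>E J))"
        unfolding lessThan_Suc PiE_insert_eq ..
    qed (simp only: case_prod_beta)
    finally show ?case .
  qed
  from this[OF order_refl, of "\<lambda>_. 0"]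
  have "A (\<lambda>i\<in>{..<k}. if i < k then s i else 0) =
      (\<Sum>\<phi>\<in>{..<k} \<rightarrow>\<^sub>E J. (\<Prod>i<k. c i (\<phi> i)) *\<^sub>R A (\<lambda>i\<in>{..<k}. if i < k then w i (\<phi> i) else 0))" .
  moreover have "(\<lambda>i\<in>{..<k}. if i < k then f i else 0) = (\<lambda>i\<in>{..<k}. f i)" for f :: "nat \<Rightarrow> 'a"
    by (auto simp: fun_eq_iff)
  ultimately show ?thesis
    by (simp add: s_def)
qed

text \<open>Polarization: \<open>fact k *\<^sub>R A v\<close> is the alternating sum of the values of the form on the diagonal at
  the points \<open>x0 + (\<Sum>j\<in>S. v j)\<close>, for an arbitrary base point \<open>x0\<close>.\<close>
lemma symmetric_multilinear_bound:
  fixes A :: "(nat \<Rightarrow> 'a::real_normed_vector) \<Rightarrow> 'b::real_normed_vector"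
  assumes A: "continuous_symmetric_multilinear k A"
    and bound: "\<And>h. norm (h - x0) \<le> \<delta> \<Longrightarrow> norm (A (\<lambda>i\<in>{..<k}. h)) \<le> N"
    and v: "\<And>j. j < k \<Longrightarrow> norm (v j) \<le> \<delta> / k"
    and \<delta>: "\<delta> \<ge> 0"
  shows "fact k * norm (A (\<lambda>i\<in>{..<k}. v i)) \<le> 2 ^ k * N"
proof -
  have lin: "linear (\<lambda>x. A (u(i := x)))" if "u \<in> {..<k} \<rightarrow>\<^sub>E UNIV" "i < k" for u i
    using A that unfolding continuous_symmetric_multilinear_def by blast
  have sym: "A (u \<circ> \<pi>) = A u" if "u \<in> {..<k} \<rightarrow>\<^sub>E UNIV" "\<pi> permutes {..<k}" for u \<pi>
    using A that unfolding continuous_symmetric_multilinear_def by blast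
  \<comment> \<open>Index \<open>k\<close> stands for the base point and always has coefficient 1;
    hence \<open>h \<sigma>\<close> is \<open>x0\<close> plus the sum of the \<open>v j\<close>
    selected by \<open>\<sigma>\<close>.\<close>
  define w where "w j = (if j < k then v j else x0)" for j
  define c :: "(nat \<Rightarrow> bool) \<Rightarrow> nat \<Rightarrow> real" where "c \<sigma> j = (if j < k then of_bool (\<sigma> j) else 1)" for \<sigma> j
  define \<Sigma> where "\<Sigma> = ({..<k} \<rightarrow>\<^sub>E (UNIV :: bool set))"
  define sg where "sg \<sigma> = (\<Prod>j<k. if \<sigma> j then 1 else - 1 :: real)" for \<sigma> :: "nat \<Rightarrow> bool"
  define h where "h \<sigma> = (\<Sum>j\<le>k. c \<sigma> j *\<^sub>R w j)" for \<sigma>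
  define \<Phi> where "\<Phi> = {\<phi> \<in> {..<k} \<rightarrow>\<^sub>E {..k}. {..<k} \<subseteq> \<phi> ` {..<k}}"
  have fin: "finite \<Sigma>" "finite ({..<k} \<rightarrow>\<^sub>E {..k})"
    by (auto simp: \<Sigma>_def intro: finite_PiE)
  have card\<Sigma>: "card \<Sigma> = 2 ^ k"
    by (simp add: \<Sigma>_def card_PiE)
  have sg: "\<bar>sg \<sigma>\<bar> = 1" for \<sigma>
    unfolding sg_def abs_prod by (rule prod.neutral) auto
  \<comment> \<open>The signed sum factors over \<open>j < k\<close>. An index missed by
    \<open>\<phi>\<close> contributes \<open>1 - 1 = 0\<close>, an index that is hit contributes
    1.\<close>
  have inner: "(\<Sum>\<sigma>\<in>\<Sigma>. sg \<sigma> * (\<Prod>i<k. c \<sigma> (\<phi> i))) = of_bool ({..<k} \<subseteq> \<phi> ` {..<k})" for \<phi>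
  proof -
    have "(\<Prod>i<k. c \<sigma> (\<phi> i)) = (\<Prod>j<k. if j \<in> \<phi> ` {..<k} then of_bool (\<sigma> j) else 1)" for \<sigma>
    proof (cases "\<forall>j<k. j \<in> \<phi> ` {..<k} \<longrightarrow> \<sigma> j")
      case True
      then have "(\<Prod>i<k. c \<sigma> (\<phi> i)) = 1" "(\<Prod>j<k. if j \<in> \<phi> ` {..<k} then of_bool (\<sigma> j) else 1 :: real) = 1"
        by (auto simp: c_def intro!: prod.neutral)
      then show ?thesis
        by simp
    next
      case False
      then obtain i where i: "i < k" "\<phi> i < k" "\<not> \<sigma> (\<phi> i)"
        by auto
      have "(\<Prod>i<k. c \<sigma> (\<phi> i)) = 0"
        using i by (intro prod_zero bexI[of _ i]) (auto simp: c_def)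
      moreover have "(\<Prod>j<k. if j \<in> \<phi> ` {..<k} then of_bool (\<sigma> j) else 1 :: real) = 0"
        using i by (intro prod_zero bexI[of _ "\<phi> i"]) auto
      ultimately show ?thesis
        by (simp only:)
    qed
    then have "(\<Sum>\<sigma>\<in>\<Sigma>. sg \<sigma> * (\<Prod>i<k. c \<sigma> (\<phi> i))) =
        (\<Sum>\<sigma>\<in>\<Sigma>. \<Prod>j<k. (if \<sigma> j then 1 else - 1) * (if j \<in> \<phi> ` {..<k} then of_bool (\<sigma> j) else 1))"
      by (simp add: sg_def prod.distrib)
    also have "\<dots> = (\<Prod>j<k. \<Sum>s\<in>UNIV. (if s then 1 else - 1) * (if j \<in> \<phi> ` {..<k} then of_bool s else 1))"
      unfolding \<Sigma>_def by (rule prod_sum_PiE[symmetric]) auto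
    also have "\<dots> = (\<Prod>j<k. of_bool (j \<in> \<phi> ` {..<k}))"
      by (rule prod.cong) (auto simp: UNIV_bool)
    also have "\<dots> = of_bool ({..<k} \<subseteq> \<phi> ` {..<k})"
    proof (cases "{..<k} \<subseteq> \<phi> ` {..<k}")
      case True
      then show ?thesis
        by (auto intro!: prod.neutral)
    next
      case False
      then obtain j where "j < k" "j \<notin> \<phi> ` {..<k}"
        by auto
      then have "(\<Prod>j<k. of_bool (j \<in> \<phi> ` {..<k}) :: real) = 0"
        by (intro prod_zero bexI[of _ j]) auto
      then show ?thesis
        using False by simp
    qed
    finally show ?thesis .
  qed
  have perm: "A (\<lambda>i\<in>{..<k}. w (\<phi> i)) = A (\<lambda>i\<in>{..<k}. v i)" if "\<phi> \<in> \<Phi>" for \<phi>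
  proof -
    have \<phi>: "{..<k} \<subseteq> \<phi> ` {..<k}"
      using that by (simp add: \<Phi>_def)
    have im: "\<phi> ` {..<k} = {..<k}"
      by (rule card_seteq[symmetric, OF _ \<phi>]) (auto intro: card_image_le[of "{..<k}" \<phi>, simplified])
    then have "bij_betw \<phi> {..<k} {..<k}"
      using eq_card_imp_inj_on[of "{..<k}" \<phi>] by (simp add: bij_betw_def)
    then have "bij_betw (\<lambda>i. if i < k then \<phi> i else i) {..<k} {..<k}"
      by (subst bij_betw_cong[of _ _ \<phi>]) auto
    then have "(\<lambda>i. if i < k then \<phi> i else i) permutes {..<k}"
      by (rule bij_imp_permutes) simp
    from sym[OF _ this, of "\<lambda>i\<in>{..<k}. v i"]
    have "A ((\<lambda>i\<in>{..<k}. v i) \<circ> (\<lambda>i. if i < k then \<phi> i else i)) = A (\<lambda>i\<in>{..<k}. v i)"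
      by simp
    moreover have "\<phi> i < k" if "i < k" for i
      using im that by blast
    then have "(\<lambda>i\<in>{..<k}. v i) \<circ> (\<lambda>i. if i < k then \<phi> i else i) = (\<lambda>i\<in>{..<k}. w (\<phi> i))"
      by (auto simp: fun_eq_iff w_def)
    ultimately show ?thesis
      by simp
  qed
  \<comment> \<open>The maps in \<open>\<Phi>\<close> restrict permutations of
    \<open>{..<k}\<close>; a lower bound for their number is enough, as the norm of \<open>A\<close>
    is to be bounded from above.\<close>
  have card\<Phi>: "fact k \<le> card \<Phi>"
  proof -
    have "card {p. p permutes {..<k}} \<le> card \<Phi>"
    proof (rule card_inj_on_le[of "\<lambda>p. restrict p {..<k}"])
      show "inj_on (\<lambda>p. restrict p {..<k}) {p. p permutes {..<k}}"
      proof (rule inj_onI, rule ext)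
        fix p q :: "nat \<Rightarrow> nat" and x
        assume pq: "p \<in> {p. p permutes {..<k}}" "q \<in> {p. p permutes {..<k}}" "restrict p {..<k} = restrict q {..<k}"
        show "p x = q x"
        proof (cases "x < k")
          case True
          then show ?thesis
            using fun_cong[OF pq(3), of x] by simp
        next
          case False
          then show ?thesis
            using pq(1,2) permutes_not_in[of p "{..<k}" x] permutes_not_in[of q "{..<k}" x] by simp
        qed
      qed
      show "(\<lambda>p. restrict p {..<k}) ` {p. p permutes {..<k}} \<subseteq> \<Phi>"
      proof clarify
        fix p :: "nat \<Rightarrow> nat" assume p: "p permutes {..<k}"
        have "p ` {..<k} = {..<k}"
          by (rule permutes_image[OF p])
        moreover have "p i \<le> k" if "i < k" for i
          using permutes_in_image[OF p, of i] that by simp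
        ultimately show "restrict p {..<k} \<in> \<Phi>"
          by (auto simp: \<Phi>_def)
      qed
      show "finite \<Phi>"
        unfolding \<Phi>_def using fin(2) by simp
    qed
    then show ?thesis
      by (simp add: card_permutations)
  qed
  have "(\<Sum>\<sigma>\<in>\<Sigma>. sg \<sigma> *\<^sub>R A (\<lambda>i\<in>{..<k}. h \<sigma>)) =
      (\<Sum>\<sigma>\<in>\<Sigma>. \<Sum>\<phi>\<in>{..<k} \<rightarrow>\<^sub>E {..k}. (sg \<sigma> * (\<Prod>i<k. c \<sigma> (\<phi> i))) *\<^sub>R A (\<lambda>i\<in>{..<k}. w (\<phi> i)))"
  proof (rule sum.cong[OF refl])
    fix \<sigma>
    have "A (\<lambda>i\<in>{..<k}. h \<sigma>) = (\<Sum>\<phi>\<in>{..<k} \<rightarrow>\<^sub>E {..k}. (\<Prod>i<k. c \<sigma> (\<phi> i)) *\<^sub>R A (\<lambda>i\<in>{..<k}. w (\<phi> i)))"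
      unfolding h_def by (rule multilinear_expand[OF lin, where c = "\<lambda>_. c \<sigma>" and w = "\<lambda>_. w"])
    then show "sg \<sigma> *\<^sub>R A (\<lambda>i\<in>{..<k}. h \<sigma>) =
        (\<Sum>\<phi>\<in>{..<k} \<rightarrow>\<^sub>E {..k}. (sg \<sigma> * (\<Prod>i<k. c \<sigma> (\<phi> i))) *\<^sub>R A (\<lambda>i\<in>{..<k}. w (\<phi> i)))"
      by (simp add: scaleR_right.sum)
  qed
  also have "\<dots> = (\<Sum>\<phi>\<in>{..<k} \<rightarrow>\<^sub>E {..k}. (\<Sum>\<sigma>\<in>\<Sigma>. sg \<sigma> * (\<Prod>i<k. c \<sigma> (\<phi> i))) *\<^sub>R A (\<lambda>i\<in>{..<k}. w (\<phi> i)))"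
    by (subst sum.swap) (simp add: scaleR_left.sum)
  also have "\<dots> = (\<Sum>\<phi>\<in>\<Phi>. A (\<lambda>i\<in>{..<k}. w (\<phi> i)))"
    unfolding inner \<Phi>_def by (rule sum.mono_neutral_cong_right) (use fin in auto)
  also have "\<dots> = of_nat (card \<Phi>) *\<^sub>R A (\<lambda>i\<in>{..<k}. v i)"
    by (simp add: perm sum_constant_scaleR)
  finally have eq: "of_nat (card \<Phi>) *\<^sub>R A (\<lambda>i\<in>{..<k}. v i) = (\<Sum>\<sigma>\<in>\<Sigma>. sg \<sigma> *\<^sub>R A (\<lambda>i\<in>{..<k}. h \<sigma>))"
    by simp
  have h_bound: "norm (h \<sigma> - x0) \<le> \<delta>" for \<sigma>
  proof -
    have "h \<sigma> = (\<Sum>j<k. c \<sigma> j *\<^sub>R w j) + x0"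
      by (simp add: h_def lessThan_Suc_atMost[symmetric] c_def w_def)
    then have "norm (h \<sigma> - x0) \<le> (\<Sum>j<k. norm (c \<sigma> j *\<^sub>R w j))"
      by (simp only: add_diff_cancel_right' norm_sum)
    also have "\<dots> \<le> (\<Sum>j<k. \<delta> / k)"
    proof (rule sum_mono)
      fix j assume "j \<in> {..<k}"
      then have "norm (w j) \<le> \<delta> / k" "\<bar>c \<sigma> j\<bar> \<le> 1"
        using v by (auto simp: w_def c_def)
      then have "\<bar>c \<sigma> j\<bar> * norm (w j) \<le> 1 * (\<delta> / k)"
        by (intro mult_mono) auto
      then show "norm (c \<sigma> j *\<^sub>R w j) \<le> \<delta> / k"
        by simp
    qed
    also have "\<dots> \<le> \<delta>"
      using \<delta> by (cases "k = 0") auto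
    finally show ?thesis .
  qed
  have "fact k * norm (A (\<lambda>i\<in>{..<k}. v i)) \<le> of_nat (card \<Phi>) * norm (A (\<lambda>i\<in>{..<k}. v i))"
  proof (rule mult_right_mono)
    have "real (fact k) \<le> real (card \<Phi>)"
      using card\<Phi> by (simp only: of_nat_le_iff)
    then show "fact k \<le> real (card \<Phi>)"
      by simp
  qed simp
  also have "\<dots> = norm (\<Sum>\<sigma>\<in>\<Sigma>. sg \<sigma> *\<^sub>R A (\<lambda>i\<in>{..<k}. h \<sigma>))"
    by (simp flip: eq)
  also have "\<dots> \<le> (\<Sum>\<sigma>\<in>\<Sigma>. norm (sg \<sigma> *\<^sub>R A (\<lambda>i\<in>{..<k}. h \<sigma>)))"
    by (rule norm_sum)
  also have "\<dots> \<le> (\<Sum>\<sigma>\<in>\<Sigma>. N)"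
    using bound h_bound by (intro sum_mono) (simp add: sg)
  also have "\<dots> = 2 ^ k * N"
    by (simp add: card\<Sigma>)
  finally show ?thesis .
qed

text \<open>One term of the series for \<open>exp k\<close>. It turns the loss
  \<open>k ^ k / fact k\<close> caused by polarization with vectors of length
  \<open>\<delta> / k\<close> into a geometric factor.\<close>

lemma power_le_exp_fact: "real k ^ k \<le> exp (real k) * fact k"
proof -
  have "(\<Sum>i\<in>{k}. inverse (fact i) * real k ^ i) \<le> (\<Sum>i. inverse (fact i) * real k ^ i)"
    using summable_exp[of "real k"] by (intro sum_le_suminf) auto
  then have "inverse (fact k) * real k ^ k \<le> exp (real k)"
    by (simp add: exp_def)
  then show ?thesis
    by (simp add: field_simps)
qed

lemma diagonal_continuous:
  assumes "continuous_symmetric_multilinear k A"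
  shows "continuous_on UNIV (\<lambda>h. A (\<lambda>i\<in>{..<k}. h))"
proof -
  have "continuous_map euclidean (product_topology (\<lambda>_. euclidean) {..<k}) (\<lambda>h::'a. \<lambda>i\<in>{..<k}. h)"
    unfolding continuous_map_componentwise by auto
  moreover have "continuous_map (product_topology (\<lambda>_. euclidean) {..<k}) euclidean A"
    using assms by (simp add: continuous_symmetric_multilinear_def)
  ultimately have "continuous_map euclidean euclidean (A \<circ> (\<lambda>h. \<lambda>i\<in>{..<k}. h))"
    by (rule continuous_map_compose)
  then show ?thesis
    by (simp add: o_def)
qed

text \<open>Pointwise convergence is turned into a uniform bound on some ball by Baire's theorem.\<close>
lemma power_series_coeff_bound:
  fixes A :: "nat \<Rightarrow> (nat \<Rightarrow> real ^ 'm) \<Rightarrow> 'b::real_normed_vector"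
  assumes A: "\<And>k. continuous_symmetric_multilinear k (A k)"
    and \<epsilon>: "\<epsilon> > 0" and conv: "\<And>h. norm h < \<epsilon> \<Longrightarrow> (\<lambda>k. A k (\<lambda>i\<in>{..<k}. h)) sums f h"
  shows "\<exists>N M. N \<ge> 0 \<and> M > 0 \<and> (\<forall>k \<phi>. norm (A k (\<lambda>i\<in>{..<k}. axis (\<phi> i) 1)) \<le> N * M ^ k)"
proof -
  define r where "r = \<epsilon> / 2"
  have r: "r > 0" "r < \<epsilon>"
    using \<epsilon> by (auto simp: r_def)
  define S where "S = cball (0 :: real ^ 'm) r"
  define E where "E n = {h \<in> S. \<forall>k. norm (A k (\<lambda>i\<in>{..<k}. h)) \<le> real n}" for n
  have closedE: "closed (E n)" for n
  proof -
    have "E n = S \<inter> (\<Inter>k. {h. norm (A k (\<lambda>i\<in>{..<k}. h)) \<le> real n})"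
      by (auto simp: E_def)
    moreover have "closed {h. norm (A k (\<lambda>i\<in>{..<k}. h)) \<le> real n}" for k
      by (intro closed_Collect_le continuous_intros diagonal_continuous A)
    ultimately show ?thesis
      by (auto simp: S_def intro!: closed_Int closed_INT)
  qed
  have "\<exists>n. h \<in> E n" if "h \<in> S" for h
  proof -
    have "norm h < \<epsilon>"
      using that r by (simp add: S_def)
    then have "(\<lambda>k. A k (\<lambda>i\<in>{..<k}. h)) \<longlonglongrightarrow> 0"
      using conv by (intro summable_LIMSEQ_zero) (auto simp: sums_iff)
    then have "Bseq (\<lambda>k. A k (\<lambda>i\<in>{..<k}. h))"
      by (intro convergent_imp_Bseq) (auto simp: convergent_def)
    then obtain B where B: "\<And>k. norm (A k (\<lambda>i\<in>{..<k}. h)) \<le> B"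
      unfolding Bseq_def by blast
    obtain n where "B \<le> real n"
      using real_arch_simple by blast
    then show ?thesis
      using B that by (auto simp: E_def intro: order_trans)
  qed
  then have empty: "(\<Inter>n. S - E n) = {}"
    by blast
  \<comment> \<open>Otherwise the complements \<open>S - E n\<close> would be dense and relatively
    open in \<open>S\<close>, although their intersection is empty.\<close>
  have "\<exists>n. \<not> S \<subseteq> closure (S - E n)"
  proof (rule ccontr)
    assume "\<not> ?thesis"
    then have dense: "S \<subseteq> closure (S - E n)" for n
      by blast
    have "S \<subseteq> closure (\<Inter>(range (\<lambda>n. S - E n)))"
    proof (rule Baire)
      show "closed S"
        by (simp add: S_def)
      show "openin (top_of_set S) T \<and> S \<subseteq> closure T" if T: "T \<in> range (\<lambda>n. S - E n)" for T
      proof -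
        obtain n where n: "T = S - E n"
          using T by blast
        have "openin (top_of_set S) (S \<inter> (- E n))"
          using closedE by (intro openin_open_Int) auto
        then show ?thesis
          using dense n by (simp add: Diff_eq)
      qed
    qed simp
    then have "S = {}"
      unfolding empty by simp
    then show False
      using r by (simp add: S_def)
  qed
  then obtain n x where x: "x \<in> S" "x \<notin> closure (S - E n)"
    by blast
  then obtain d where d: "d > 0" "ball x d \<inter> (S - E n) = {}"
    using open_contains_ball[of "- closure (S - E n)"] closure_subset[of "S - E n"] by blast
  \<comment> \<open>The point found may lie on the boundary of \<open>S\<close>; it is moved to an
    interior point \<open>x0\<close> that has a full ball inside one \<open>E n\<close>.\<close>
  have "x \<in> closure (ball 0 r)"
    using x r by (simp add: S_def)
  then obtain x0 where x0: "x0 \<in> ball 0 r" "dist x0 x < d"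
    using d(1) by (meson closure_approachable)
  have "open (ball 0 r \<inter> ball x d)" "x0 \<in> ball 0 r \<inter> ball x d"
    using x0 by (auto simp: dist_commute)
  then obtain \<delta> where \<delta>: "\<delta> > 0" "cball x0 \<delta> \<subseteq> ball 0 r \<inter> ball x d"
    using open_contains_cball by blast
  have bound: "norm (A k (\<lambda>i\<in>{..<k}. h)) \<le> real n" if "norm (h - x0) \<le> \<delta>" for h k
  proof -
    have "h \<in> cball x0 \<delta>"
      using that by (simp add: dist_norm norm_minus_commute)
    then have "h \<in> ball 0 r" "h \<in> ball x d"
      using \<delta>(2) by auto
    then have "h \<in> E n"
      using d(2) by (auto simp: S_def)
    then show ?thesis
      by (simp add: E_def)
  qed
  \<comment> \<open>Polarization bounds coefficient \<open>k\<close> by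
    \<open>2 ^ k * n / (fact k * (\<delta> / k) ^ k)\<close>, and
    \<open>k ^ k \<le> exp k * fact k\<close>.\<close>
  define M where "M = 2 * exp 1 / \<delta>"
  have M: "M > 0"
    using \<delta> by (simp add: M_def)
  have "norm (A k (\<lambda>i\<in>{..<k}. axis (\<phi> i) 1)) \<le> real n * M ^ k" for k \<phi>
  proof (cases "k = 0")
    case True
    then show ?thesis
      using bound[of x0 0] \<delta> by (simp add: restrict_def)
  next
    case False
    define t where "t = \<delta> / k"
    have t: "t > 0"
      using \<delta> False by (simp add: t_def)
    have lin: "linear (\<lambda>x. A k (u(i := x)))" if "u \<in> {..<k} \<rightarrow>\<^sub>E UNIV" "i < k" for u i
      using A[of k] that unfolding continuous_symmetric_multilinear_def by blast
    \<comment> \<open>Homogeneity of degree \<open>k\<close>, read off from the expansion with a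
      single summand in every slot.\<close>
    have "A k (\<lambda>i\<in>{..<k}. \<Sum>j\<in>{()}. t *\<^sub>R axis (\<phi> i) 1) = (\<Sum>\<psi>\<in>{..<k} \<rightarrow>\<^sub>E {()}. (\<Prod>i<k. t) *\<^sub>R A k (\<lambda>i\<in>{..<k}. axis (\<phi> i) 1))"
      by (rule multilinear_expand[OF lin])
    moreover have "card ({..<k} \<rightarrow>\<^sub>E {()}) = 1"
      by (simp add: card_PiE)
    ultimately have scale: "A k (\<lambda>i\<in>{..<k}. t *\<^sub>R axis (\<phi> i) 1) = t ^ k *\<^sub>R A k (\<lambda>i\<in>{..<k}. axis (\<phi> i) 1)"
      by (simp add: sum_constant_scaleR)
    have "fact k * norm (A k (\<lambda>i\<in>{..<k}. t *\<^sub>R axis (\<phi> i) 1)) \<le> 2 ^ k * real n"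
      by (rule symmetric_multilinear_bound[OF A bound, of x0 \<delta>])
         (use \<delta> t in \<open>auto simp: norm_axis_eq t_def\<close>)
    then have "fact k * t ^ k * norm (A k (\<lambda>i\<in>{..<k}. axis (\<phi> i) 1)) \<le> 2 ^ k * real n"
      unfolding scale using t by simp
    then have "norm (A k (\<lambda>i\<in>{..<k}. axis (\<phi> i) 1)) \<le> 2 ^ k * real n / (fact k * t ^ k)"
      using t by (simp add: field_simps)
    also have "\<dots> = real n * (2 / \<delta>) ^ k * (real k ^ k / fact k)"
      using \<delta> False by (simp add: t_def power_divide field_simps)
    also have "\<dots> \<le> real n * (2 / \<delta>) ^ k * exp (real k)"
      using power_le_exp_fact[of k] \<delta> by (intro mult_left_mono) (auto simp: field_simps)
    also have "\<dots> = real n * M ^ k"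
      by (simp add: M_def power_mult_distrib power_divide exp_of_nat_mult[symmetric])
    finally show ?thesis .
  qed
  then show ?thesis
    using M by (intro exI[of _ "real n"] exI[of _ M]) auto
qed

text \<open>The coefficients of \<open>l \<circ> F\<close> inherit the geometric bound for those of
  \<open>F\<close>, which does not involve \<open>l\<close>. So one radius and one bound
  \<open>B\<close> serve all functionals of norm at most one, as the series over countably many of
  them demands.\<close>

lemma real_analytic_complexification:
  fixes F :: "real ^ 'm \<Rightarrow> 'b::real_normed_vector"
  assumes F: "F real_analytic_on U" and p0: "p0 \<in> U"
  shows "\<exists>\<rho> B. \<rho> > 0 \<and> B \<ge> 0 \<and> (\<forall>l. bounded_linear l \<longrightarrow> (\<forall>T. \<bar>l T\<bar> \<le> norm T) \<longrightarrow>
    (\<exists>G. hol G (ball (cvec p0) \<rho>) \<and> (\<forall>z\<in>ball (cvec p0) \<rho>. norm (G z) \<le> B) \<and>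
      (\<forall>x\<in>ball p0 \<rho>. G (cvec x) = of_real (l (F x)))))"
proof -
  obtain A \<epsilon> where A: "\<And>k. continuous_symmetric_multilinear k (A k)" and \<epsilon>: "\<epsilon> > 0"
      and conv: "\<And>h. norm h < \<epsilon> \<Longrightarrow> (\<lambda>k. A k (\<lambda>i\<in>{..<k}. h)) sums F (p0 + h)"
    using F p0 unfolding real_analytic_on_def by blast
  obtain N M where N: "N \<ge> 0" and M: "M > 0"
      and NM: "\<And>k \<phi>. norm (A k (\<lambda>i\<in>{..<k}. axis (\<phi> i) 1)) \<le> N * M ^ k"
    using power_series_coeff_bound[OF A \<epsilon> conv] by blast
  define m where "m = real CARD('m)"
  have m: "m > 0"
    by (simp add: m_def)
  \<comment> \<open>There are \<open>m ^ k\<close> tuples of indices, so term \<open>k\<close> is at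
    most \<open>N * (m * M * \<rho>) ^ k \<le> N * (1 / 2) ^ k\<close>.\<close>
  define \<rho> where "\<rho> = min \<epsilon> (1 / (2 * m * M))"
  have \<rho>: "\<rho> > 0" "\<rho> \<le> \<epsilon>" "\<rho> \<le> 1 / (2 * m * M)"
    using \<epsilon> m M by (auto simp: \<rho>_def)
  have "\<exists>G. hol G (ball (cvec p0) \<rho>) \<and> (\<forall>z\<in>ball (cvec p0) \<rho>. norm (G z) \<le> 2 * N) \<and>
      (\<forall>x\<in>ball p0 \<rho>. G (cvec x) = of_real (l (F x)))"
    if l: "bounded_linear l" "\<And>T. \<bar>l T\<bar> \<le> norm T" for l
  proof -
    define a where "a k \<phi> = l (A k (\<lambda>i\<in>{..<k}. axis (\<phi> i) 1))" for k \<phi>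
    define t where "t k z = (\<Sum>\<phi>\<in>{..<k} \<rightarrow>\<^sub>E UNIV. (\<Prod>i<k. (z $ \<phi> i - cvec p0 $ \<phi> i)) * of_real (a k \<phi>))" for k and z :: "complex ^ 'm"
    define G where "G z = (\<Sum>k. t k z)" for z
    have bound: "norm (t k z) \<le> N * (1 / 2) ^ k" if z: "z \<in> ball (cvec p0) \<rho>" for k z
    proof -
      have zi: "norm (z $ i - cvec p0 $ i) \<le> \<rho>" for i
        using dist_vec_nth_le[of z i "cvec p0"] z by (simp add: dist_norm norm_minus_commute)
      have "norm (t k z) \<le> (\<Sum>\<phi>\<in>{..<k} \<rightarrow>\<^sub>E (UNIV::'m set). \<rho> ^ k * (N * M ^ k))"
        unfolding t_def
      proof (rule order_trans[OF norm_sum sum_mono])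
        fix \<phi>
        have "norm (\<Prod>i<k. (z $ \<phi> i - cvec p0 $ \<phi> i)) \<le> (\<Prod>i<k. \<rho>)"
          unfolding prod_norm[symmetric] using zi by (intro prod_mono) simp
        moreover have "norm (complex_of_real (a k \<phi>)) \<le> N * M ^ k"
          using l(2) NM unfolding a_def by (auto intro: order_trans)
        ultimately show "norm ((\<Prod>i<k. (z $ \<phi> i - cvec p0 $ \<phi> i)) * of_real (a k \<phi>)) \<le> \<rho> ^ k * (N * M ^ k)"
          unfolding norm_mult using \<rho>(1) by (intro mult_mono) auto
      qed
      also have "\<dots> = N * (m * M * \<rho>) ^ k"
        by (simp add: card_PiE m_def power_mult_distrib)
      also have "\<dots> \<le> N * (1 / 2) ^ k"
      proof (intro mult_left_mono power_mono N)
        show "m * M * \<rho> \<le> 1 / 2"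
          using \<rho>(3) m M by (simp add: field_simps)
      qed (use m M \<rho> in auto)
      finally show ?thesis .
    qed
    have sm: "summable (\<lambda>k. N * (1 / 2) ^ k)"
      by (intro summable_mult summable_geometric) simp
    have lim: "uniform_limit (ball (cvec p0) \<rho>) (\<lambda>n z. \<Sum>k<n. t k z) G sequentially"
      unfolding G_def by (rule Weierstrass_m_test[OF bound sm])
    have "hol G (ball (cvec p0) \<rho>)"
      by (rule hol_uniform_limit[OF _ lim])
         (unfold t_def, intro hol_sum hol_mult hol_prod hol_diff hol_coord hol_const)
    moreover have "norm (G z) \<le> 2 * N" if "z \<in> ball (cvec p0) \<rho>" for z
    proof -
      have "norm (G z) \<le> (\<Sum>k. N * (1 / 2) ^ k)"
        unfolding G_def by (rule norm_suminf_le[OF bound[OF that] sm])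
      also have "\<dots> = 2 * N"
        by (simp add: suminf_mult suminf_geometric summable_geometric)
      finally show ?thesis .
    qed
    moreover have "G (cvec x) = of_real (l (F x))" if x: "x \<in> ball p0 \<rho>" for x
    proof -
      have "t k (cvec x) = of_real (l (A k (\<lambda>i\<in>{..<k}. x - p0)))" for k
      proof -
        have lin: "linear (\<lambda>x. A k (u(i := x)))" if "u \<in> {..<k} \<rightarrow>\<^sub>E UNIV" "i < k" for u i
          using A[of k] that unfolding continuous_symmetric_multilinear_def by blast
        have "x - p0 = (\<Sum>j\<in>UNIV. (x - p0) $ j *\<^sub>R axis j 1)"
          using basis_expansion[of "x - p0", symmetric] unfolding scalar_mult_eq_scaleR .
        then have "A k (\<lambda>i\<in>{..<k}. x - p0) = A k (\<lambda>i\<in>{..<k}. \<Sum>j\<in>UNIV. (x - p0) $ j *\<^sub>R axis j 1)"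
          by (rule arg_cong)
        also have "\<dots> = (\<Sum>\<phi>\<in>{..<k} \<rightarrow>\<^sub>E UNIV. (\<Prod>i<k. (x - p0) $ \<phi> i) *\<^sub>R A k (\<lambda>i\<in>{..<k}. axis (\<phi> i) 1))"
          by (rule multilinear_expand[OF lin, where c = "\<lambda>_ j. (x - p0) $ j" and w = "\<lambda>_ j. axis j 1"])
        finally have "l (A k (\<lambda>i\<in>{..<k}. x - p0)) = (\<Sum>\<phi>\<in>{..<k} \<rightarrow>\<^sub>E UNIV. (\<Prod>i<k. (x - p0) $ \<phi> i) * a k \<phi>)"
          using bounded_linear.linear[OF l(1)] by (simp add: linear_sum linear_scale a_def)
        then show ?thesis
          by (simp add: t_def)
      qed
      moreover have "(\<lambda>k. complex_of_real (l (A k (\<lambda>i\<in>{..<k}. x - p0)))) sums of_real (l (F x))"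
      proof -
        have "norm (x - p0) < \<epsilon>"
          using x \<rho>(2) by (simp add: dist_norm norm_minus_commute)
        from conv[OF this] have "(\<lambda>k. A k (\<lambda>i\<in>{..<k}. x - p0)) sums F x"
          by simp
        from bounded_linear.sums[OF l(1) this] show ?thesis
          by (rule sums_of_real)
      qed
      ultimately show ?thesis
        by (simp add: G_def sums_iff)
    qed
    ultimately show ?thesis
      by blast
  qed
  then show ?thesis
    using \<rho>(1) N by (intro exI[of _ \<rho>] exI[of _ "2 * N"]) auto
qed

section \<open>Reduction to a scalar function\<close>

text \<open>Pairs of points are coded as vectors over a sum type of indices, so that a function on
  \<open>U \<times> U\<close> is again a function on some \<open>real ^ 'k\<close>.\<close>

definition lft :: "'a ^ ('m::finite + 'n::finite) \<Rightarrow> 'a ^ 'm" where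
  "lft v = (\<chi> i. v $ Inl i)"

definition rgt :: "'a ^ ('m::finite + 'n::finite) \<Rightarrow> 'a ^ 'n" where
  "rgt v = (\<chi> i. v $ Inr i)"

lemma lft_nth [simp]: "lft v $ i = v $ Inl i"
  by (simp add: lft_def)

lemma rgt_nth [simp]: "rgt v $ i = v $ Inr i"
  by (simp add: rgt_def)

lemma dist_lft_le: "dist (lft v) (lft w) \<le> dist v w"
proof -
  have "(\<Sum>i\<in>range Inl. (dist (v $ i) (w $ i))\<^sup>2) \<le> (\<Sum>i\<in>UNIV. (dist (v $ i) (w $ i))\<^sup>2)"
    by (rule sum_mono2) auto
  then show ?thesis
    by (simp add: dist_vec_def L2_set_def sum.reindex inj_def)
qed

lemma dist_rgt_le: "dist (rgt v) (rgt w) \<le> dist v w"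
proof -
  have "(\<Sum>i\<in>range Inr. (dist (v $ i) (w $ i))\<^sup>2) \<le> (\<Sum>i\<in>UNIV. (dist (v $ i) (w $ i))\<^sup>2)"
    by (rule sum_mono2) auto
  then show ?thesis
    by (simp add: dist_vec_def L2_set_def sum.reindex inj_def)
qed

lemma cvec_lft: "lft (cvec v) = cvec (lft v)"
  by (simp add: vec_eq_iff)

lemma cvec_rgt: "rgt (cvec v) = cvec (rgt v)"
  by (simp add: vec_eq_iff)

lemma ex_lft_rgt: "\<exists>v. lft v = p \<and> rgt v = q"
  by (rule exI[of _ "\<chi> i. case i of Inl i \<Rightarrow> p $ i | Inr i \<Rightarrow> q $ i"]) (simp add: vec_eq_iff)

lemma compact_lft_rgt:
  fixes K :: "(real ^ 'm) set" and L :: "(real ^ 'n) set"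
  assumes "compact K" "compact L"
  shows "compact {v. lft v \<in> K \<and> rgt v \<in> L}"
proof -
  define J :: "(real ^ 'm) \<times> (real ^ 'n) \<Rightarrow> real ^ ('m + 'n)" where
    "J = (\<lambda>(p, q). \<chi> i. case i of Inl i \<Rightarrow> p $ i | Inr i \<Rightarrow> q $ i)"
  have "continuous_on UNIV (\<lambda>pq. \<chi> i. case i of Inl i \<Rightarrow> fst pq $ i | Inr i \<Rightarrow> snd pq $ i :: real)"
    by (rule continuous_on_vec_lambda, rename_tac i, case_tac i) (auto intro!: continuous_intros)
  then have "continuous_on (K \<times> L) J"
    by (auto simp: J_def case_prod_beta intro: continuous_on_subset)
  moreover have "{v. lft v \<in> K \<and> rgt v \<in> L} = J ` (K \<times> L)"
  proof (intro equalityI subsetI)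
    fix v assume "v \<in> {v. lft v \<in> K \<and> rgt v \<in> L}"
    moreover have "v = J (lft v, rgt v)"
      by (auto simp: J_def vec_eq_iff split: sum.split)
    ultimately show "v \<in> J ` (K \<times> L)"
      by (intro image_eqI[of _ _ "(lft v, rgt v)"]) auto
  next
    fix v assume "v \<in> J ` (K \<times> L)"
    then obtain p q where "p \<in> K" "q \<in> L" "v = J (p, q)"
      by blast
    moreover have "lft (J (p, q)) = p" "rgt (J (p, q)) = q"
      by (auto simp: J_def vec_eq_iff)
    ultimately show "v \<in> {v. lft v \<in> K \<and> rgt v \<in> L}"
      by simp
  qed
  ultimately show ?thesis
    using assms by (auto intro: compact_continuous_image compact_Times)
qed

text \<open>Matrix entries of \<open>T\<close> at the points of two countable dense sets, scaled to
  norm at most one. An operator with all these entries zero vanishes by continuity, in the second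
  vector and then in the first.\<close>

lemma separating_functionals:
  assumes X: "\<exists>D :: 'x set. countable D \<and> closure D = UNIV"
    and Y: "\<exists>D :: 'y set. countable D \<and> closure D = UNIV"
  obtains l :: "nat \<Rightarrow> ('x::real_inner \<Rightarrow>\<^sub>L 'y::real_inner) \<Rightarrow> real"
  where "\<And>k. bounded_linear (l k)" "\<And>k T. \<bar>l k T\<bar> \<le> norm T" "\<And>T. (\<And>k. l k T = 0) \<Longrightarrow> T = 0"
proof -
  obtain D :: "'x set" and E :: "'y set" where D: "countable D" "closure D = UNIV"
      and E: "countable E" "closure E = UNIV"
    using X Y by blast
  have ne: "D \<noteq> {}" "E \<noteq> {}"
    using D(2) E(2) by auto
  define x where "x k = from_nat_into D (fst (prod_decode k))" for k
  define y where "y k = from_nat_into E (snd (prod_decode k))" for k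
  \<comment> \<open>The summand 1 keeps the denominator positive when one of the vectors is
    zero.\<close>
  define l where "l k T = inner (y k) (blinfun_apply T (x k)) / (1 + norm (x k) * norm (y k))" for k and T :: "'x \<Rightarrow>\<^sub>L 'y"
  have pos: "1 + norm (x k) * norm (y k) > 0" for k
    by (intro add_pos_nonneg) auto
  show thesis
  proof
    show "bounded_linear (l k)" for k
      unfolding l_def
      by (intro bounded_linear_compose[OF bounded_linear_divide] bounded_linear_compose[OF bounded_linear_inner_right]
          blinfun.bounded_linear_left)
    show "\<bar>l k T\<bar> \<le> norm T" for k T
    proof -
      have "\<bar>inner (y k) (T (x k))\<bar> \<le> norm (y k) * norm (T (x k))"
        by (rule Cauchy_Schwarz_ineq2)
      also have "\<dots> \<le> norm (y k) * (norm T * norm (x k))"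
        by (intro mult_left_mono norm_blinfun) auto
      also have "\<dots> \<le> norm T * (1 + norm (x k) * norm (y k))"
        by (simp add: algebra_simps)
      finally show ?thesis
        using pos[of k] by (simp add: l_def pos_divide_le_eq)
    qed
    show "T = 0" if T: "\<And>k. l k T = 0" for T
    proof -
      have orth: "inner v (T u) = 0" if uv: "u \<in> D" "v \<in> E" for u v
      proof -
        obtain i j where "u = from_nat_into D i" "v = from_nat_into E j"
          using uv from_nat_into_surj[OF D(1)] from_nat_into_surj[OF E(1)] by blast
        then have "u = x (prod_encode (i, j))" "v = y (prod_encode (i, j))"
          by (simp_all add: x_def y_def)
        then show ?thesis
          using T[of "prod_encode (i, j)"] pos[of "prod_encode (i, j)"] by (simp add: l_def)
      qed
      have "inner v (T u) = 0" if "u \<in> D" for u v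
      proof (rule continuous_constant_on_closure[of E "\<lambda>v. inner v (T u)"])
        show "continuous_on (closure E) (\<lambda>v. inner v (T u))"
          by (intro continuous_intros)
      qed (use that E(2) orth in auto)
      then have TD: "T u = 0" if "u \<in> D" for u
        using that inner_eq_zero_iff by blast
      have "T u = 0" for u
      proof (rule continuous_constant_on_closure[of D "\<lambda>u. T u"])
        show "continuous_on (closure D) (\<lambda>u. T u)"
          by (intro continuous_intros)
      qed (use D(2) TD in auto)
      then show ?thesis
        by (intro blinfun_eqI) simp
    qed
  qed
qed

text \<open>On one complex ball all the squares are bounded by the same
  \<open>(B1 + B2)\<^sup>2\<close>, so the weights \<open>(1 / 2) ^ k\<close> make the series of
  holomorphic extensions converge uniformly.\<close>

lemma ranalytic_weighted_difference_series:
  fixes F :: "real ^ 'm \<Rightarrow> 'b::real_normed_vector" and a :: "real ^ ('m + 'm)"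
  assumes F: "F real_analytic_on U" and a: "lft a \<in> U" "rgt a \<in> U"
    and l: "\<And>k. bounded_linear (l k)" "\<And>k T. \<bar>l k T\<bar> \<le> norm T"
  shows "ranalytic (\<lambda>v. \<Sum>k. (1 / 2) ^ k * (l k (F (lft v)) - l k (F (rgt v)))\<^sup>2) a"
proof -
  obtain \<rho>1 B1 where \<rho>1: "\<rho>1 > 0" and B1: "B1 \<ge> 0"
    and *: "\<forall>l. bounded_linear l \<longrightarrow> (\<forall>T. \<bar>l T\<bar> \<le> norm T) \<longrightarrow> (\<exists>G. hol G (ball (cvec (lft a)) \<rho>1) \<and>
      (\<forall>z\<in>ball (cvec (lft a)) \<rho>1. norm (G z) \<le> B1) \<and> (\<forall>x\<in>ball (lft a) \<rho>1. G (cvec x) = of_real (l (F x))))"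
    using real_analytic_complexification[OF F a(1)] by blast
  obtain \<rho>2 B2 where \<rho>2: "\<rho>2 > 0" and B2: "B2 \<ge> 0"
    and **: "\<forall>l. bounded_linear l \<longrightarrow> (\<forall>T. \<bar>l T\<bar> \<le> norm T) \<longrightarrow> (\<exists>G. hol G (ball (cvec (rgt a)) \<rho>2) \<and>
      (\<forall>z\<in>ball (cvec (rgt a)) \<rho>2. norm (G z) \<le> B2) \<and> (\<forall>x\<in>ball (rgt a) \<rho>2. G (cvec x) = of_real (l (F x))))"
    using real_analytic_complexification[OF F a(2)] by blast
  have "\<forall>k. \<exists>G. hol G (ball (cvec (lft a)) \<rho>1) \<and> (\<forall>z\<in>ball (cvec (lft a)) \<rho>1. norm (G z) \<le> B1) \<and>
      (\<forall>x\<in>ball (lft a) \<rho>1. G (cvec x) = of_real (l k (F x)))"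
    using * l by blast
  from choice[OF this] obtain G1 where G1: "\<And>k. hol (G1 k) (ball (cvec (lft a)) \<rho>1)"
      "\<And>k z. z \<in> ball (cvec (lft a)) \<rho>1 \<Longrightarrow> norm (G1 k z) \<le> B1"
      "\<And>k x. x \<in> ball (lft a) \<rho>1 \<Longrightarrow> G1 k (cvec x) = of_real (l k (F x))"
    by blast
  have "\<forall>k. \<exists>G. hol G (ball (cvec (rgt a)) \<rho>2) \<and> (\<forall>z\<in>ball (cvec (rgt a)) \<rho>2. norm (G z) \<le> B2) \<and>
      (\<forall>x\<in>ball (rgt a) \<rho>2. G (cvec x) = of_real (l k (F x)))"
    using ** l by blast
  from choice[OF this] obtain G2 where G2: "\<And>k. hol (G2 k) (ball (cvec (rgt a)) \<rho>2)"
      "\<And>k z. z \<in> ball (cvec (rgt a)) \<rho>2 \<Longrightarrow> norm (G2 k z) \<le> B2"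
      "\<And>k x. x \<in> ball (rgt a) \<rho>2 \<Longrightarrow> G2 k (cvec x) = of_real (l k (F x))"
    by blast
  define \<rho> where "\<rho> = min \<rho>1 \<rho>2"
  define t where "t k z = (1 / 2) ^ k * (G1 k (lft z) - G2 k (rgt z))\<^sup>2" for k z
  have in1: "lft z \<in> ball (cvec (lft a)) \<rho>1" and in2: "rgt z \<in> ball (cvec (rgt a)) \<rho>2"
    if "z \<in> ball (cvec a) \<rho>" for z
    using that dist_lft_le[of "cvec a" z] dist_rgt_le[of "cvec a" z] by (auto simp: \<rho>_def cvec_lft cvec_rgt)
  have bound: "norm (t k z) \<le> (B1 + B2)\<^sup>2 * (1 / 2) ^ k" if z: "z \<in> ball (cvec a) \<rho>" for k z
  proof -
    have "norm (G1 k (lft z) - G2 k (rgt z)) \<le> B1 + B2"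
      using norm_triangle_ineq4[of "G1 k (lft z)" "G2 k (rgt z)"] G1(2)[OF in1[OF z], of k] G2(2)[OF in2[OF z], of k]
      by linarith
    then have "norm (G1 k (lft z) - G2 k (rgt z)) ^ 2 \<le> (B1 + B2)\<^sup>2"
      by (intro power_mono) auto
    then show ?thesis
      by (simp add: t_def norm_mult norm_power norm_divide field_simps)
  qed
  have sm: "summable (\<lambda>k. (B1 + B2)\<^sup>2 * (1 / 2) ^ k)"
    by (intro summable_mult summable_geometric) simp
  have lim: "uniform_limit (ball (cvec a) \<rho>) (\<lambda>n z. \<Sum>k<n. t k z) (\<lambda>z. \<Sum>k. t k z) sequentially"
    by (rule Weierstrass_m_test[OF bound sm])
  have h1: "hol (\<lambda>z. G1 k (lft z)) (ball (cvec a) \<rho>)" for k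
    by (rule hol_compose[OF G1(1)]) (use in1 in \<open>auto intro: hol_coord\<close>)
  have h2: "hol (\<lambda>z. G2 k (rgt z)) (ball (cvec a) \<rho>)" for k
    by (rule hol_compose[OF G2(1)]) (use in2 in \<open>auto intro: hol_coord\<close>)
  have hol: "hol (\<lambda>z. \<Sum>k. t k z) (ball (cvec a) \<rho>)"
    by (rule hol_uniform_limit[OF _ lim])
       (unfold t_def, intro hol_sum hol_mult hol_power hol_diff hol_const h1 h2)
  show ?thesis
  proof (rule ranalyticI[OF _ hol])
    show "\<rho> > 0"
      using \<rho>1 \<rho>2 by (simp add: \<rho>_def)
    fix v assume v: "v \<in> ball a \<rho>"
    then have cv: "cvec v \<in> ball (cvec a) \<rho>"
      by (simp only: cvec_in_ball)
    have eq: "t k (cvec v) = of_real ((1 / 2) ^ k * (l k (F (lft v)) - l k (F (rgt v)))\<^sup>2)" for k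
    proof -
      have "lft v \<in> ball (lft a) \<rho>1" "rgt v \<in> ball (rgt a) \<rho>2"
        using in1[OF cv] in2[OF cv] by (simp_all only: cvec_lft cvec_rgt cvec_in_ball)
      then show ?thesis
        using G1(3) G2(3) by (simp add: t_def cvec_lft cvec_rgt)
    qed
    have "summable (\<lambda>k. t k (cvec v))"
      by (rule summable_comparison_test'[OF sm bound[OF cv]])
    then have "summable (\<lambda>k. (1 / 2) ^ k * (l k (F (lft v)) - l k (F (rgt v)))\<^sup>2)"
      unfolding eq by (simp only: summable_of_real_iff)
    then show "(\<Sum>k. t k (cvec v)) = of_real (\<Sum>k. (1 / 2) ^ k * (l k (F (lft v)) - l k (F (rgt v)))\<^sup>2)"
      unfolding eq by (simp only: suminf_of_real)
  qed
qed

lemma continuously_differentiable_locally_lipschitz: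
  fixes R :: "'a::real_normed_vector \<Rightarrow> 'b::real_normed_vector"
  assumes R: "R continuously_differentiable_on U" and U: "open U" "p \<in> U"
  obtains \<delta> L where "\<delta> > 0" "ball p \<delta> \<subseteq> U" "L \<ge> 0"
    "\<And>x y. x \<in> ball p \<delta> \<Longrightarrow> y \<in> ball p \<delta> \<Longrightarrow> norm (R x - R y) \<le> L * dist x y"
proof -
  obtain R' where R': "\<And>x. x \<in> U \<Longrightarrow> (R has_derivative blinfun_apply (R' x)) (at x)"
      and cont: "continuous_on U R'"
    using R unfolding continuously_differentiable_on_def by blast
  have "continuous (at p) R'"
    using cont U continuous_on_eq_continuous_at by blast
  then obtain d where d: "d > 0" "\<And>x. dist x p < d \<Longrightarrow> dist (R' x) (R' p) < 1"
    unfolding continuous_at_eps_delta by (metis zero_less_one)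
  obtain e where e: "e > 0" "ball p e \<subseteq> U"
    using U open_contains_ball by blast
  define \<delta> where "\<delta> = min d e"
  have sub: "ball p \<delta> \<subseteq> U"
    using e by (auto simp: \<delta>_def)
  have "norm (R x - R y) \<le> (norm (R' p) + 1) * dist x y" if "x \<in> ball p \<delta>" "y \<in> ball p \<delta>" for x y
    unfolding dist_norm
  proof (rule differentiable_bound[OF _ _ _ that])
    show "convex (ball p \<delta>)"
      by simp
    show "(R has_derivative blinfun_apply (R' x)) (at x within ball p \<delta>)" if "x \<in> ball p \<delta>" for x
      using R' sub that by (blast intro: has_derivative_at_withinI)
    show "onorm (blinfun_apply (R' x)) \<le> norm (R' p) + 1" if "x \<in> ball p \<delta>" for x
    proof -
      have "norm (R' x - R' p) < 1"
        using d(2)[of x] that by (simp add: \<delta>_def dist_norm norm_minus_commute)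
      then show ?thesis
        using norm_triangle_ineq2[of "R' x" "R' p"] by (simp add: norm_blinfun.rep_eq)
    qed
  qed
  then show thesis
    using that[of \<delta> "norm (R' p) + 1"] d(1) e(1) sub by (simp add: \<delta>_def)
qed

theorem theoremA:
  fixes U :: "(real ^ 'm) set"
    and F :: "real ^ 'm \<Rightarrow>
      ('x::{real_inner, complete_space}) \<Rightarrow>\<^sub>L ('y::{real_inner, complete_space})"
    and R :: "real ^ 'm \<Rightarrow> real ^ 'r"
  assumes "open U"
    and separable_X: "\<exists>D :: 'x set. countable D \<and> closure D = UNIV"
    and separable_Y: "\<exists>D :: 'y set. countable D \<and> closure D = UNIV"
    and "F real_analytic_on U"
    and "R continuously_differentiable_on U"
    and "\<And>p q. p \<in> U \<Longrightarrow> q \<in> U \<Longrightarrow> F p = F q \<Longrightarrow> R p = R q"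
  shows "\<forall>K. compact K \<and> K \<subseteq> U \<longrightarrow>
    (\<exists>C \<theta>. C > 0 \<and> 0 < \<theta> \<and> \<theta> \<le> 1 \<and>
      (\<forall>p\<in>K. \<forall>q\<in>K. norm (R p - R q) \<le> C * norm (F p - F q) powr \<theta>))"
proof (intro allI impI, elim conjE)
  fix K assume K: "compact K" "K \<subseteq> U"
  obtain l :: "nat \<Rightarrow> ('x \<Rightarrow>\<^sub>L 'y) \<Rightarrow> real" where l: "\<And>k. bounded_linear (l k)" "\<And>k T. \<bar>l k T\<bar> \<le> norm T"
      and l0: "\<And>T. (\<And>k. l k T = 0) \<Longrightarrow> T = 0"
    using separating_functionals[OF separable_X separable_Y] by blast
  have l_diff: "l k (S - T) = l k S - l k T" for k S T
    using bounded_linear.linear[OF l(1)] by (rule linear_diff)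
  define f where "f v = (\<Sum>k. (1 / 2) ^ k * (l k (F (lft v)) - l k (F (rgt v)))\<^sup>2)" for v
  have sm: "summable (\<lambda>k. (norm T)\<^sup>2 * (1 / 2) ^ k)" for T :: "'x \<Rightarrow>\<^sub>L 'y"
    by (intro summable_mult summable_geometric) simp
  have term_le: "(1 / 2) ^ k * (l k S - l k T)\<^sup>2 \<le> (norm (S - T))\<^sup>2 * (1 / 2) ^ k" for k S T
    using power_mono[OF l(2)[of k "S - T"], of 2] by (simp add: l_diff field_simps)
  have sf: "summable (\<lambda>k. (1 / 2) ^ k * (l k S - l k T)\<^sup>2)" for S T
    by (rule summable_comparison_test'[OF sm[of "S - T"]]) (use term_le in auto)
  have f_nonneg: "0 \<le> f v" for v
    unfolding f_def by (intro suminf_nonneg sf) simp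
  have f_le: "f v \<le> 2 * (norm (F (lft v) - F (rgt v)))\<^sup>2" for v
  proof -
    have "f v \<le> (\<Sum>k. (norm (F (lft v) - F (rgt v)))\<^sup>2 * (1 / 2) ^ k)"
      unfolding f_def by (intro suminf_le sf sm term_le)
    also have "\<dots> = 2 * (norm (F (lft v) - F (rgt v)))\<^sup>2"
      by (simp add: suminf_mult suminf_geometric summable_geometric)
    finally show ?thesis .
  qed
  have f_zero: "F (lft v) = F (rgt v)" if "f v = 0" for v
  proof -
    have "(1 / 2) ^ k * (l k (F (lft v)) - l k (F (rgt v)))\<^sup>2 = 0" for k
      using that suminf_eq_zero_iff[OF sf] unfolding f_def by simp
    then have "l k (F (lft v) - F (rgt v)) = 0" for k
      by (simp add: l_diff)
    then show ?thesis
      using l0 by (metis eq_iff_diff_eq_0)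
  qed
  define K2 where "K2 = {v :: real ^ ('m + 'm). lft v \<in> K \<and> rgt v \<in> K}"
  have K2: "compact K2"
    unfolding K2_def by (intro compact_lft_rgt K)
  have "bounded (R ` K)"
  proof (intro compact_imp_bounded compact_continuous_image K)
    have "continuous_on U R"
      using assms(5) unfolding continuously_differentiable_on_def
      by (metis continuous_at_imp_continuous_on has_derivative_continuous)
    then show "continuous_on K R"
      using K(2) continuous_on_subset by blast
  qed
  then obtain M where M: "M > 0" "\<And>p. p \<in> K \<Longrightarrow> norm (R p) \<le> M"
    by (auto simp: bounded_pos)
  \<comment> \<open>Division by \<open>2 * M\<close> brings \<open>g\<close> into the interval from
    0 to 1 on \<open>K2\<close>, as \<open>pow_dominated\<close> requires.\<close>
  define g where "g v = norm (R (lft v) - R (rgt v)) / (2 * M)" for v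
  have g_nonneg: "0 \<le> g v" for v
    using M(1) by (simp add: g_def)
  have g_le_1: "g v \<le> 1" if "v \<in> K2" for v
  proof -
    have "norm (R (lft v)) \<le> M" "norm (R (rgt v)) \<le> M"
      using that by (auto simp: K2_def intro: M(2))
    then have "norm (R (lft v) - R (rgt v)) \<le> 2 * M"
      using norm_triangle_ineq4[of "R (lft v)" "R (rgt v)"] by linarith
    then show ?thesis
      using M(1) by (simp add: g_def)
  qed
  have "pow_dominated g f K2"
  proof (rule pow_dominated_compact[OF K2])
    fix c assume c: "c \<in> K2"
    then have cU: "lft c \<in> U" "rgt c \<in> U"
      using K(2) by (auto simp: K2_def)
    obtain \<delta>1 L1 where 1: "\<delta>1 > 0" "ball (lft c) \<delta>1 \<subseteq> U" "L1 \<ge> 0"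
      "\<And>x y. x \<in> ball (lft c) \<delta>1 \<Longrightarrow> y \<in> ball (lft c) \<delta>1 \<Longrightarrow> norm (R x - R y) \<le> L1 * dist x y"
      by (rule continuously_differentiable_locally_lipschitz[OF assms(5,1) cU(1)]) blast
    obtain \<delta>2 L2 where 2: "\<delta>2 > 0" "ball (rgt c) \<delta>2 \<subseteq> U" "L2 \<ge> 0"
      "\<And>x y. x \<in> ball (rgt c) \<delta>2 \<Longrightarrow> y \<in> ball (rgt c) \<delta>2 \<Longrightarrow> norm (R x - R y) \<le> L2 * dist x y"
      by (rule continuously_differentiable_locally_lipschitz[OF assms(5,1) cU(2)]) blast
    define N where "N = ball c (min \<delta>1 \<delta>2)"
    have N: "lft x \<in> ball (lft c) \<delta>1" "rgt x \<in> ball (rgt c) \<delta>2" if "x \<in> N" for x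
      using that dist_lft_le[of c x] dist_rgt_le[of c x] by (auto simp: N_def)
    have "ranalytic f c"
      unfolding f_def by (rule ranalytic_weighted_difference_series[OF assms(4) cU l])
    moreover have "open N" "c \<in> N"
      using 1(1) 2(1) by (auto simp: N_def)
    moreover have "\<bar>g x - g y\<bar> \<le> ((L1 + L2) / (2 * M)) * dist x y" if "x \<in> N" "y \<in> N" for x y
    proof -
      have "\<bar>norm (R (lft x) - R (rgt x)) - norm (R (lft y) - R (rgt y))\<bar>
          \<le> norm ((R (lft x) - R (rgt x)) - (R (lft y) - R (rgt y)))"
        by (rule norm_triangle_ineq3)
      also have "\<dots> = norm ((R (lft x) - R (lft y)) - (R (rgt x) - R (rgt y)))"
        by (simp add: algebra_simps)
      also have "\<dots> \<le> norm (R (lft x) - R (lft y)) + norm (R (rgt x) - R (rgt y))"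
        by (rule norm_triangle_ineq4)
      also have "\<dots> \<le> L1 * dist (lft x) (lft y) + L2 * dist (rgt x) (rgt y)"
        using N that by (intro add_mono 1(4) 2(4)) auto
      also have "\<dots> \<le> L1 * dist x y + L2 * dist x y"
        using 1(3) 2(3) by (intro add_mono mult_left_mono dist_lft_le dist_rgt_le)
      finally show ?thesis
        using M(1) by (simp add: g_def diff_divide_distrib[symmetric] field_simps)
    qed
    moreover have "g x = 0" if "x \<in> N" "f x = 0" for x
      using assms(6)[OF subsetD[OF 1(2) N(1)[OF that(1)]] subsetD[OF 2(2) N(2)[OF that(1)]] f_zero[OF that(2)]]
      by (simp add: g_def)
    ultimately obtain n C where "C \<ge> 0" and ev: "\<forall>\<^sub>F x in nhds c. \<bar>g x\<bar> ^ n \<le> C * \<bar>f x\<bar>"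
      using lojasiewicz_local[of f c N g "(L1 + L2) / (2 * M)"] by blast
    moreover obtain W where "open W" "c \<in> W" "\<And>x. x \<in> W \<Longrightarrow> \<bar>g x\<bar> ^ n \<le> C * \<bar>f x\<bar>"
      using ev unfolding eventually_nhds by blast
    ultimately show "\<exists>W. open W \<and> c \<in> W \<and> pow_dominated g f (K2 \<inter> W)"
      using g_nonneg g_le_1 f_nonneg unfolding pow_dominated_def by (intro exI[of _ W] conjI exI[of _ n] exI[of _ C]) auto
  qed
  then obtain n C where C: "C \<ge> 0" and gC: "\<And>v. v \<in> K2 \<Longrightarrow> g v ^ n \<le> C * f v"
    unfolding pow_dominated_def by blast
  \<comment> \<open>From \<open>g ^ n \<le> C * f\<close> and \<open>f \<le> 2 * H\<^sup>2\<close>,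
    with \<open>H\<close> the norm of \<open>F p - F q\<close>. As \<open>g \<le> 1\<close>, the
    exponent may be raised to \<open>n + 2\<close>, which keeps \<open>\<theta> \<le> 1\<close> and
    covers \<open>n = 0\<close>; \<open>2 * C + 1\<close> instead of \<open>2 * C\<close> keeps the
    constant positive.\<close>
  define \<theta> where "\<theta> = 2 / (real n + 2)"
  define C' where "C' = 2 * M * (2 * C + 1) powr (1 / (real n + 2))"
  have "norm (R p - R q) \<le> C' * norm (F p - F q) powr \<theta>" if pq: "p \<in> K" "q \<in> K" for p q
  proof -
    obtain v where v: "lft v = p" "rgt v = q"
      using ex_lft_rgt by blast
    then have vK: "v \<in> K2"
      using pq by (simp add: K2_def)
    define H where "H = norm (F p - F q)"
    have "g v ^ (n + 2) \<le> g v ^ n"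
      using g_nonneg[of v] g_le_1 vK by (intro power_decreasing) auto
    also have "\<dots> \<le> C * (2 * H\<^sup>2)"
      using f_le[of v] by (intro order_trans[OF gC[OF vK]] mult_left_mono C) (simp add: H_def v)
    also have "\<dots> \<le> (2 * C + 1) * H\<^sup>2"
      by (simp add: algebra_simps)
    finally have main: "g v ^ (n + 2) \<le> (2 * C + 1) * H\<^sup>2" .
    have "g v \<le> (2 * C + 1) powr (1 / (real n + 2)) * H powr \<theta>"
    \<comment> \<open>Real powers are manipulated for positive bases only. For \<open>H = 0\<close>
      the right side is \<open>0 powr \<theta> = 0\<close>, and \<open>main\<close> forces
      \<open>g v = 0\<close>.\<close>
    proof (cases "g v = 0 \<or> H = 0")
      case True
      then have "g v = 0"
        using main zero_less_power[of "g v" "n + 2"] g_nonneg[of v]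
        by (cases "g v = 0") (auto simp del: zero_less_power power_add_numeral add_2_eq_Suc')
      then show ?thesis
        by simp
    next
      case False
      then have pos: "g v > 0" "H > 0"
        using g_nonneg[of v] by (auto simp: H_def)
      have "g v = (g v ^ (n + 2)) powr (1 / (real n + 2))"
        unfolding powr_realpow[OF pos(1), symmetric] powr_powr using pos by (simp add: add.commute)
      also have "\<dots> \<le> ((2 * C + 1) * H\<^sup>2) powr (1 / (real n + 2))"
        using main pos by (intro powr_mono2) auto
      also have "\<dots> = (2 * C + 1) powr (1 / (real n + 2)) * H powr \<theta>"
        using powr_realpow[OF pos(2), of 2, symmetric] C by (simp add: powr_mult \<theta>_def powr_powr)
      finally show ?thesis .
    qed
    then have "2 * M * g v \<le> 2 * M * ((2 * C + 1) powr (1 / (real n + 2)) * H powr \<theta>)"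
      using M(1) by (intro mult_left_mono) auto
    then show ?thesis
      using M(1) v by (simp add: g_def C'_def H_def mult.assoc)
  qed
  moreover have "C' > 0" "0 < \<theta>" "\<theta> \<le> 1"
    using M(1) C by (auto simp: C'_def \<theta>_def)
  ultimately show "\<exists>C \<theta>. C > 0 \<and> 0 < \<theta> \<and> \<theta> \<le> 1 \<and> (\<forall>p\<in>K. \<forall>q\<in>K. norm (R p - R q) \<le> C * norm (F p - F q) powr \<theta>)"
    by blast
qed

end
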